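(* Let $F(\cdot;\xi)$, $f(x)=\mathbb{E}_\xi[F(x;\xi)]$ and $L$ be as in the context (stochastic components Lipschitz with $\mathbb{E}_\xi[L(\xi)^2]\le L^2$). Suppose that $f$ is convex and that $\mathcal{X}^*=\arg\min_{x\in\mathbb{R}^d}f(x)$ is non-empty. Let $\delta,\epsilon>0$, $x_0\in\mathbb{R}^d$ and $R=\mathrm{dist}(x_0,\mathcal{X}^* )$. Then the algorithm WS-GFM$^+$ (defined in the context) started at $x_0$, with an appropriate parameter setting, outputs a $(\delta,\epsilon)$-Goldstein stationary point of $f$ in expectation (i.e. its output $\hat x$ satisfies $\mathbb{E}\,\mathrm{dist}(0,\partial_\delta f(\hat x))\le\epsilon$) within a stochastic zeroth-order oracle complexity of $$\mathcal{O}\left(\frac{d^{3/2}L^3}{\epsilon^3}+\frac{d^{4/3}L^2R^{2/3}}{\delta^{2/3}\epsilon^2}\right).$$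
   Context: Setting. $f:\mathbb{R}^d\to\mathbb{R}$ has the form $f(x)=\mathbb{E}_\xi[F(x;\xi)]$ with $\xi$ a random index. For every $\xi$, $|F(x;\xi)-F(y;\xi)|\le L(\xi)\|x-y\|$ for all $x,y\in\mathbb{R}^d$ (Euclidean norm), and $\mathbb{E}_\xi[L(\xi)^2]\le L^2$ for a constant $L>0$. $\mathrm{dist}(x,A)=\inf_{y\in A}\|x-y\|$. Goldstein subdifferential. For Lipschitz $f$, the Clarke subdifferential is $\partial f(x)=\mathrm{conv}\{g: g=\lim_{x_k\to x}\nabla f(x_k)\}$ (limits along sequences of differentiability points), and $\partial_\delta f(x)=\mathrm{conv}\big(\bigcup_{\|y-x\|\le\delta}\partial f(y)\big)$. A point $x$ is $(\delta,\epsilon)$-Goldstein stationary if $\mathrm{dist}(0,\partial_\delta f(x))\le\epsilon$. Gradient estimators. With a smoothing parameter $\rho>0$ and $w$ in the unit sphere $\mathbb{S}\subset\mathbb{R}^d$, $g(x;w,\xi)=\frac{d}{2\rho}\big(F(x+\rho w;\xi)-F(x-\rho w;\xi)\big)w$. For $S=\{(\xi_i,w_i)\}_{i=1}^b$ with $\xi_i$ i.i.d. copies of $\xi$ and $w_i$ i.i.d. uniform on $\mathbb{S}$, $g(x;S)=\frac1b\sum_{i=1}^b g(x;w_i,\xi_i)$. Algorithm GFM$(x_0,\eta,T)$. For $t=0,\dots,T-1$: sample independently $w_t$ uniform on $\mathbb{S}$ and a fresh $\xi_t$; set $x_{t+1}=x_t-\eta g(x_t;w_t,\xi_t)$. Return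 a point chosen uniformly at random from $\{x_t\}_{t=0}^{T-1}$. Algorithm GFM$^+(x_0,\eta,T,m,b,b')$. For $t=0,1,\dots,T-1$: if $t \bmod m=0$, draw a fresh sample $S'=\{(\xi_i,w_i)\}_{i=1}^{b'}$ and set $v_t=g(x_t;S')$; otherwise draw a fresh sample $S=\{(\xi_i,w_i)\}_{i=1}^{b}$ and set $v_t=v_{t-1}+g(x_t;S)-g(x_{t-1};S)$ (same $S$ in both terms); then set $x_{t+1}=x_t-\eta v_t$. Return a point chosen uniformly at random from $\{x_t\}_{t=0}^{T-1}$. Algorithm WS-GFM$^+(x_0,\eta_0,T_0,\eta,T,m,b,b')$. First compute $x_1=\mathrm{GFM}(x_0,\eta_0,T_0)$, then return $\mathrm{GFM}^+(x_1,\eta,T,m,b,b')$. The parameters (step sizes, iteration numbers, $m,b,b'$, and the smoothing parameter of each of the two phases) may depend on $d,L,R,\delta,\epsilon$. The stochastic zeroth-order oracle complexity is the number of evaluations of values $F(x;\xi)$. $\mathcal{O}(\cdot)$ is the usual asymptotic notation for small target accuracy, hiding only numeric constants. *)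

theory Defs
  imports "HOL-Probability.Probability"
begin

section \<open>Goldstein stationarity\<close>

definition clarke_subdiff :: "('a::euclidean_space \<Rightarrow> real) \<Rightarrow> 'a \<Rightarrow> 'a set" where
  "clarke_subdiff f x = convex hull
     {g. \<exists>X G. X \<longlonglongrightarrow> x \<and> (\<forall>k. GDERIV f (X k) :> G k) \<and> G \<longlonglongrightarrow> g}"

definition goldstein_subdiff :: "('a::euclidean_space \<Rightarrow> real) \<Rightarrow> real \<Rightarrow> 'a \<Rightarrow> 'a set" where
  "goldstein_subdiff f \<delta> x = convex hull (\<Union>y\<in>cball x \<delta>. clarke_subdiff f y)"

text \<open>The output law \<open>M\<close> of an algorithm is \<open>(\<delta>, \<epsilon>)\<close>-Goldstein stationary in expectation.
  Integrability is required explicitly, since a Bochner integral that does not exist is \<open>0\<close>. The convention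
  \<open>infdist 0 {} = 0\<close> plays no role: by Rademacher's theorem \<^const>\<open>clarke_subdiff\<close> is nonempty
  for Lipschitz \<open>f\<close>.\<close>

definition goldstein_stationary_in_expectation ::
    "('a::euclidean_space \<Rightarrow> real) \<Rightarrow> real \<Rightarrow> real \<Rightarrow> 'a measure \<Rightarrow> bool" where
  "goldstein_stationary_in_expectation f \<delta> \<epsilon> M \<longleftrightarrow>
     integrable M (\<lambda>x. infdist 0 (goldstein_subdiff f \<delta> x)) \<and>
     (\<integral>x. infdist 0 (goldstein_subdiff f \<delta> x) \<partial>M) \<le> \<epsilon>"

section \<open>The stochastic objective\<close>

definition argmin_set :: "('a \<Rightarrow> real) \<Rightarrow> 'a set" where
  "argmin_set f = {x. \<forall>y. f x \<le> f y}"

definition expected_objective :: "'x measure \<Rightarrow> ('a \<Rightarrow> 'x \<Rightarrow> real) \<Rightarrow> 'a \<Rightarrow> real" where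
  "expected_objective \<Xi> F x = (\<integral>\<xi>. F x \<xi> \<partial>\<Xi>)"

text \<open>\<open>\<Xi>\<close> is the law of the random index and \<open>Lc \<xi>\<close> is a Lipschitz constant of the
  component \<open>F(\<cdot>; \<xi>)\<close>.\<close>

definition mean_square_lipschitz ::
    "'x measure \<Rightarrow> ('a::real_normed_vector \<Rightarrow> 'x \<Rightarrow> real) \<Rightarrow> ('x \<Rightarrow> real) \<Rightarrow> real \<Rightarrow> bool" where
  "mean_square_lipschitz \<Xi> F Lc L \<longleftrightarrow>
     prob_space \<Xi> \<and>
     (\<forall>x. integrable \<Xi> (F x)) \<and>
     (\<forall>\<xi>\<in>space \<Xi>. \<forall>x y. \<bar>F x \<xi> - F y \<xi>\<bar> \<le> Lc \<xi> * norm (x - y)) \<and>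
     integrable \<Xi> (\<lambda>\<xi>. (Lc \<xi>)\<^sup>2) \<and>
     (\<integral>\<xi>. (Lc \<xi>)\<^sup>2 \<partial>\<Xi>) \<le> L\<^sup>2"

section \<open>Gradient estimators\<close>

text \<open>The uniform distribution on the unit sphere, as the law of \<open>u / norm u\<close> for \<open>u\<close> uniform in
  the unit ball; the value of \<open>sgn\<close> at the null set \<open>{0}\<close> is irrelevant.\<close>

definition uniform_sphere :: "'a::euclidean_space measure" where
  "uniform_sphere = distr (uniform_measure lborel (cball 0 1)) borel sgn"

definition sample_law :: "'x measure \<Rightarrow> ('x \<times> 'a::euclidean_space) measure" where
  "sample_law \<Xi> = \<Xi> \<Otimes>\<^sub>M uniform_sphere"

definition grad_est ::
    "('a::euclidean_space \<Rightarrow> 'x \<Rightarrow> real) \<Rightarrow> real \<Rightarrow> 'a \<Rightarrow> 'x \<times> 'a \<Rightarrow> 'a" where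
  "grad_est F \<rho> x = (\<lambda>(\<xi>, w).
     (real DIM('a) / (2 * \<rho>) * (F (x + \<rho> *\<^sub>R w) \<xi> - F (x - \<rho> *\<^sub>R w) \<xi>)) *\<^sub>R w)"

definition batch_est ::
    "('a::euclidean_space \<Rightarrow> 'x \<Rightarrow> real) \<Rightarrow> real \<Rightarrow> nat \<Rightarrow> 'a \<Rightarrow> (nat \<Rightarrow> 'x \<times> 'a) \<Rightarrow> 'a" where
  "batch_est F \<rho> b x S = (1 / real b) *\<^sub>R (\<Sum>i<b. grad_est F \<rho> x (S i))"

section \<open>The algorithms\<close>

text \<open>Iterates are functions of the realised samples; the law of the output is the image of the
  product of the sample laws and of the uniform law of the returned index.\<close>

primrec gfm_iterate ::
    "('a::euclidean_space \<Rightarrow> 'x \<Rightarrow> real) \<Rightarrow> real \<Rightarrow> real \<Rightarrow> 'a \<Rightarrow> (nat \<Rightarrow> 'x \<times> 'a) \<Rightarrow> nat \<Rightarrow> 'a" where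
  "gfm_iterate F \<rho> \<eta> x0 s 0 = x0"
| "gfm_iterate F \<rho> \<eta> x0 s (Suc t) =
     gfm_iterate F \<rho> \<eta> x0 s t - \<eta> *\<^sub>R grad_est F \<rho> (gfm_iterate F \<rho> \<eta> x0 s t) (s t)"

definition gfm ::
    "'x measure \<Rightarrow> ('a::euclidean_space \<Rightarrow> 'x \<Rightarrow> real) \<Rightarrow> real \<Rightarrow> real \<Rightarrow> nat \<Rightarrow> 'a \<Rightarrow> 'a measure" where
  "gfm \<Xi> F \<rho> \<eta> T x0 =
     distr (measure_pmf (pmf_of_set {..<T}) \<Otimes>\<^sub>M PiM {..<T} (\<lambda>_. sample_law \<Xi>)) borel
       (\<lambda>(t, s). gfm_iterate F \<rho> \<eta> x0 s t)"

text \<open>The state after \<open>t\<close> steps is the pair \<open>(x\<^sub>t, v\<^sub>t)\<close>; \<open>s t i\<close> is the \<open>i\<close>-th sample of the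
  batch drawn in step \<open>t\<close>.\<close>

primrec gfm_plus_state ::
    "('a::euclidean_space \<Rightarrow> 'x \<Rightarrow> real) \<Rightarrow> real \<Rightarrow> real \<Rightarrow> nat \<Rightarrow> nat \<Rightarrow> nat \<Rightarrow> 'a \<Rightarrow>
     (nat \<Rightarrow> nat \<Rightarrow> 'x \<times> 'a) \<Rightarrow> nat \<Rightarrow> 'a \<times> 'a" where
  "gfm_plus_state F \<rho> \<eta> m b b' x0 s 0 = (x0, batch_est F \<rho> b' x0 (s 0))"
| "gfm_plus_state F \<rho> \<eta> m b b' x0 s (Suc t) =
     (let (x, v) = gfm_plus_state F \<rho> \<eta> m b b' x0 s t;
          x' = x - \<eta> *\<^sub>R v;
          v' = (if Suc t mod m = 0 then batch_est F \<rho> b' x' (s (Suc t))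
                else v + batch_est F \<rho> b x' (s (Suc t)) - batch_est F \<rho> b x (s (Suc t)))
      in (x', v'))"

definition gfm_plus ::
    "'x measure \<Rightarrow> ('a::euclidean_space \<Rightarrow> 'x \<Rightarrow> real) \<Rightarrow> real \<Rightarrow> real \<Rightarrow> nat \<Rightarrow> nat \<Rightarrow> nat \<Rightarrow> nat \<Rightarrow>
     'a \<Rightarrow> 'a measure" where
  "gfm_plus \<Xi> F \<rho> \<eta> T m b b' x0 =
     distr (measure_pmf (pmf_of_set {..<T}) \<Otimes>\<^sub>M
            PiM {..<T} (\<lambda>t. PiM {..<(if t mod m = 0 then b' else b)} (\<lambda>_. sample_law \<Xi>))) borel
       (\<lambda>(t, s). fst (gfm_plus_state F \<rho> \<eta> m b b' x0 s t))"

definition ws_gfm_plus ::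
    "'x measure \<Rightarrow> ('a::euclidean_space \<Rightarrow> 'x \<Rightarrow> real) \<Rightarrow> real \<Rightarrow> real \<Rightarrow> nat \<Rightarrow>
     real \<Rightarrow> real \<Rightarrow> nat \<Rightarrow> nat \<Rightarrow> nat \<Rightarrow> nat \<Rightarrow> 'a \<Rightarrow> 'a measure" where
  "ws_gfm_plus \<Xi> F \<rho>0 \<eta>0 T0 \<rho> \<eta> T m b b' x0 =
     gfm \<Xi> F \<rho>0 \<eta>0 T0 x0 \<bind> (\<lambda>x1. gfm_plus \<Xi> F \<rho> \<eta> T m b b' x1)"

section \<open>Oracle calls\<close>

text \<open>One estimate \<^const>\<open>grad_est\<close> evaluates \<open>F\<close> twice. A step of the second phase that does
  not restart evaluates a batch of size \<open>b\<close> at both \<open>x\<^sub>t\<close> and \<open>x\<^bsub>t-1\<^esub>\<close>.\<close>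

definition gfm_calls :: "nat \<Rightarrow> nat" where
  "gfm_calls T = (\<Sum>t<T. 2)"

definition gfm_plus_calls :: "nat \<Rightarrow> nat \<Rightarrow> nat \<Rightarrow> nat \<Rightarrow> nat" where
  "gfm_plus_calls T m b b' = (\<Sum>t<T. if t mod m = 0 then 2 * b' else 2 * b + 2 * b)"

definition ws_gfm_plus_calls :: "nat \<Rightarrow> nat \<Rightarrow> nat \<Rightarrow> nat \<Rightarrow> nat \<Rightarrow> nat" where
  "ws_gfm_plus_calls T0 T m b b' = gfm_calls T0 + gfm_plus_calls T m b b'"

text \<open>The numeric constant hidden by the asymptotic notation. It has to be the same for all
  dimensions, and as the dimension is a type, an existential quantifier for it inside a
  proposition would let it depend on the dimension; hence a concrete, deliberately generous,
  number.\<close>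

definition complexity_const :: real where
  "complexity_const = 10 ^ 6"

end

(* Replace f by its average f_delta over balls of radius delta. The divergence theorem, which for
   a convex f only needs difference quotients and differentiability almost everywhere, shows that
   the gradient of f_delta is both the mean of the estimator g and an average of gradients of f at
   distance at most delta, so that its norm bounds dist(0, Goldstein subdifferential).

   The estimator has second moment O(d L^2) instead of d^2 L^2: the odd function
   F(x + rho w) - F(x - rho w) of w is the integral of its derivative along a half circle from -w
   to w, and averaging over random half circles yields a Poincare inequality on the sphere.

   For convex f the smoothed gradients are approximate subgradients, so GFM is stochastic
   subgradient descent and yields a point of expected gap O(R sqrt(d) L / sqrt T0 + delta L). From
   there GFM+ is variance-reduced gradient descent on f_delta, whose gradient estimates are
   Lipschitz in mean square with constant O(d L / delta); a potential combining the gap and the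
   estimation error gives T = O(gap / (eta eps^2)). The claimed bound comes from
   m = b' ~ d L^2 / eps^2, b = 1, eta ~ delta / (d L sqrt m) and
   T0 ~ d^(4/3) L^2 R^(2/3) / (delta^(2/3) eps^2), which balances the two phases. *)

theory Submission
  imports Defs
begin

section \<open>Laws of randomly sampled iterates\<close>

text \<open>All expectations are nonnegative integrals bounded from above. The law of the second
  phase, as a function of its starting point, enters only through an inequality for
  \<open>bind\<close> that holds for arbitrary kernels. Integrability of the distance is recovered
  at the very end from a finite bound, its measurability from lower semicontinuity. The sphere law
  is the image of the ball under \<open>sgn\<close>, so sphere integrals are Lebesgue integrals of
  functions of \<open>sgn u\<close>. Rotation invariance is used for pairs (x, y) in the product
  space, where rotating the pair factors into shears. The half circles are thus random elliptic arcs
  cos t x + sin t y, and the gain 1 / d is the mean of the squared inner product of a vector with a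
  random direction, itself computed by the divergence theorem for a linear function. Gradients of a
  convex function exist almost everywhere because the one-sided derivatives in opposite directions
  have a nonnegative sum with vanishing weighted integrals. For \<epsilon> \<ge> L every point is
  stationary. The parameters are therefore chosen under \<epsilon> < L, where rounding up to
  integers costs only constant factors.\<close>

text \<open>\<open>distr\<close> along a map that is not measurable is the null measure, so the upper
  bounds below also cover sampling from iterates \<open>X t\<close> that are not measurable for
  \<open>t \<ge> T\<close>.\<close>

lemma nn_integral_distr_not_measurable:
  assumes space: "f \<in> space M \<rightarrow> space N" and f: "f \<notin> M \<rightarrow>\<^sub>M N"
  shows "(\<integral>\<^sup>+x. g x \<partial>distr M N f) = 0"
proof -
  obtain A where A: "A \<in> sets N" "f -` A \<inter> space M \<notin> sets M"
    using space f unfolding measurable_def by auto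
  have pre: "f -` (space N - A) \<inter> space M = space M - (f -` A \<inter> space M)"
    using space by auto
  have "f -` (space N - A) \<inter> space M \<notin> sets M"
  proof
    assume "f -` (space N - A) \<inter> space M \<in> sets M"
    then have "space M - (space M - (f -` A \<inter> space M)) \<in> sets M"
      unfolding pre by (rule sets.compl_sets)
    also have "space M - (space M - (f -` A \<inter> space M)) = f -` A \<inter> space M" by auto
    finally show False using A(2) by simp
  qed
  then have 0: "emeasure M (f -` A \<inter> space M) = 0" "emeasure M (f -` (space N - A) \<inter> space M) = 0"
    using A(2) by (simp_all add: emeasure_notin_sets)
  define \<mu> where "\<mu> B = emeasure M (f -` B \<inter> space M)" for B
  have conv: "emeasure (distr M N f) (space N) =
      (if measure_space (space N) (sets N) \<mu> then \<mu> (space N) else 0)"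
    unfolding distr_def emeasure_measure_of_conv \<mu>_def[abs_def]
    by (auto simp: sets.sigma_sets_eq)
  have "emeasure (distr M N f) (space (distr M N f)) = 0"
  \<comment> \<open>If the candidate \<open>\<mu>\<close> is not a measure, \<open>distr\<close>
    falls back to the null measure. Otherwise it is additive over \<open>A\<close> and its
    complement, whose preimages are both non-measurable and so receive the default value 0.\<close>
  proof (cases "measure_space (space N) (sets N) \<mu>")
    case True
    then have "additive (sets N) \<mu>"
      by (auto simp: measure_space_def intro!: sets.countably_additive_additive)
    then have "\<mu> (A \<union> (space N - A)) = \<mu> A + \<mu> (space N - A)"
      using A by (intro additiveD) auto
    moreover have "A \<union> (space N - A) = space N" using sets.sets_into_space[OF A(1)] by auto
    ultimately have "\<mu> (space N) = 0" using 0 by (simp only: \<mu>_def add_0)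
    then show ?thesis using conv True by simp
  qed (simp add: conv)
  then have "AE x in distr M N f. False"
    by (intro AE_I[where N="space (distr M N f)"]) auto
  then have "AE x in distr M N f. g x = 0" by eventually_elim simp
  then have "(\<integral>\<^sup>+x. g x \<partial>distr M N f) = (\<integral>\<^sup>+x. 0 \<partial>distr M N f)"
    by (rule nn_integral_cong_AE)
  then show ?thesis by simp
qed

lemma nn_integral_distr_le:
  assumes "f \<in> space M \<rightarrow> space N" and "g \<in> borel_measurable N"
  shows "(\<integral>\<^sup>+x. g x \<partial>distr M N f) \<le> (\<integral>\<^sup>+x. g (f x) \<partial>M)"
  using assms
  by (cases "f \<in> M \<rightarrow>\<^sub>M N") (auto simp: nn_integral_distr nn_integral_distr_not_measurable)

text \<open>\<open>bind\<close> is the join of the image of \<open>M\<close> under \<open>K\<close>.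
  Pushing forward along a non-measurable \<open>K\<close> gives the null measure, so the inequality
  survives in that case too. This is how the second phase is attached to the first.\<close>

lemma nn_integral_bind_le:
  fixes K :: "'a \<Rightarrow> 'b measure"
  assumes "space M \<noteq> {}"
    and K: "\<And>x. x \<in> space M \<Longrightarrow> K x \<in> space (subprob_algebra N)"
    and g: "g \<in> borel_measurable N"
  shows "(\<integral>\<^sup>+y. g y \<partial>(M \<bind> K)) \<le> (\<integral>\<^sup>+x. \<integral>\<^sup>+y. g y \<partial>K x \<partial>M)"
proof -
  have "sets (K (SOME x. x \<in> space M)) = sets N"
    using K[OF some_in_eq[THEN iffD2, OF assms(1)]] by (simp add: space_subprob_algebra)
  then have *: "M \<bind> K = join (distr M (subprob_algebra N) K)"
    using assms(1) by (simp add: bind_def cong: subprob_algebra_cong)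
  have "(\<integral>\<^sup>+y. g y \<partial>(M \<bind> K)) = (\<integral>\<^sup>+M'. \<integral>\<^sup>+y. g y \<partial>M' \<partial>distr M (subprob_algebra N) K)"
    unfolding * using g by (intro nn_integral_join) auto
  also have "\<dots> \<le> (\<integral>\<^sup>+x. \<integral>\<^sup>+y. g y \<partial>K x \<partial>M)"
    using assms by (intro nn_integral_distr_le) (auto intro: nn_integral_measurable_subprob_algebra)
  finally show ?thesis .
qed

lemma sets_bind_subprob:
  assumes "space M \<noteq> {}" and K: "\<And>x. x \<in> space M \<Longrightarrow> K x \<in> space (subprob_algebra N)"
  shows "sets (M \<bind> K) = sets N"
proof -
  have "sets (K (SOME x. x \<in> space M)) = sets N"
    using K[OF some_in_eq[THEN iffD2, OF assms(1)]] by (simp add: space_subprob_algebra)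
  then show ?thesis
    using assms(1) by (simp add: bind_def cong: subprob_algebra_cong)
qed

text \<open>The index law lives on all natural numbers, while \<open>X t\<close> is controlled only
  for \<open>t < T\<close>. The two sides agree if the joint map is measurable, and the left side is
  0 otherwise.\<close>

lemma nn_integral_uniform_output_le:
  fixes X :: "nat \<Rightarrow> 'w \<Rightarrow> 'a::euclidean_space"
  assumes "T \<ge> 1" and "prob_space P" and X: "\<And>t. t < T \<Longrightarrow> X t \<in> P \<rightarrow>\<^sub>M borel"
    and h: "h \<in> borel_measurable borel"
  shows "(\<integral>\<^sup>+x. h x \<partial>distr (measure_pmf (pmf_of_set {..<T}) \<Otimes>\<^sub>M P) borel (\<lambda>(t, s). X t s))
    \<le> (\<Sum>t<T. \<integral>\<^sup>+s. h (X t s) \<partial>P) / of_nat T"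
proof -
  interpret P: prob_space P by fact
  interpret p: prob_space "measure_pmf (pmf_of_set {..<T})" by (rule measure_pmf.prob_space_axioms)
  interpret pp: pair_prob_space "measure_pmf (pmf_of_set {..<T})" P ..
  have ne: "{..<T} \<noteq> {}" using assms(1) by (simp add: lessThan_empty_iff)
  show ?thesis
  proof (cases "(\<lambda>(t, s). X t s) \<in> measure_pmf (pmf_of_set {..<T}) \<Otimes>\<^sub>M P \<rightarrow>\<^sub>M borel")
    case True
    then have "(\<integral>\<^sup>+x. h x \<partial>distr (measure_pmf (pmf_of_set {..<T}) \<Otimes>\<^sub>M P) borel (\<lambda>(t, s). X t s))
      = (\<integral>\<^sup>+t. \<integral>\<^sup>+s. h (X t s) \<partial>P \<partial>measure_pmf (pmf_of_set {..<T}))"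
      using h by (subst nn_integral_distr, simp, simp, subst P.nn_integral_fst[symmetric])
        (auto intro!: measurable_compose[OF _ h] simp: split_beta)
    also have "\<dots> = (\<Sum>t<T. \<integral>\<^sup>+s. h (X t s) \<partial>P) / of_nat T"
      using ne by (subst nn_integral_pmf_of_set) (auto simp: card_lessThan)
    finally show ?thesis by simp
  next
    case False
    then have "(\<integral>\<^sup>+x. h x \<partial>distr (measure_pmf (pmf_of_set {..<T}) \<Otimes>\<^sub>M P) borel (\<lambda>(t, s). X t s)) = 0"
      by (intro nn_integral_distr_not_measurable) auto
    then show ?thesis by simp
  qed
qed

text \<open>A chain driven by independent samples, with steps that may depend on time. The first
  phase, the second phase and the partial sums of a batch average are all instances, so one drift
  argument serves all three.\<close>

primrec chain :: "(nat \<Rightarrow> 's \<Rightarrow> 'w \<Rightarrow> 's) \<Rightarrow> 's \<Rightarrow> (nat \<Rightarrow> 'w) \<Rightarrow> nat \<Rightarrow> 's" where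
  "chain step z s 0 = z"
| "chain step z s (Suc n) = step n (chain step z s n) (s n)"

text \<open>The state at time \<open>n\<close> reads only samples with smaller index, so the sample
  \<open>T\<close> can be integrated out separately.\<close>

lemma chain_fun_upd: "n \<le> T \<Longrightarrow> chain step z (s(T := w)) n = chain step z s n"
  by (induction n) auto

lemma measurable_chain:
  fixes step :: "nat \<Rightarrow> 's::second_countable_topology \<Rightarrow> 'w \<Rightarrow> 's"
  assumes step: "\<And>n. (\<lambda>(z, w). step n z w) \<in> borel \<Otimes>\<^sub>M M n \<rightarrow>\<^sub>M borel"
    and "n \<le> T"
  shows "(\<lambda>(z, s). chain step z s n) \<in> borel \<Otimes>\<^sub>M PiM {..<T} M \<rightarrow>\<^sub>M borel"
  using \<open>n \<le> T\<close>
proof (induction n)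
  case (Suc n)
  have "(\<lambda>x. (\<lambda>(z, w). step n z w) ((\<lambda>(z, s). chain step z s n) x, snd x n))
      \<in> borel \<Otimes>\<^sub>M PiM {..<T} M \<rightarrow>\<^sub>M borel"
    using Suc by (intro measurable_compose[OF _ step] measurable_Pair
      measurable_compose[OF measurable_snd measurable_component_singleton]) auto
  then show ?case by (simp add: split_beta)
qed (simp add: split_beta)

lemma measurable_chain_init:
  fixes step :: "nat \<Rightarrow> 's::second_countable_topology \<Rightarrow> 'w \<Rightarrow> 's"
  assumes step: "\<And>n. (\<lambda>(z, w). step n z w) \<in> borel \<Otimes>\<^sub>M M n \<rightarrow>\<^sub>M borel"
    and "n \<le> T"
  shows "(\<lambda>s. chain step z s n) \<in> PiM {..<T} M \<rightarrow>\<^sub>M borel"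
  using measurable_compose[OF measurable_Pair1' measurable_chain[OF assms], of z] by simp

text \<open>\<open>V\<close> is a Lyapunov function: in each step it decreases in mean by the cost \<open>c\<close>, up to
  an error \<open>\<beta>\<close>.\<close>

lemma chain_drift:
  fixes step :: "nat \<Rightarrow> 's::second_countable_topology \<Rightarrow> 'w \<Rightarrow> 's"
    and V c :: "nat \<Rightarrow> 's \<Rightarrow> ennreal"
  assumes M: "\<And>n. prob_space (M n)"
    and step: "\<And>n. (\<lambda>(z, w). step n z w) \<in> borel \<Otimes>\<^sub>M M n \<rightarrow>\<^sub>M borel"
    and V[measurable]: "\<And>n. V n \<in> borel_measurable borel"
    and c[measurable]: "\<And>n. c n \<in> borel_measurable borel"
    and drift: "\<And>n z. (\<integral>\<^sup>+w. V (Suc n) (step n z w) \<partial>M n) + c n z \<le> V n z + \<beta> n"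
  shows "(\<integral>\<^sup>+s. V T (chain step z s T) \<partial>PiM {..<T} M)
      + (\<Sum>n<T. \<integral>\<^sup>+s. c n (chain step z s n) \<partial>PiM {..<T} M) \<le> V 0 z + (\<Sum>n<T. \<beta> n)"
proof (induction T)
  case 0
  then show ?case by (simp add: PiM_empty)
next
  case (Suc T)
  interpret product_sigma_finite M
    using M by (simp add: product_sigma_finite_def prob_space_imp_sigma_finite)
  interpret MT: prob_space "M T" by (rule M)
  interpret P: prob_space "PiM {..<T} M" by (intro prob_space_PiM M)
  note [measurable] = step measurable_chain_init[OF step]
  \<comment> \<open>Fubini for the last sample: the history stays outside, and the drift hypothesis
    applies to the inner integral at a fixed state.\<close>
  have insert: "(\<integral>\<^sup>+s. h s \<partial>PiM {..<Suc T} M) = (\<integral>\<^sup>+s. \<integral>\<^sup>+w. h (s(T := w)) \<partial>M T \<partial>PiM {..<T} M)"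
    if "h \<in> borel_measurable (PiM {..<Suc T} M)" for h
    using that product_nn_integral_insert[of "{..<T}" T h] by (simp add: lessThan_Suc)
  have c_eq: "(\<integral>\<^sup>+s. c n (chain step z s n) \<partial>PiM {..<Suc T} M) =
      (\<integral>\<^sup>+s. c n (chain step z s n) \<partial>PiM {..<T} M)" if "n \<le> T" for n
    using that by (subst insert) (auto simp: chain_fun_upd MT.emeasure_space_1)
  have V_eq: "(\<integral>\<^sup>+s. V (Suc T) (chain step z s (Suc T)) \<partial>PiM {..<Suc T} M) =
      (\<integral>\<^sup>+s. \<integral>\<^sup>+w. V (Suc T) (step T (chain step z s T) w) \<partial>M T \<partial>PiM {..<T} M)"
    by (subst insert) (auto simp: chain_fun_upd simp del: fun_upd_apply chain.simps(2)
      intro!: nn_integral_cong measurable_compose[OF measurable_chain_init[OF step] V], simp add: chain_fun_upd)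
  have [measurable]: "(\<lambda>z. \<integral>\<^sup>+w. V (Suc T) (step T z w) \<partial>M T) \<in> borel_measurable borel"
    using step[of T] by measurable
  have "(\<integral>\<^sup>+s. V (Suc T) (chain step z s (Suc T)) \<partial>PiM {..<Suc T} M) +
      (\<integral>\<^sup>+s. c T (chain step z s T) \<partial>PiM {..<T} M) =
      (\<integral>\<^sup>+s. (\<integral>\<^sup>+w. V (Suc T) (step T (chain step z s T) w) \<partial>M T) + c T (chain step z s T) \<partial>PiM {..<T} M)"
    unfolding V_eq by (rule nn_integral_add[symmetric]) measurable
  also have "\<dots> \<le> (\<integral>\<^sup>+s. V T (chain step z s T) + \<beta> T \<partial>PiM {..<T} M)"
    by (intro nn_integral_mono drift)
  also have "\<dots> = (\<integral>\<^sup>+s. V T (chain step z s T) \<partial>PiM {..<T} M) + \<beta> T"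
    by (subst nn_integral_add) (auto simp: P.emeasure_space_1)
  finally have "(\<integral>\<^sup>+s. V (Suc T) (chain step z s (Suc T)) \<partial>PiM {..<Suc T} M) +
      (\<Sum>n<Suc T. \<integral>\<^sup>+s. c n (chain step z s n) \<partial>PiM {..<Suc T} M) \<le>
      (\<integral>\<^sup>+s. V T (chain step z s T) \<partial>PiM {..<T} M) + \<beta> T +
      (\<Sum>n<T. \<integral>\<^sup>+s. c n (chain step z s n) \<partial>PiM {..<T} M)"
    by (simp add: c_eq ac_simps add_left_mono del: chain.simps(2))
  also have "\<dots> \<le> V 0 z + (\<Sum>n<T. \<beta> n) + \<beta> T"
    using add_right_mono[OF Suc, of "\<beta> T"] by (simp add: ac_simps)
  finally show ?case by (simp add: ac_simps)
qed

section \<open>The divergence theorem for convex functions on the ball\<close>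

lemma abs_Suc_times_le: "\<bar>c\<bar> \<le> B / real (Suc n) \<Longrightarrow> \<bar>real (Suc n) * c\<bar> \<le> B"
  by (simp add: abs_mult pos_le_divide_eq mult.commute del: of_nat_Suc)

text \<open>Countably many step sizes make the derivative a sequential limit, which preserves
  measurability and fits dominated convergence.\<close>

lemma has_derivative_seq_quotient:
  fixes f :: "'a::real_normed_vector \<Rightarrow> real"
  assumes f: "(f has_derivative f') (at x)"
  shows "(\<lambda>n. real (Suc n) * (f (x + (1 / real (Suc n)) *\<^sub>R a) - f x)) \<longlonglongrightarrow> f' a"
proof -
  have "((\<lambda>t. f (x + t *\<^sub>R a)) has_derivative (\<lambda>t. f' (t *\<^sub>R a))) (at 0)"
    by (rule has_derivative_compose[of "\<lambda>t. x + t *\<^sub>R a" "\<lambda>t. t *\<^sub>R a" 0 UNIV f f'])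
      (auto intro!: derivative_eq_intros f)
  moreover have "f' (t *\<^sub>R a) = f' a * t" for t
    using has_derivative_linear[OF f] by (simp add: linear_cmul)
  ultimately have "((\<lambda>t. f (x + t *\<^sub>R a)) has_real_derivative f' a) (at 0)"
    by (simp add: has_field_derivative_def)
  then have "((\<lambda>t. (f (x + t *\<^sub>R a) - f x) / t) \<longlongrightarrow> f' a) (at 0)"
    by (simp add: DERIV_def)
  moreover have "filterlim (\<lambda>n. 1 / real (Suc n)) (at 0) sequentially"
    using LIMSEQ_Suc[OF lim_1_over_n[where 'a=real]] by (auto simp: filterlim_at)
  ultimately have "((\<lambda>n. (f (x + (1 / real (Suc n)) *\<^sub>R a) - f x) / (1 / real (Suc n))) \<longlonglongrightarrow> f' a)"
    by (rule filterlim_compose)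
  then show ?thesis by (simp add: mult.commute)
qed

lemma lborel_integral_shift:
  fixes g :: "'a::euclidean_space \<Rightarrow> 'b::{banach, second_countable_topology}"
  assumes [measurable]: "g \<in> borel_measurable borel"
  shows "(\<integral>u. g (c + u) \<partial>lborel) = (\<integral>u. g u \<partial>lborel)"
proof -
  have "(\<integral>u. g u \<partial>lborel) = (\<integral>u. g u \<partial>distr lborel borel ((+) c))"
    by (simp add: lborel_distr_plus)
  also have "\<dots> = (\<integral>u. g (c + u) \<partial>lborel)"
    by (subst integral_distr) auto
  finally show ?thesis by simp
qed

lemma lborel_integrable_shift:
  fixes g :: "'a::euclidean_space \<Rightarrow> 'b::{banach, second_countable_topology}"
  assumes "integrable lborel g"
  shows "integrable lborel (\<lambda>u. g (c + u))"
proof -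
  have "integrable (distr lborel borel ((+) c)) g"
    using assms by (simp add: lborel_distr_plus)
  then show ?thesis by (rule integrable_distr[rotated]) auto
qed

lemma integrable_lborel_bounded_support:
  fixes g :: "'a::euclidean_space \<Rightarrow> real"
  assumes "g \<in> borel_measurable borel" and "\<And>u. \<bar>g u\<bar> \<le> B" and "\<And>u. norm u > r \<Longrightarrow> g u = 0"
  shows "integrable lborel g"
proof (rule Bochner_Integration.integrable_bound)
  show "integrable lborel (\<lambda>u::'a. B * indicator (cball 0 r) u)"
    using emeasure_lborel_cball_finite[of 0 r] by (intro integrable_mult_right integrable_real_indicator) auto
  show "AE u in lborel. norm (g u) \<le> norm (B * indicator (cball 0 r) u)"
  proof (rule AE_I2)
    fix u show "norm (g u) \<le> norm (B * indicator (cball 0 r) u)"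
      using assms(2)[of u] assms(3)[of u] by (auto simp: indicator_def)
  qed
qed (use assms in auto)

lemma AE_lborel_norm_neq: "AE u::'a::euclidean_space in lborel. norm u \<noteq> r"
proof -
  have "negligible (sphere (0::'a) r)" by (rule negligible_sphere)
  then have "sphere (0::'a) r \<in> null_sets lborel"
    by (simp add: negligible_iff_null_sets null_sets_def)
  then show ?thesis by (rule AE_I') (auto simp: sphere_def)
qed

text \<open>A Lipschitz substitute for the indicator of the ball of radius \<open>r\<close>. Its
  gradient lives on the shell of width \<open>h\<close>, which becomes the sphere in the
  limit.\<close>

definition cutoff :: "real \<Rightarrow> real \<Rightarrow> 'a::euclidean_space \<Rightarrow> real" where
  "cutoff r h u = min 1 (max 0 ((r - norm u) / h))"

lemma borel_measurable_cutoff [measurable]: "cutoff r h \<in> borel_measurable borel"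
  unfolding cutoff_def by measurable

lemma cutoff_bounds: "0 \<le> cutoff r h u" "cutoff r h u \<le> 1"
  by (auto simp: cutoff_def)

lemma cutoff_eq_0: "h > 0 \<Longrightarrow> norm u \<ge> r \<Longrightarrow> cutoff r h u = 0"
  using divide_nonpos_pos[of "r - norm u" h] by (simp add: cutoff_def max_absorb1)

lemma cutoff_lipschitz:
  assumes "h > 0" shows "\<bar>cutoff r h u - cutoff r h v\<bar> \<le> 1 / h * norm (u - v)"
proof -
  have "\<bar>cutoff r h u - cutoff r h v\<bar> \<le> \<bar>(r - norm u) / h - (r - norm v) / h\<bar>"
    unfolding cutoff_def by linarith
  also have "\<dots> = \<bar>norm v - norm u\<bar> / h"
    using assms by (simp add: diff_divide_distrib[symmetric])
  also have "\<dots> \<le> norm (v - u) / h"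
    using assms norm_triangle_ineq3[of v u] by (intro divide_right_mono) auto
  finally show ?thesis by (simp add: norm_minus_commute)
qed

text \<open>Minus the derivative of the cutoff in direction \<open>a\<close>, away from the two
  spheres where the cutoff has a kink.\<close>

definition shell_slope :: "real \<Rightarrow> real \<Rightarrow> 'a::euclidean_space \<Rightarrow> 'a \<Rightarrow> real" where
  "shell_slope r h a u = (if r - h < norm u \<and> norm u < r then inner (sgn u) a / h else 0)"

lemma borel_measurable_shell_slope [measurable]: "shell_slope r h a \<in> borel_measurable borel"
  unfolding shell_slope_def sgn_div_norm by measurable

lemma cutoff_derivative:
  assumes h: "0 < h" "h < r" and u: "norm u \<noteq> r" "norm u \<noteq> r - h"
  shows "(\<lambda>n. real (Suc n) * (cutoff r h (u - (1 / real (Suc n)) *\<^sub>R a) - cutoff r h u))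
    \<longlonglongrightarrow> shell_slope r h a u"
proof -
  have eq: "shell_slope r h (- a) u = - shell_slope r h a u" by (simp add: shell_slope_def)
  have "(cutoff r h has_derivative (\<lambda>v. - shell_slope r h v u)) (at u)"
  proof -
    consider "norm u < r - h" | "r - h < norm u" "norm u < r" | "norm u > r" using u by linarith
    then show ?thesis
    proof cases
      case 1
      have "((\<lambda>_. 1) has_derivative (\<lambda>v. - shell_slope r h v u)) (at u)"
        using 1 by (simp add: shell_slope_def)
      then show ?thesis
        by (rule has_derivative_transform_within_open[where s="{v. norm v < r - h}"])
          (use 1 h in \<open>auto simp: cutoff_def open_Collect_less continuous_intros divide_simps\<close>)
    next
      case 2
      have "((\<lambda>v. (r - norm v) / h) has_derivative (\<lambda>v. - shell_slope r h v u)) (at u)"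
        using 2 h by (auto simp: shell_slope_def intro!: derivative_eq_intros has_derivative_norm)
          (auto simp: inner_commute)
      then show ?thesis
        by (rule has_derivative_transform_within_open[where s="{v. norm v < r} \<inter> {v. r - h < norm v}"])
          (use 2 h in \<open>auto simp: cutoff_def open_Collect_less continuous_intros divide_simps intro!: open_Int\<close>)
    next
      case 3
      have "((\<lambda>_. 0) has_derivative (\<lambda>v. - shell_slope r h v u)) (at u)"
        using 3 by (simp add: shell_slope_def)
      then show ?thesis
        by (rule has_derivative_transform_within_open[where s="{v. r < norm v}"])
          (use 3 h in \<open>auto simp: cutoff_eq_0 open_Collect_less continuous_intros\<close>)
    qed
  qed
  \<comment> \<open>The quotient runs in direction \<open>- a\<close> and the derivative is minus
    the slope, so the two signs cancel.\<close>
  from has_derivative_seq_quotient[OF this, of "- a"] eq show ?thesis by simp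
qed

text \<open>For convex functions this is the one-sided directional derivative, which exists
  everywhere. The sequential form makes it a Borel function of the point.\<close>

definition dir_deriv :: "('a::euclidean_space \<Rightarrow> real) \<Rightarrow> 'a \<Rightarrow> 'a \<Rightarrow> real" where
  "dir_deriv f a y = lim (\<lambda>n. real (Suc n) * (f (y + (1 / real (Suc n)) *\<^sub>R a) - f y))"

section \<open>One-sided derivatives of Lipschitz convex functions\<close>

locale lipschitz_convex =
  fixes f :: "'a::euclidean_space \<Rightarrow> real" and L :: real
  assumes convex: "convex_on UNIV f"
    and lip: "\<bar>f x - f y\<bar> \<le> L * norm (x - y)"
begin

lemma L_nonneg: "L \<ge> 0"
proof -
  obtain b :: 'a where "b \<in> Basis" by (meson nonempty_Basis ex_in_conv)
  then show ?thesis using lip[of b 0] by simp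
qed

lemma continuous: "continuous_on S f"
proof -
  have "L-lipschitz_on UNIV f"
    using lip L_nonneg by (auto simp: lipschitz_on_def dist_norm dist_real_def)
  then show ?thesis using lipschitz_on_continuous_on continuous_on_subset by blast
qed

lemma borel_measurable [measurable]: "f \<in> borel_measurable borel"
  by (intro borel_measurable_continuous_onI continuous)

lemma quotient_mono:
  assumes "0 < s" "s \<le> t"
  shows "(f (y + s *\<^sub>R a) - f y) / s \<le> (f (y + t *\<^sub>R a) - f y) / t"
proof -
  have "y + s *\<^sub>R a = (1 - s / t) *\<^sub>R y + (s / t) *\<^sub>R (y + t *\<^sub>R a)"
    using assms by (simp add: algebra_simps)
  also have "f \<dots> \<le> (1 - s / t) * f y + (s / t) * f (y + t *\<^sub>R a)"
    using assms by (intro convex_onD[OF convex]) (auto simp: field_simps)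
  finally have "f (y + s *\<^sub>R a) - f y \<le> (s / t) * (f (y + t *\<^sub>R a) - f y)"
    by (simp add: algebra_simps)
  then have "(f (y + s *\<^sub>R a) - f y) / s \<le> (s / t) * (f (y + t *\<^sub>R a) - f y) / s"
    using assms by (intro divide_right_mono) auto
  then show ?thesis using assms by simp
qed

lemma abs_quotient_le:
  "\<bar>real (Suc n) * (f (y + (1 / real (Suc n)) *\<^sub>R a) - f y)\<bar> \<le> L * norm a"
proof -
  have "\<bar>f (y + (1 / real (Suc n)) *\<^sub>R a) - f y\<bar> \<le> L * norm a / real (Suc n)"
    using lip[of "y + (1 / real (Suc n)) *\<^sub>R a" y] by simp
  then show ?thesis by (rule abs_Suc_times_le)
qed

text \<open>Convexity makes the quotients decrease along the sequence, and the Lipschitz bound keeps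
  them bounded below.\<close>

lemma dir_deriv_tendsto:
  "(\<lambda>n. real (Suc n) * (f (y + (1 / real (Suc n)) *\<^sub>R a) - f y)) \<longlonglongrightarrow> dir_deriv f a y"
    (is "?q \<longlonglongrightarrow> _")
proof -
  have dec: "decseq ?q"
  proof (rule decseq_SucI)
    fix n show "?q (Suc n) \<le> ?q n"
      using quotient_mono[of "1 / real (Suc (Suc n))" "1 / real (Suc n)" y a]
      by (simp add: frac_le mult.commute del: of_nat_Suc)
  qed
  have "\<forall>n. - (L * norm a) \<le> ?q n"
    using abs_quotient_le[of _ y a] unfolding abs_le_iff by (metis minus_le_iff)
  from decseq_convergent[OF dec this] obtain l where "?q \<longlonglongrightarrow> l" by blast
  then show ?thesis unfolding dir_deriv_def by (simp add: limI)
qed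

lemma dir_deriv_measurable [measurable]: "dir_deriv f a \<in> borel_measurable borel"
  unfolding dir_deriv_def[abs_def] by measurable

lemma abs_dir_deriv_le: "\<bar>dir_deriv f a y\<bar> \<le> L * norm a"
  by (rule LIMSEQ_le_const2[OF tendsto_rabs[OF dir_deriv_tendsto]]) (intro exI allI impI abs_quotient_le)

text \<open>The limit of monotone quotients lies below each of them. At \<open>t = 1\<close> this is
  the subgradient inequality.\<close>

lemma dir_deriv_le_quotient:
  assumes "t > 0" shows "dir_deriv f a y \<le> (f (y + t *\<^sub>R a) - f y) / t"
proof -
  obtain N where N: "1 / real (Suc N) < t" using assms by (rule nat_approx_posE)
  have "real (Suc n) * (f (y + (1 / real (Suc n)) *\<^sub>R a) - f y) \<le> (f (y + t *\<^sub>R a) - f y) / t"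
    if "n \<ge> N" for n
  proof -
    have "1 / real (Suc n) \<le> 1 / real (Suc N)" using that by (simp add: frac_le)
    then show ?thesis
      using quotient_mono[of "1 / real (Suc n)" t y a] N by (simp add: mult.commute del: of_nat_Suc)
  qed
  then show ?thesis by (intro LIMSEQ_le_const2[OF dir_deriv_tendsto]) blast
qed

lemma midpoint_le: "2 * f y \<le> f (y + z) + f (y - z)"
proof -
  have "f ((1 - 1 / 2) *\<^sub>R (y + z) + (1 / 2) *\<^sub>R (y - z)) \<le> (1 - 1 / 2) * f (y + z) + (1 / 2) * f (y - z)"
    by (rule convex_onD[OF convex]) auto
  moreover have "(1 - 1 / 2) *\<^sub>R (y + z) + (1 / 2) *\<^sub>R (y - z) = (1 / 2) *\<^sub>R (y + y)"
    by (simp flip: scaleR_add_right)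
  ultimately show ?thesis by (simp add: scaleR_half_double)
qed

text \<open>Midpoint convexity in the limit. Equality means that the derivative along the line is
  two-sided.\<close>

lemma dir_deriv_neg_ge: "0 \<le> dir_deriv f a y + dir_deriv f (- a) y"
proof -
  have "0 \<le> real (Suc n) * (f (y + (1 / real (Suc n)) *\<^sub>R a) - f y)
      + real (Suc n) * (f (y + (1 / real (Suc n)) *\<^sub>R (- a)) - f y)" for n
    unfolding distrib_left[symmetric]
    using midpoint_le[of y "(1 / real (Suc n)) *\<^sub>R a"] by (intro mult_nonneg_nonneg) simp_all
  then show ?thesis
    using LIMSEQ_le_const[OF tendsto_add[OF dir_deriv_tendsto[of y a] dir_deriv_tendsto[of y "- a"]]] by blast
qed

lemma bounded_on_ball: "norm u \<le> r \<Longrightarrow> \<bar>f u\<bar> \<le> \<bar>f 0\<bar> + L * r"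
  using lip[of u 0] mult_left_mono[OF _ L_nonneg, of "norm u" r] by auto

text \<open>Integration by parts against a radial cutoff; only the translation invariance of the
  Lebesgue measure is needed, the derivatives being limits of difference quotients.\<close>

lemma integral_cutoff_dir_deriv:
  assumes h: "0 < h" "h < r"
  shows "(\<integral>u. cutoff r h u * dir_deriv f a u \<partial>lborel) = (\<integral>u. f u * shell_slope r h a u \<partial>lborel)"
proof -
  define q where "q n u = real (Suc n) * (f (u + (1 / real (Suc n)) *\<^sub>R a) - f u)" for n u
  define p where "p n u = real (Suc n) * (cutoff r h (u - (1 / real (Suc n)) *\<^sub>R a) - cutoff r h u)" for n u
  have [measurable]: "q n \<in> borel_measurable borel" "p n \<in> borel_measurable borel" for n
    unfolding q_def p_def by measurable
  have lim1: "(\<lambda>n. \<integral>u. cutoff r h u * q n u \<partial>lborel) \<longlonglongrightarrow> (\<integral>u. cutoff r h u * dir_deriv f a u \<partial>lborel)"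
  proof (rule integral_dominated_convergence[where w="\<lambda>u. L * norm a * indicator (cball 0 r) u"])
    show "AE u in lborel. (\<lambda>n. cutoff r h u * q n u) \<longlonglongrightarrow> cutoff r h u * dir_deriv f a u"
      unfolding q_def by (intro AE_I2 tendsto_mult_left dir_deriv_tendsto)
    show "integrable lborel (\<lambda>u::'a. L * norm a * indicator (cball 0 r) u)"
      using emeasure_lborel_cball_finite[of 0 r] by (intro integrable_mult_right integrable_real_indicator) auto
    fix n
    have "\<bar>cutoff r h u * q n u\<bar> \<le> L * norm a * indicator (cball 0 r) u" for u
      using mult_mono[OF cutoff_bounds(2)[of r h u] abs_quotient_le[of n u a]] cutoff_bounds(1)[of r h u]
        cutoff_eq_0[OF h(1), of r u]
      by (cases "norm u \<le> r") (auto simp: q_def abs_mult simp del: of_nat_Suc)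
    then show "AE u in lborel. norm (cutoff r h u * q n u) \<le> L * norm a * indicator (cball 0 r) u" by simp
  qed measurable
  \<comment> \<open>The ball of radius \<open>r + norm a\<close> contains the support of every
    \<open>p n\<close>, because the shifts have norm at most \<open>norm a\<close>. The first factor
    bounds \<open>f\<close> there, the second the difference quotients of the cutoff.\<close>
  define B where "B = (\<bar>f 0\<bar> + L * (r + norm a)) * (1 / h * norm a)"
  have lim2: "(\<lambda>n. \<integral>u. f u * p n u \<partial>lborel) \<longlonglongrightarrow> (\<integral>u. f u * shell_slope r h a u \<partial>lborel)"
  proof (rule integral_dominated_convergence[where w="\<lambda>u. B * indicator (cball 0 (r + norm a)) u"])
    show "AE u in lborel. (\<lambda>n. f u * p n u) \<longlonglongrightarrow> f u * shell_slope r h a u"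
      using AE_lborel_norm_neq[of r] AE_lborel_norm_neq[of "r - h"] unfolding p_def
      by eventually_elim (intro tendsto_mult_left cutoff_derivative h)
    show "integrable lborel (\<lambda>u::'a. B * indicator (cball 0 (r + norm a)) u)"
      using emeasure_lborel_cball_finite[of 0 "r + norm a"]
      by (intro integrable_mult_right integrable_real_indicator) auto
    fix n
    have "\<bar>f u * p n u\<bar> \<le> B * indicator (cball 0 (r + norm a)) u" for u
    proof (cases "norm u \<le> r + norm a")
      case True
      have "\<bar>cutoff r h (u - (1 / real (Suc n)) *\<^sub>R a) - cutoff r h u\<bar> \<le> 1 / h * norm a / real (Suc n)"
        using cutoff_lipschitz[OF h(1), of r "u - (1 / real (Suc n)) *\<^sub>R a" u] by simp
      then have "\<bar>p n u\<bar> \<le> 1 / h * norm a"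
        unfolding p_def by (rule abs_Suc_times_le)
      moreover have "0 \<le> \<bar>f 0\<bar> + L * (r + norm a)"
        using L_nonneg h by (intro add_nonneg_nonneg mult_nonneg_nonneg) auto
      ultimately have "\<bar>f u\<bar> * \<bar>p n u\<bar> \<le> B"
        unfolding B_def using bounded_on_ball[OF True] by (intro mult_mono) auto
      then show ?thesis using True by (simp add: abs_mult)
    next
      case False
      have "norm ((1 / real (Suc n)) *\<^sub>R a) \<le> norm a"
        by (simp add: divide_le_eq mult_le_cancel_left1)
      then have "norm (u - (1 / real (Suc n)) *\<^sub>R a) \<ge> r"
        using norm_triangle_ineq2[of u "(1 / real (Suc n)) *\<^sub>R a"] False by linarith
      moreover have "norm u \<ge> r" using False norm_ge_zero[of a] by linarith
      ultimately show ?thesis using h by (simp add: p_def cutoff_eq_0 False del: of_nat_Suc)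
    qed
    then show "AE u in lborel. norm (f u * p n u) \<le> B * indicator (cball 0 (r + norm a)) u" by simp
  qed measurable
  \<comment> \<open>Discrete integration by parts: a translation by \<open>?v\<close> moves the
    shift from \<open>f\<close> to the cutoff, which is why \<open>p\<close> is built with
    \<open>- a\<close>.\<close>
  have "(\<integral>u. cutoff r h u * q n u \<partial>lborel) = (\<integral>u. f u * p n u \<partial>lborel)" for n
  proof -
    let ?v = "(1 / real (Suc n)) *\<^sub>R a"
    have int: "integrable lborel (\<lambda>u. cutoff r h (u - v) * f u)" for v
    proof (rule integrable_lborel_bounded_support)
      fix u
      show "norm u > r + norm v \<Longrightarrow> cutoff r h (u - v) * f u = 0"
        using norm_triangle_ineq2[of u v] by (simp add: cutoff_eq_0[OF h(1)])
      have "0 \<le> \<bar>f 0\<bar> + L * (r + norm v)"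
        using L_nonneg h by (intro add_nonneg_nonneg mult_nonneg_nonneg) auto
      then show "\<bar>cutoff r h (u - v) * f u\<bar> \<le> \<bar>f 0\<bar> + L * (r + norm v)"
      proof (cases "norm u \<le> r + norm v")
        case True
        show ?thesis
          using mult_mono[OF cutoff_bounds(2)[of r h "u - v"] bounded_on_ball[OF True]]
            cutoff_bounds(1)[of r h "u - v"] by (simp add: abs_mult)
      next
        case False
        then show ?thesis
          using norm_triangle_ineq2[of u v] \<open>0 \<le> \<bar>f 0\<bar> + L * (r + norm v)\<close>
          by (simp add: cutoff_eq_0[OF h(1)])
      qed
    qed measurable
    have int0: "integrable lborel (\<lambda>u. cutoff r h u * f u)" using int[of 0] by simp
    have shift: "(\<integral>u. cutoff r h u * f (u + ?v) \<partial>lborel) = (\<integral>u. cutoff r h (u - ?v) * f u \<partial>lborel)"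
      using lborel_integral_shift[of "\<lambda>u. cutoff r h (u - ?v) * f u" ?v] by (simp add: add.commute)
    have ints: "integrable lborel (\<lambda>u. cutoff r h u * f (u + ?v))"
      using lborel_integrable_shift[OF int[of ?v], of ?v] by (simp add: add.commute)
    have "(\<integral>u. cutoff r h u * q n u \<partial>lborel)
        = (\<integral>u. real (Suc n) * (cutoff r h u * f (u + ?v) - cutoff r h u * f u) \<partial>lborel)"
      by (simp add: q_def algebra_simps del: of_nat_Suc)
    also have "\<dots> = real (Suc n) * ((\<integral>u. cutoff r h (u - ?v) * f u \<partial>lborel) - (\<integral>u. cutoff r h u * f u \<partial>lborel))"
      using ints int0 shift by (simp del: of_nat_Suc)
    also have "\<dots> = (\<integral>u. real (Suc n) * (cutoff r h (u - ?v) * f u - cutoff r h u * f u) \<partial>lborel)"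
      using int[of ?v] int0 by (simp del: of_nat_Suc)
    also have "\<dots> = (\<integral>u. f u * p n u \<partial>lborel)"
      by (simp add: p_def algebra_simps del: of_nat_Suc)
    finally show ?thesis .
  qed
  with lim1 lim2 show ?thesis by (simp add: LIMSEQ_unique)
qed

end

lemma sets_borel_ball [measurable]: "ball (c::'a::metric_space) r \<in> sets borel"
  by simp

lemma shell_slope_minus: "shell_slope r h (- a) u = - shell_slope r h a u"
  by (simp add: shell_slope_def)

lemma lborel_integral_scale:
  fixes g :: "'a::euclidean_space \<Rightarrow> real"
  assumes "g \<in> borel_measurable borel" and "c \<noteq> 0"
  shows "(\<integral>u. g u \<partial>lborel) = \<bar>c\<bar> ^ DIM('a) * (\<integral>u. g (c *\<^sub>R u) \<partial>lborel)"
proof -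
  have "(\<integral>u. g u \<partial>lborel) = (\<integral>u. g u \<partial>density (distr lborel borel (\<lambda>x. 0 + c *\<^sub>R x)) (\<lambda>_. ennreal (\<bar>c\<bar> ^ DIM('a))))"
    using lborel_affine[of c "0::'a"] assms(2) by (simp add: ennreal_power)
  also have "\<dots> = \<bar>c\<bar> ^ DIM('a) * (\<integral>u. g (c *\<^sub>R u) \<partial>lborel)"
    using assms by (subst integral_density) (auto simp: integral_distr)
  finally show ?thesis .
qed

context
  fixes k :: "'a::euclidean_space \<Rightarrow> real" and B :: real
  assumes k [measurable]: "k \<in> borel_measurable borel" and B: "\<And>w. \<bar>k w\<bar> \<le> B"
begin

lemma integrable_sgn_on_ball: "integrable lborel (\<lambda>u. indicator (ball 0 r) u * k (sgn u))"
proof (rule integrable_lborel_bounded_support)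
  show "\<bar>indicator (ball 0 r) u * k (sgn u)\<bar> \<le> B" for u
    using B[of "sgn u"] by (auto simp: indicator_def)
  show "norm u > r \<Longrightarrow> indicator (ball 0 r) u * k (sgn u) = 0" for u
    by (simp add: indicator_def)
qed measurable

lemma integral_sgn_on_ball:
  assumes "r > 0"
  shows "(\<integral>u. indicator (ball 0 r) u * k (sgn u) \<partial>lborel)
    = r ^ DIM('a) * (\<integral>u. indicator (ball 0 1) u * k (sgn u) \<partial>lborel)"
proof -
  have "indicator (ball 0 r) (r *\<^sub>R u) = (indicator (ball 0 1) u :: real)" for u :: 'a
    using assms by (auto simp: indicator_def)
  then show ?thesis
    using assms by (subst lborel_integral_scale[of _ r]) (auto simp: sgn_scaleR)
qed

text \<open>Up to a null sphere the shell is a difference of two balls, and integrals of functions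
  of \<open>sgn u\<close> over balls scale with the power \<open>DIM('a)\<close> of the
  radius.\<close>

lemma integral_sgn_on_shell:
  assumes "0 < h" "h < 1"
  shows "(\<integral>u. indicator {u. 1 - h < norm u \<and> norm u < 1} u * k (sgn u) \<partial>lborel)
    = (1 - (1 - h) ^ DIM('a)) * (\<integral>u. indicator (ball 0 1) u * k (sgn u) \<partial>lborel)"
proof -
  have "(\<integral>u. indicator {u. 1 - h < norm u \<and> norm u < 1} u * k (sgn u) \<partial>lborel)
      = (\<integral>u. indicator (ball 0 1) u * k (sgn u) - indicator (ball 0 (1 - h)) u * k (sgn u) \<partial>lborel)"
  proof (rule integral_cong_AE)
    show "AE u in lborel. indicator {u. 1 - h < norm u \<and> norm u < 1} u * k (sgn u) =
        indicator (ball 0 1) u * k (sgn u) - indicator (ball 0 (1 - h)) u * k (sgn u)"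
      using AE_lborel_norm_neq[of "1 - h"] by eventually_elim (use assms in \<open>auto simp: indicator_def\<close>)
  qed measurable
  also have "\<dots> = (\<integral>u. indicator (ball 0 1) u * k (sgn u) \<partial>lborel) -
      (\<integral>u. indicator (ball 0 (1 - h)) u * k (sgn u) \<partial>lborel)"
    by (intro Bochner_Integration.integral_diff integrable_sgn_on_ball)
  also have "\<dots> = (1 - (1 - h) ^ DIM('a)) * (\<integral>u. indicator (ball 0 1) u * k (sgn u) \<partial>lborel)"
    using assms integral_sgn_on_ball[of "1 - h"] by (simp add: algebra_simps)
  finally show ?thesis .
qed

end

section \<open>Differentiability almost everywhere and the divergence theorem\<close>

context lipschitz_convex
begin

text \<open>The sum of the two one-sided derivatives is nonnegative. Against a cutoff it integrates
  to zero, because integration by parts yields the slopes for \<open>a\<close> and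
  \<open>- a\<close>, which cancel; hence it vanishes almost everywhere. Applied along the
  coordinate axes, this gives almost everywhere differentiability.\<close>

lemma AE_dir_deriv_neg: "AE y in lborel. dir_deriv f (- a) y = - dir_deriv f a y"
proof -
  have "AE y in lborel. norm y < real (Suc k) \<longrightarrow> dir_deriv f (- a) y = - dir_deriv f a y" for k
  proof -
    let ?c = "cutoff (real (Suc k)) (1 / 2) :: 'a \<Rightarrow> real"
    have int: "integrable lborel (\<lambda>y. ?c y * dir_deriv f b y)" for b
    proof (rule integrable_lborel_bounded_support)
      show "\<bar>?c y * dir_deriv f b y\<bar> \<le> 1 * (L * norm b)" for y
        unfolding abs_mult using cutoff_bounds[of "real (Suc k)" "1/2" y] abs_dir_deriv_le[of b y]
        by (intro mult_mono) auto
      show "norm y > real (Suc k) \<Longrightarrow> ?c y * dir_deriv f b y = 0" for y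
        by (simp add: cutoff_eq_0 del: of_nat_Suc)
    qed measurable
    have "(\<integral>y. ?c y * dir_deriv f a y + ?c y * dir_deriv f (- a) y \<partial>lborel)
        = (\<integral>y. f y * shell_slope (real (Suc k)) (1/2) a y \<partial>lborel)
        + (\<integral>y. f y * shell_slope (real (Suc k)) (1/2) (- a) y \<partial>lborel)"
      using int by (subst Bochner_Integration.integral_add) (auto simp: integral_cutoff_dir_deriv)
    also have "\<dots> = 0"
      by (simp add: shell_slope_minus)
    finally have "AE y in lborel. ?c y * dir_deriv f a y + ?c y * dir_deriv f (- a) y = 0"
      using int dir_deriv_neg_ge cutoff_bounds(1)
      by (subst (asm) integral_nonneg_eq_0_iff_AE)
        (auto intro!: AE_I2 mult_nonneg_nonneg simp flip: distrib_left simp del: of_nat_Suc,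
         simp add: distrib_left)
    then show ?thesis
    proof eventually_elim
      case (elim y)
      show ?case
      proof
        assume "norm y < real (Suc k)"
        then have "?c y \<noteq> 0" by (auto simp: cutoff_def)
        moreover have "?c y * (dir_deriv f a y + dir_deriv f (- a) y) = 0"
          using elim by (simp add: distrib_left)
        ultimately show "dir_deriv f (- a) y = - dir_deriv f a y"
          by (simp add: add_eq_0_iff)
      qed
    qed
  qed
  then have "AE y in lborel. \<forall>k. norm y < real (Suc k) \<longrightarrow> dir_deriv f (- a) y = - dir_deriv f a y"
    unfolding AE_all_countable by blast
  then show ?thesis
  proof eventually_elim
    case (elim y)
    obtain k where "norm y < real k" using reals_Archimedean2 by blast
    then have "norm y < real (Suc k)" by simp
    then show ?case using elim by blast
  qed
qed

text \<open>One quotient close to its limit is enough, since monotonicity carries the bound to all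
  smaller steps.\<close>

lemma eventually_le_dir_deriv:
  assumes "e > 0"
  obtains s where "s > 0" "\<And>t. 0 \<le> t \<Longrightarrow> t \<le> s \<Longrightarrow> f (y + t *\<^sub>R a) - f y \<le> t * (dir_deriv f a y + e)"
proof -
  obtain n where n: "real (Suc n) * (f (y + (1 / real (Suc n)) *\<^sub>R a) - f y) < dir_deriv f a y + e"
    using order_tendstoD(2)[OF dir_deriv_tendsto[of y a], of "dir_deriv f a y + e"] assms
    by (auto dest!: eventually_happens)
  show thesis
  proof (rule that[of "1 / real (Suc n)"])
    fix t assume t: "0 \<le> t" "t \<le> 1 / real (Suc n)"
    show "f (y + t *\<^sub>R a) - f y \<le> t * (dir_deriv f a y + e)"
    proof (cases "t = 0")
      case False
      then have "(f (y + t *\<^sub>R a) - f y) / t \<le> dir_deriv f a y + e"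
        using quotient_mono[of t "1 / real (Suc n)" y a] t n by (simp add: mult.commute del: of_nat_Suc)
      then show ?thesis using False t by (simp add: divide_le_eq mult.commute)
    qed simp
  qed simp
qed

definition grad :: "'a \<Rightarrow> 'a" where
  "grad y = (\<Sum>i\<in>Basis. dir_deriv f i y *\<^sub>R i)"

text \<open>By convexity it suffices to bound the remainder along the axes: a displacement is the
  average of \<open>DIM('a)\<close> displacements along them.\<close>

lemma GDERIV_grad:
  assumes neg: "\<And>i. i \<in> Basis \<Longrightarrow> dir_deriv f (- i) y = - dir_deriv f i y"
  shows "GDERIV f y :> grad y"
proof -
  let ?d = "real DIM('a)"
  \<comment> \<open>Only the upper estimate is proved directly; the lower one follows from it by
    comparing opposite displacements.\<close>
  have upper: "\<exists>r>0. \<forall>z. norm z < r \<longrightarrow> f (y + z) - f y - z \<bullet> grad y \<le> e * norm z" if e: "e > 0" for e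
  proof -
    have "e / ?d > 0" using e by simp
    then have "\<exists>s>0. \<forall>t. 0 \<le> t \<and> t \<le> s \<longrightarrow> f (y + t *\<^sub>R a) - f y \<le> t * (dir_deriv f a y + e / ?d)" for a
      by (metis eventually_le_dir_deriv)
    then obtain s where s: "\<And>a. s a > 0"
      "\<And>a t. 0 \<le> t \<Longrightarrow> t \<le> s a \<Longrightarrow> f (y + t *\<^sub>R a) - f y \<le> t * (dir_deriv f a y + e / ?d)" by metis
    define m where "m = Min ((s ` Basis) \<union> ((\<lambda>i. s (- i)) ` Basis))"
    \<comment> \<open>The displacements along the axes are stretched by \<open>?d\<close> before
      averaging, so the common threshold \<open>m\<close> has to be divided by
      \<open>?d\<close>.\<close>
    define r where "r = m / ?d"
    have r: "?d * r \<le> s i" "?d * r \<le> s (- i)" if "i \<in> Basis" for i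
      using that by (auto simp: r_def m_def)
    have "m > 0" unfolding m_def using s(1) by (subst Min_gr_iff) auto
    then have "r > 0" by (simp add: r_def)
    moreover have "f (y + z) - f y - z \<bullet> grad y \<le> e * norm z" if z: "norm z < r" for z
    proof -
      have part: "f (y + (?d * (z \<bullet> i)) *\<^sub>R i) - f y \<le> ?d * (z \<bullet> i) * dir_deriv f i y + e * norm z"
        if i: "i \<in> Basis" for i
      proof -
        have zi: "\<bar>z \<bullet> i\<bar> \<le> norm z" using Basis_le_norm[OF i] .
        then have "?d * \<bar>z \<bullet> i\<bar> \<le> ?d * r" using z by (intro mult_left_mono) auto
        then have le: "?d * \<bar>z \<bullet> i\<bar> \<le> s i" "?d * \<bar>z \<bullet> i\<bar> \<le> s (- i)" using r[OF i] by linarith+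
        have "?d * \<bar>z \<bullet> i\<bar> * (e / ?d) \<le> e * norm z" using zi e by (simp add: mult.commute)
        moreover have "f (y + (?d * (z \<bullet> i)) *\<^sub>R i) - f y
            \<le> ?d * (z \<bullet> i) * dir_deriv f i y + ?d * \<bar>z \<bullet> i\<bar> * (e / ?d)"
        proof (cases "z \<bullet> i \<ge> 0")
          case True
          then show ?thesis using s(2)[of "?d * (z \<bullet> i)" i] le by (simp add: algebra_simps)
        next
          case False
          then have "z \<bullet> i * ?d \<le> 0" by (simp add: mult_le_0_iff)
          then show ?thesis using False s(2)[of "?d * \<bar>z \<bullet> i\<bar>" "- i"] le neg[OF i]
            by (simp add: algebra_simps)
        qed
        ultimately show ?thesis by linarith
      qed
      have "y + z = (\<Sum>i\<in>Basis. (1 / ?d) *\<^sub>R (y + (?d * (z \<bullet> i)) *\<^sub>R i))"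
        by (simp add: scaleR_add_right sum.distrib euclidean_representation sum_constant_scaleR)
      also have "f \<dots> \<le> (\<Sum>i\<in>Basis. (1 / ?d) * f (y + (?d * (z \<bullet> i)) *\<^sub>R i))"
        by (intro convex_on_sum[OF _ _ convex]) auto
      also have "\<dots> \<le> (\<Sum>i\<in>Basis. (1 / ?d) * (f y + (?d * (z \<bullet> i) * dir_deriv f i y + e * norm z)))"
        using part by (intro sum_mono mult_left_mono) (auto simp: algebra_simps)
      also have "\<dots> = f y + (\<Sum>i\<in>Basis. (z \<bullet> i) * dir_deriv f i y) + e * norm z"
        by (simp add: distrib_left sum.distrib)
      also have "(\<Sum>i\<in>Basis. (z \<bullet> i) * dir_deriv f i y) = z \<bullet> grad y"
        by (simp add: grad_def inner_sum_right mult.commute)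
      finally show ?thesis by simp
    qed
    ultimately show ?thesis by blast
  qed
  show ?thesis
    unfolding gderiv_def has_derivative_at_alt
  proof (intro conjI allI impI)
    show "bounded_linear (\<lambda>h. h \<bullet> grad y)" by (rule bounded_linear_inner_left)
    fix e :: real assume "e > 0"
    from upper[OF this] obtain r where r: "r > 0"
      "\<And>z. norm z < r \<Longrightarrow> f (y + z) - f y - z \<bullet> grad y \<le> e * norm z" by blast
    have "norm (f x - f y - (x - y) \<bullet> grad y) \<le> e * norm (x - y)" if "norm (x - y) < r" for x
    proof -
      \<comment> \<open>The point \<open>y - (x - y)\<close> mirrors \<open>x\<close> in
        \<open>y\<close>; the upper estimate there becomes the lower estimate at
        \<open>x\<close>.\<close>
      have "2 * f y \<le> f x + f (y + (y - x))"
        using midpoint_le[of y "x - y"] by (simp add: algebra_simps)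
      then show ?thesis
        using r(2)[of "x - y"] r(2)[of "y - x"] that
        by (simp add: norm_minus_commute inner_diff_left abs_le_iff)
    qed
    with r(1) show "\<exists>d>0. \<forall>x. norm (x - y) < d \<longrightarrow>
        norm (f x - f y - (x - y) \<bullet> grad y) \<le> e * norm (x - y)" by blast
  qed
qed

lemma dir_deriv_eq_inner:
  assumes "GDERIV f y :> g" shows "dir_deriv f a y = a \<bullet> g"
  using LIMSEQ_unique[OF dir_deriv_tendsto has_derivative_seq_quotient[OF assms[unfolded gderiv_def]]] .

lemma AE_GDERIV_grad: "AE y in lborel. GDERIV f y :> grad y"
proof -
  have "AE y in lborel. \<forall>i\<in>Basis. dir_deriv f (- i) y = - dir_deriv f i y"
    by (intro AE_finite_allI AE_dir_deriv_neg) auto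
  then show ?thesis by eventually_elim (simp add: GDERIV_grad)
qed

text \<open>The divergence theorem, as the limit of the cutoffs of width \<open>1 / n\<close>.\<close>

lemma ball_integral_dir_deriv:
  "(\<integral>u. indicator (ball 0 1) u * dir_deriv f a u \<partial>lborel)
    = real DIM('a) * (\<integral>u. indicator (ball 0 1) u * (f (sgn u) * (sgn u \<bullet> a)) \<partial>lborel)"
proof -
  \<comment> \<open>Set to 0 outside the closed unit ball so that it is bounded, as the shell
    formula requires. Its values at \<open>sgn u\<close> are unaffected.\<close>
  define k where "k w = (if norm w \<le> 1 then f w * (w \<bullet> a) else 0)" for w
  define h where "h n = 1 / real (Suc n)" for n
  define shell where "shell n = {u :: 'a. 1 - h n < norm u \<and> norm u < 1}" for n
  define I where "I = (\<integral>u. indicator (ball 0 1) u * k (sgn u) \<partial>lborel)"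
  define V :: real where "V = (\<integral>u. indicator (ball (0::'a) 1) u * 1 \<partial>lborel)"
  let ?c = "\<lambda>n. 1 - (1 - h n) ^ DIM('a)"
  have [measurable]: "k \<in> borel_measurable borel" unfolding k_def by measurable
  have [measurable]: "shell n \<in> sets borel" for n
    unfolding shell_def by measurable
  have k_sgn: "k (sgn u) = f (sgn u) * (sgn u \<bullet> a)" for u by (simp add: k_def norm_sgn)
  have k_le: "\<bar>k w\<bar> \<le> (\<bar>f 0\<bar> + L) * norm a" for w
  proof (cases "norm w \<le> 1")
    case True
    have "\<bar>w \<bullet> a\<bar> \<le> 1 * norm a"
      using Cauchy_Schwarz_ineq2[of w a] mult_right_mono[OF True, of "norm a"] by simp
    then show ?thesis
      using True bounded_on_ball[OF True] by (auto simp: k_def abs_mult intro!: mult_mono)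
  qed (use L_nonneg in \<open>simp add: k_def\<close>)
  \<comment> \<open>The shifted index keeps the width strictly below the radius 1.\<close>
  have h: "0 < h n" "h (Suc n) < 1" for n by (auto simp: h_def)
  have h0: "h \<longlonglongrightarrow> 0" unfolding h_def by (rule LIMSEQ_Suc[OF lim_1_over_n])
  have lim1: "(\<lambda>n. \<integral>u. cutoff 1 (h (Suc n)) u * dir_deriv f a u \<partial>lborel)
      \<longlonglongrightarrow> (\<integral>u. indicator (ball 0 1) u * dir_deriv f a u \<partial>lborel)"
  proof (rule integral_dominated_convergence[where w="\<lambda>u. L * norm a * indicator (cball 0 1) u"])
    show "integrable lborel (\<lambda>u::'a. L * norm a * indicator (cball 0 1) u)"
      using emeasure_lborel_cball_finite[of 0 1] by (intro integrable_mult_right integrable_real_indicator) auto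
    have "(\<lambda>n. cutoff 1 (h (Suc n)) u) \<longlonglongrightarrow> indicator (ball 0 1) u" for u :: 'a
    proof (cases "norm u < 1")
      case True
      then have "eventually (\<lambda>n. h (Suc n) < 1 - norm u) sequentially"
        using order_tendstoD(2)[OF LIMSEQ_Suc[OF h0]] by simp
      then have "eventually (\<lambda>n. cutoff 1 (h (Suc n)) u = indicator (ball 0 1) u) sequentially"
      proof eventually_elim
        case (elim n)
        then have "(1 - norm u) / h (Suc n) \<ge> 1" using h(1)[of "Suc n"] by (simp add: le_divide_eq)
        then show ?case using True by (simp add: cutoff_def indicator_def)
      qed
      then show ?thesis by (rule tendsto_eventually)
    qed (use h in \<open>simp add: cutoff_eq_0 indicator_def\<close>)
    then show "AE u in lborel. (\<lambda>n. cutoff 1 (h (Suc n)) u * dir_deriv f a u)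
        \<longlonglongrightarrow> indicator (ball 0 1) u * dir_deriv f a u"
      by (intro AE_I2 tendsto_mult_right)
    fix n
    have "\<bar>cutoff 1 (h (Suc n)) u * dir_deriv f a u\<bar> \<le> L * norm a * indicator (cball 0 1) u" for u
      using mult_mono[OF cutoff_bounds(2)[of 1 "h (Suc n)" u] abs_dir_deriv_le[of a u]]
        cutoff_bounds(1)[of 1 "h (Suc n)" u] cutoff_eq_0[OF h(1), of 1 u "Suc n"]
      by (cases "norm u \<le> 1") (auto simp: abs_mult)
    then show "AE u in lborel. norm (cutoff 1 (h (Suc n)) u * dir_deriv f a u)
        \<le> L * norm a * indicator (cball 0 1) u" by simp
  qed measurable
  have shell_eq: "(\<integral>u. indicator (shell (Suc n)) u * k (sgn u) \<partial>lborel) = ?c (Suc n) * I"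
    "(\<integral>u. indicator (shell (Suc n)) u * 1 \<partial>lborel) = ?c (Suc n) * V" for n
    unfolding shell_def I_def V_def
    using integral_sgn_on_shell[of k, OF _ k_le h(1)[of "Suc n"] h(2)[of n]]
      integral_sgn_on_shell[of "\<lambda>_. 1" 1, OF _ _ h(1)[of "Suc n"] h(2)[of n]] by simp_all
  have int_shell: "integrable lborel (\<lambda>u. indicator (shell n) u * g (sgn u))"
    if [measurable]: "g \<in> borel_measurable borel" and "\<And>w. \<bar>g w\<bar> \<le> B" for g :: "'a \<Rightarrow> real" and B n
  proof (rule integrable_lborel_bounded_support)
    show "\<bar>indicator (shell n) u * g (sgn u)\<bar> \<le> B" for u
      using that(2)[of "sgn u"] by (auto simp: indicator_def)
    show "norm u > 1 \<Longrightarrow> indicator (shell n) u * g (sgn u) = 0" for u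
      by (simp add: shell_def)
  qed measurable
  \<comment> \<open>The relative volume of the shell divided by its width tends to the derivative of
    \<open>x ^ DIM('a)\<close> at 1. This is where the factor of the dimension in the theorem comes
    from.\<close>
  have c_lim: "(\<lambda>n. real (Suc n) * ?c n) \<longlonglongrightarrow> real DIM('a)"
  proof -
    have "((\<lambda>x::real. x ^ DIM('a)) has_derivative (\<lambda>v. real DIM('a) * v)) (at 1)"
      by (auto intro!: derivative_eq_intros)
    from tendsto_minus[OF has_derivative_seq_quotient[OF this, of "- 1"]]
    show ?thesis by (simp add: h_def right_diff_distrib' del: of_nat_Suc)
  qed
  then have lim2: "(\<lambda>n. real (Suc (Suc n)) * (?c (Suc n) * I)) \<longlonglongrightarrow> real DIM('a) * I"
    using tendsto_mult_right[OF LIMSEQ_Suc[OF c_lim], of I] by (simp only: mult.assoc)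
  \<comment> \<open>On the shell \<open>u\<close> is within \<open>h\<close> of
    \<open>sgn u\<close>, so replacing \<open>f u\<close> by \<open>f (sgn u)\<close> costs at most
    \<open>L * h\<close>. After division by \<open>h\<close> this is bounded, while the volume of
    the shell tends to 0.\<close>
  have diff: "\<bar>(\<integral>u. f u * shell_slope 1 (h (Suc n)) a u \<partial>lborel) - real (Suc (Suc n)) * (?c (Suc n) * I)\<bar>
      \<le> L * norm a * (?c (Suc n) * V)" for n
  proof -
    let ?S = "indicator (shell (Suc n)) :: 'a \<Rightarrow> real"
    have inth: "real (Suc (Suc n)) = 1 / h (Suc n)" by (simp add: h_def)
    have i1: "integrable lborel (\<lambda>u. f u * shell_slope 1 (h (Suc n)) a u)"
    proof (rule integrable_lborel_bounded_support)
      show "norm u > 1 \<Longrightarrow> f u * shell_slope 1 (h (Suc n)) a u = 0" for u by (simp add: shell_slope_def)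
      show "\<bar>f u * shell_slope 1 (h (Suc n)) a u\<bar> \<le> (\<bar>f 0\<bar> + L * 1) * (norm a / h (Suc n))" for u
      proof (cases "norm u < 1")
        case True
        have "\<bar>sgn u \<bullet> a\<bar> \<le> 1 * norm a"
          using Cauchy_Schwarz_ineq2[of "sgn u" a] by (cases "u = 0") (auto simp: norm_sgn)
        then have "\<bar>shell_slope 1 (h (Suc n)) a u\<bar> \<le> norm a / h (Suc n)"
          using h(1)[of "Suc n"] by (auto simp: shell_slope_def intro!: divide_right_mono)
        then show ?thesis
          unfolding abs_mult using bounded_on_ball[of u 1] True L_nonneg by (intro mult_mono) auto
      qed (use L_nonneg h(1)[of "Suc n"] in \<open>simp add: shell_slope_def\<close>)
    qed measurable
    have i2: "integrable lborel (\<lambda>u. ?S u * k (sgn u) / h (Suc n))"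
      using int_shell[of k, OF _ k_le] by simp
    have i3: "integrable lborel (\<lambda>u. ?S u * 1)" using int_shell[of "\<lambda>_. 1" 1] by simp
    have pt: "\<bar>f u * shell_slope 1 (h (Suc n)) a u - ?S u * k (sgn u) / h (Suc n)\<bar> \<le> L * norm a * (?S u * 1)" for u
    proof (cases "u \<in> shell (Suc n)")
      case True
      then have u: "1 - h (Suc n) < norm u" "norm u < 1" "u \<noteq> 0" using h(2)[of n] by (auto simp: shell_def)
      have "u - sgn u = (norm u - 1) *\<^sub>R sgn u"
        using u by (simp add: sgn_div_norm algebra_simps)
      then have "norm (u - sgn u) = 1 - norm u" using u by (simp add: norm_sgn)
      also have "\<dots> \<le> h (Suc n)" using u by simp
      finally have "\<bar>f u - f (sgn u)\<bar> \<le> L * h (Suc n)"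
        using lip[of u "sgn u"] mult_left_mono[OF _ L_nonneg] by (meson order_trans)
      moreover have "\<bar>sgn u \<bullet> a\<bar> \<le> norm a"
        using Cauchy_Schwarz_ineq2[of "sgn u" a] u by (simp add: norm_sgn)
      ultimately have "\<bar>(f u - f (sgn u)) * (sgn u \<bullet> a)\<bar> \<le> L * h (Suc n) * norm a"
        unfolding abs_mult by (intro mult_mono) auto
      then have "\<bar>(f u - f (sgn u)) * (sgn u \<bullet> a)\<bar> / h (Suc n) \<le> L * norm a"
        using h(1)[of "Suc n"] by (simp add: divide_le_eq mult_ac)
      moreover have "f u * shell_slope 1 (h (Suc n)) a u - ?S u * k (sgn u) / h (Suc n)
          = (f u - f (sgn u)) * (sgn u \<bullet> a) / h (Suc n)"
        using True u by (simp add: shell_slope_def k_sgn diff_divide_distrib left_diff_distrib)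
      ultimately show ?thesis using True h(1)[of "Suc n"] by simp
    next
      case False
      then show ?thesis by (auto simp: shell_slope_def shell_def)
    qed
    have "(\<integral>u. f u * shell_slope 1 (h (Suc n)) a u \<partial>lborel) - real (Suc (Suc n)) * (?c (Suc n) * I)
        = (\<integral>u. f u * shell_slope 1 (h (Suc n)) a u - ?S u * k (sgn u) / h (Suc n) \<partial>lborel)"
      using i1 i2 by (subst Bochner_Integration.integral_diff) (auto simp: shell_eq inth simp del: of_nat_Suc)
    also have "\<bar>\<dots>\<bar> \<le> (\<integral>u. \<bar>f u * shell_slope 1 (h (Suc n)) a u - ?S u * k (sgn u) / h (Suc n)\<bar> \<partial>lborel)"
      by (rule integral_abs_bound)
    also have "\<dots> \<le> (\<integral>u. L * norm a * (?S u * 1) \<partial>lborel)"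
      using i1 i2 i3 pt by (intro integral_mono integrable_abs Bochner_Integration.integrable_diff integrable_mult_right) auto
    also have "\<dots> = L * norm a * (?c (Suc n) * V)"
      by (subst integral_mult_right_zero) (simp only: shell_eq)
    finally show ?thesis .
  qed
  have "(\<lambda>n. ?c n) \<longlonglongrightarrow> 1 - (1 - 0) ^ DIM('a)" by (intro tendsto_intros h0)
  then have "?c \<longlonglongrightarrow> 0" by simp
  from tendsto_mult_left[OF tendsto_mult_right[OF LIMSEQ_Suc[OF this], of V], of "L * norm a"]
  have bound0: "(\<lambda>n. L * norm a * (?c (Suc n) * V)) \<longlonglongrightarrow> 0"
    unfolding mult_zero_left mult_zero_right .
  have "(\<lambda>n. (\<integral>u. f u * shell_slope 1 (h (Suc n)) a u \<partial>lborel) - real (Suc (Suc n)) * (?c (Suc n) * I)) \<longlonglongrightarrow> 0"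
    by (rule Lim_null_comparison[OF _ bound0], rule always_eventually, rule allI, unfold real_norm_def, rule diff)
  from tendsto_add[OF this lim2]
  have "(\<lambda>n. \<integral>u. f u * shell_slope 1 (h (Suc n)) a u \<partial>lborel) \<longlonglongrightarrow> real DIM('a) * I"
    by (simp only: diff_add_cancel add_0)
  moreover have "(\<integral>u. f u * shell_slope 1 (h (Suc n)) a u \<partial>lborel)
      = (\<integral>u. cutoff 1 (h (Suc n)) u * dir_deriv f a u \<partial>lborel)" for n
    using h by (simp add: integral_cutoff_dir_deriv)
  ultimately have "(\<lambda>n. \<integral>u. cutoff 1 (h (Suc n)) u * dir_deriv f a u \<partial>lborel) \<longlonglongrightarrow> real DIM('a) * I"
    by simp
  from LIMSEQ_unique[OF lim1 this] show ?thesis by (simp add: I_def k_sgn)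
qed

end

section \<open>Smoothing over the ball\<close>

lemma sets_borel_cball [measurable]: "cball (c::'a::metric_space) r \<in> sets borel"
  by simp

abbreviation ball_law :: "'a::euclidean_space measure" where
  "ball_law \<equiv> uniform_measure lborel (cball 0 1)"

lemma content_unit_ball_pos: "measure lborel (cball (0::'a::euclidean_space) 1) > 0"
  using content_cball_pos[of 1 "0::'a"] by simp

lemma emeasure_unit_ball: "emeasure lborel (cball (0::'a::euclidean_space) 1) = ennreal (measure lborel (cball (0::'a) 1))"
  using emeasure_lborel_cball_finite[of "0::'a" 1] by (intro emeasure_eq_ennreal_measure) auto

lemma prob_space_ball_law: "prob_space (ball_law :: 'a::euclidean_space measure)"
  using content_unit_ball_pos[where 'a='a] emeasure_lborel_cball_finite[of "0::'a" 1]
  by (intro prob_space_uniform_measure) (auto simp: emeasure_unit_ball)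

lemma integral_ball_law:
  fixes g :: "'a::euclidean_space \<Rightarrow> real"
  assumes g [measurable]: "g \<in> borel_measurable borel"
  shows "(\<integral>u. g u \<partial>ball_law) =
    (\<integral>u. indicator (ball 0 1) u * g u \<partial>lborel) / measure lborel (cball (0::'a) 1)"
proof -
  let ?v = "measure lborel (cball (0::'a) 1)"
  have "ball_law = density lborel (\<lambda>u::'a. ennreal (indicator (cball 0 1) u / ?v))"
    unfolding uniform_measure_def using content_unit_ball_pos[where 'a='a]
    by (intro density_cong) (auto simp: emeasure_unit_ball indicator_def divide_ennreal simp flip: ennreal_1)
  then have "(\<integral>u. g u \<partial>ball_law) = (\<integral>u. (indicator (cball 0 1) u / ?v) *\<^sub>R g u \<partial>lborel)"
    by (simp only:) (subst integral_density, auto)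
  also have "\<dots> = (\<integral>u. (indicator (ball 0 1) u * g u) / ?v \<partial>lborel)"
  proof (rule integral_cong_AE)
    show "AE u in lborel. (indicator (cball 0 1) u / ?v) *\<^sub>R g u = (indicator (ball 0 1) u * g u) / ?v"
      using AE_lborel_norm_neq[of 1] by eventually_elim (auto simp: indicator_def)
  qed measurable
  finally show ?thesis by simp
qed

lemma AE_ball_law_norm: "AE u in ball_law. norm (u::'a::euclidean_space) \<le> 1"
  by (rule AE_uniform_measureI) auto

lemma integrable_ball_law:
  fixes g :: "'a::euclidean_space \<Rightarrow> real"
  assumes "g \<in> borel_measurable borel" and "\<And>u. norm u \<le> 1 \<Longrightarrow> \<bar>g u\<bar> \<le> B"
  shows "integrable ball_law g"
proof -
  interpret prob_space "ball_law :: 'a measure" by (rule prob_space_ball_law)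
  have "AE u in ball_law. norm (g u) \<le> B"
    using AE_ball_law_norm by eventually_elim (simp add: assms(2))
  then show ?thesis using assms(1) by (intro integrable_const_bound) auto
qed

lemma integral_ball_law_uminus:
  fixes g :: "'a::euclidean_space \<Rightarrow> real"
  assumes g [measurable]: "g \<in> borel_measurable borel"
  shows "(\<integral>u. g (- u) \<partial>ball_law) = (\<integral>u. g u \<partial>ball_law)"
proof -
  have "(\<integral>u. indicator (ball 0 1) u * g u \<partial>lborel) =
      (\<integral>u. indicator (ball 0 1) ((-1) *\<^sub>R u) * g ((-1) *\<^sub>R u) \<partial>lborel)"
    using lborel_integral_scale[of "\<lambda>u. indicator (ball 0 1) u * g u" "-1"] by simp
  then show ?thesis by (simp add: integral_ball_law indicator_def)
qed

lemma AE_lborel_affine: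
  fixes x :: "'a::euclidean_space"
  assumes "AE y in lborel. P y" and "c \<noteq> 0"
  shows "AE u in lborel. P (x + c *\<^sub>R u)"
proof -
  obtain N where N: "N \<in> null_sets lborel" "{y. \<not> P y} \<subseteq> N"
    using assms(1) by (auto elim!: AE_E simp: null_sets_def)
  then have "AE y in lborel. y \<notin> N" by (intro AE_not_in)
  then have "AE y in density (distr lborel borel (\<lambda>u. x + c *\<^sub>R u)) (\<lambda>_. ennreal (\<bar>c\<bar> ^ DIM('a))). y \<notin> N"
    by (subst (asm) lborel_affine[OF assms(2), of x])
  then have "AE y in distr lborel borel (\<lambda>u. x + c *\<^sub>R u). y \<notin> N"
    using assms(2) by (simp add: AE_density)
  moreover have "N \<in> sets borel" using N(1) by (auto simp: null_sets_def)
  ultimately have "AE u in lborel. x + c *\<^sub>R u \<notin> N"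
    by (subst (asm) AE_distr_iff) auto
  then show ?thesis by eventually_elim (use N(2) in auto)
qed

lemma AE_ball_law_affine:
  fixes x :: "'a::euclidean_space"
  assumes "AE y in lborel. P y" and "c \<noteq> 0"
  shows "AE u in ball_law. P (x + c *\<^sub>R u)"
  using AE_lborel_affine[OF assms, of x] by (intro AE_uniform_measureI) (auto elim: eventually_mono)

lemma prob_space_uniform_sphere: "prob_space (uniform_sphere :: 'a::euclidean_space measure)"
  unfolding uniform_sphere_def
  by (intro prob_space.prob_space_distr prob_space_ball_law) simp

lemma sets_uniform_sphere [simp, measurable_cong]: "sets uniform_sphere = sets borel"
  by (simp add: uniform_sphere_def)

lemma space_uniform_sphere [simp]: "space uniform_sphere = UNIV"
  by (simp add: uniform_sphere_def)

lemma AE_uniform_sphere_norm: "AE w in uniform_sphere. norm w \<le> 1"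
  unfolding uniform_sphere_def by (subst AE_distr_iff) (auto simp: norm_sgn)

lemma integral_uniform_sphere:
  fixes g :: "'a::euclidean_space \<Rightarrow> 'b::{banach, second_countable_topology}"
  assumes [measurable]: "g \<in> borel_measurable borel"
  shows "(\<integral>w. g w \<partial>uniform_sphere) = (\<integral>u. g (sgn u) \<partial>ball_law)"
  unfolding uniform_sphere_def by (intro integral_distr) auto

lemma integrable_uniform_sphere:
  fixes g :: "'a::euclidean_space \<Rightarrow> 'b::{banach, second_countable_topology}"
  assumes "g \<in> borel_measurable borel" and "\<And>w. norm w \<le> 1 \<Longrightarrow> norm (g w) \<le> B"
  shows "integrable uniform_sphere g"
proof -
  interpret prob_space "uniform_sphere :: 'a measure" by (rule prob_space_uniform_sphere)
  have "AE w in uniform_sphere. norm (g w) \<le> B"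
    using AE_uniform_sphere_norm by eventually_elim (simp add: assms(2))
  then show ?thesis using assms(1) by (intro integrable_const_bound) auto
qed

section \<open>The smoothed objective and its gradient\<close>

context lipschitz_convex
begin

definition smoothing :: "real \<Rightarrow> 'a \<Rightarrow> real" where
  "smoothing \<rho> x = (\<integral>u. f (x + \<rho> *\<^sub>R u) \<partial>ball_law)"

text \<open>Taken as the mean of the two-point estimator for \<open>f\<close>.
  \<open>inner_smoothing_grad\<close> identifies it with an average of derivatives of
  \<open>f\<close>, and \<open>smoothing_subgradient\<close> makes it a subgradient of
  \<open>smoothing\<close>.\<close>

definition smoothing_grad :: "real \<Rightarrow> 'a \<Rightarrow> 'a" where
  "smoothing_grad \<rho> x = (\<integral>w. (real DIM('a) / (2 * \<rho>) * (f (x + \<rho> *\<^sub>R w) - f (x - \<rho> *\<^sub>R w))) *\<^sub>R w \<partial>uniform_sphere)"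

lemma integrable_smoothing: "\<rho> \<ge> 0 \<Longrightarrow> integrable ball_law (\<lambda>u. f (x + \<rho> *\<^sub>R u))"
proof (rule integrable_ball_law)
  fix u :: 'a assume "\<rho> \<ge> 0" "norm u \<le> 1"
  then have "norm (x + \<rho> *\<^sub>R u) \<le> norm x + \<rho>"
    by (intro norm_triangle_le) (simp add: mult_left_le)
  then show "\<bar>f (x + \<rho> *\<^sub>R u)\<bar> \<le> \<bar>f 0\<bar> + L * (norm x + \<rho>)"
    by (rule bounded_on_ball)
qed measurable

text \<open>Jensen's inequality for a symmetric law: pairing \<open>u\<close> with
  \<open>- u\<close> leaves only midpoint convexity.\<close>

lemma smoothing_ge:
  assumes "\<rho> \<ge> 0" shows "f x \<le> smoothing \<rho> x"
proof -
  interpret B: prob_space "ball_law :: 'a measure" by (rule prob_space_ball_law)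
  have eq: "(\<integral>u. f (x + \<rho> *\<^sub>R (- u)) \<partial>ball_law) = smoothing \<rho> x"
    unfolding smoothing_def by (rule integral_ball_law_uminus) measurable
  have int: "integrable ball_law (\<lambda>u. f (x + \<rho> *\<^sub>R (- u)))"
  proof (rule integrable_ball_law)
    fix u :: 'a assume "norm u \<le> 1"
    then have "norm (x + \<rho> *\<^sub>R (- u)) \<le> norm x + \<rho>"
      using assms by (intro norm_triangle_le) (simp add: mult_left_le)
    then show "\<bar>f (x + \<rho> *\<^sub>R (- u))\<bar> \<le> \<bar>f 0\<bar> + L * (norm x + \<rho>)"
      by (rule bounded_on_ball)
  qed measurable
  have "2 * f x = (\<integral>u. 2 * f x \<partial>(ball_law :: 'a measure))"
    using B.prob_space by simp
  also have "\<dots> \<le> (\<integral>u. f (x + \<rho> *\<^sub>R u) + f (x + \<rho> *\<^sub>R (- u)) \<partial>ball_law)"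
    using integrable_smoothing[OF assms] int midpoint_le by (intro integral_mono) auto
  also have "\<dots> = 2 * smoothing \<rho> x"
    using integrable_smoothing[OF assms] int eq by (simp add: smoothing_def)
  finally show ?thesis by simp
qed

lemma smoothing_le:
  assumes "\<rho> \<ge> 0" shows "smoothing \<rho> x \<le> f x + \<rho> * L"
proof -
  interpret B: prob_space "ball_law :: 'a measure" by (rule prob_space_ball_law)
  have "smoothing \<rho> x \<le> (\<integral>u. f x + \<rho> * L \<partial>(ball_law :: 'a measure))"
    unfolding smoothing_def
  proof (intro integral_mono_AE integrable_smoothing assms)
    show "AE u in ball_law. f (x + \<rho> *\<^sub>R u) \<le> f x + \<rho> * L"
      using AE_ball_law_norm
    proof eventually_elim
      case (elim u)
      have "L * norm (\<rho> *\<^sub>R u) \<le> L * \<rho>"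
        using elim assms L_nonneg by (intro mult_left_mono) (auto simp: mult_left_le)
      then show ?case using lip[of "x + \<rho> *\<^sub>R u" x] by (simp add: mult.commute)
    qed
  qed auto
  then show ?thesis using B.prob_space by simp
qed

lemma integrable_smoothing_grad:
  assumes "\<rho> > 0"
  shows "integrable uniform_sphere (\<lambda>w. (real DIM('a) / (2 * \<rho>) * (f (x + \<rho> *\<^sub>R w) - f (x - \<rho> *\<^sub>R w))) *\<^sub>R w)"
proof (rule integrable_uniform_sphere)
  fix w :: 'a assume w: "norm w \<le> 1"
  have "\<bar>f (x + \<rho> *\<^sub>R w) - f (x - \<rho> *\<^sub>R w)\<bar> \<le> L * norm ((2 * \<rho>) *\<^sub>R w)"
    using lip[of "x + \<rho> *\<^sub>R w" "x - \<rho> *\<^sub>R w"] by (simp add: scaleR_2 flip: scaleR_scaleR)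
  also have "\<dots> \<le> L * (2 * \<rho>)"
    using w assms L_nonneg by (intro mult_left_mono) (auto simp: mult_left_le)
  finally have "\<bar>real DIM('a) / (2 * \<rho>) * (f (x + \<rho> *\<^sub>R w) - f (x - \<rho> *\<^sub>R w))\<bar> \<le> real DIM('a) / (2 * \<rho>) * (L * (2 * \<rho>))"
    unfolding abs_mult using assms by (intro mult_mono) auto
  then show "norm ((real DIM('a) / (2 * \<rho>) * (f (x + \<rho> *\<^sub>R w) - f (x - \<rho> *\<^sub>R w))) *\<^sub>R w)
      \<le> real DIM('a) / (2 * \<rho>) * (L * (2 * \<rho>)) * 1"
    unfolding norm_scaleR using w assms L_nonneg by (intro mult_mono) auto
qed measurable

text \<open>The divergence theorem for \<open>f\<close> rescaled to the unit ball around
  \<open>x\<close>. It ties the zeroth-order estimator to first-order information on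
  \<open>f\<close> within distance \<open>\<rho>\<close>.\<close>

lemma inner_smoothing_grad:
  assumes \<rho>: "\<rho> > 0"
  shows "a \<bullet> smoothing_grad \<rho> x = (\<integral>u. dir_deriv f a (x + \<rho> *\<^sub>R u) \<partial>ball_law)"
proof -
  let ?g = "\<lambda>u. f (x + \<rho> *\<^sub>R u)" and ?d = "real DIM('a)" and ?v = "measure lborel (cball (0::'a) 1)"
  interpret g: lipschitz_convex ?g "\<rho> * L"
  proof
    show "convex_on UNIV ?g"
      unfolding convex_on_def
    proof (intro conjI ballI allI impI)
      fix y z :: 'a and u v :: real assume uv: "0 \<le> u" "0 \<le> v" "u + v = 1"
      have "x + \<rho> *\<^sub>R (u *\<^sub>R y + v *\<^sub>R z) = u *\<^sub>R (x + \<rho> *\<^sub>R y) + v *\<^sub>R (x + \<rho> *\<^sub>R z)"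
        using uv by (simp add: algebra_simps flip: scaleR_add_left)
      then show "f (x + \<rho> *\<^sub>R (u *\<^sub>R y + v *\<^sub>R z)) \<le> u * f (x + \<rho> *\<^sub>R y) + v * f (x + \<rho> *\<^sub>R z)"
        using convex uv by (simp add: convex_on_def)
    qed simp
    show "\<bar>?g y - ?g z\<bar> \<le> \<rho> * L * norm (y - z)" for y z
      using lip[of "x + \<rho> *\<^sub>R y" "x + \<rho> *\<^sub>R z"] \<rho> by (simp add: mult_ac flip: scaleR_diff_right)
  qed
  \<comment> \<open>Shrinking the direction by \<open>\<rho>\<close> undoes the rescaling of the
    argument, so both derivatives have the same quotients.\<close>
  have dd: "dir_deriv ?g (inverse \<rho> *\<^sub>R a) u = dir_deriv f a (x + \<rho> *\<^sub>R u)" for u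
    using \<rho> by (simp add: dir_deriv_def scaleR_add_right add.assoc mult.commute[of \<rho>])
  have s [measurable]: "(\<lambda>u. f (x + \<rho> *\<^sub>R sgn u) * (sgn u \<bullet> a)) \<in> borel_measurable borel"
    "(\<lambda>u. f (x - \<rho> *\<^sub>R sgn u) * (sgn u \<bullet> a)) \<in> borel_measurable borel" by measurable
  have bnd: "\<bar>f (x + c *\<^sub>R sgn u) * (sgn u \<bullet> a)\<bar> \<le> (\<bar>f 0\<bar> + L * (norm x + \<bar>c\<bar>)) * norm a" for u c
  proof -
    have "norm (x + c *\<^sub>R sgn u) \<le> norm x + \<bar>c\<bar>"
      by (intro norm_triangle_le) (simp add: norm_sgn)
    moreover have "\<bar>sgn u \<bullet> a\<bar> \<le> 1 * norm a"
      using Cauchy_Schwarz_ineq2[of "sgn u" a] by (cases "u = 0") (auto simp: norm_sgn)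
    moreover have "0 \<le> \<bar>f 0\<bar> + L * (norm x + \<bar>c\<bar>)" using L_nonneg by simp
    ultimately show ?thesis unfolding abs_mult by (intro mult_mono bounded_on_ball) auto
  qed
  have int: "integrable ball_law (\<lambda>u. f (x + \<rho> *\<^sub>R sgn u) * (sgn u \<bullet> a))"
    "integrable ball_law (\<lambda>u. f (x - \<rho> *\<^sub>R sgn u) * (sgn u \<bullet> a))"
    using bnd[of \<rho>] bnd[of "-\<rho>"] by (auto intro!: integrable_ball_law s)
  \<comment> \<open>By reflection the two halves of the symmetric difference contribute equally,
    which cancels the 2 in the denominator of the estimator.\<close>
  have refl: "(\<integral>u. f (x - \<rho> *\<^sub>R sgn u) * (sgn u \<bullet> a) \<partial>ball_law) = - (\<integral>u. f (x + \<rho> *\<^sub>R sgn u) * (sgn u \<bullet> a) \<partial>ball_law)"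
    using integral_ball_law_uminus[OF s(1)] by (simp add: sgn_minus) 
  have "(\<integral>u. dir_deriv f a (x + \<rho> *\<^sub>R u) \<partial>ball_law) = (\<integral>u. dir_deriv ?g (inverse \<rho> *\<^sub>R a) u \<partial>ball_law)"
    by (simp add: dd)
  also have "\<dots> = ?d * (\<integral>u. ?g (sgn u) * (sgn u \<bullet> (inverse \<rho> *\<^sub>R a)) \<partial>ball_law)"
    by (simp add: integral_ball_law g.ball_integral_dir_deriv del: inner_scaleR_right)
  also have "\<dots> = ?d / \<rho> * (\<integral>u. f (x + \<rho> *\<^sub>R sgn u) * (sgn u \<bullet> a) \<partial>ball_law)"
    using \<rho> by (simp add: divide_inverse mult_ac)
  finally have A: "(\<integral>u. dir_deriv f a (x + \<rho> *\<^sub>R u) \<partial>ball_law)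
      = ?d / \<rho> * (\<integral>u. f (x + \<rho> *\<^sub>R sgn u) * (sgn u \<bullet> a) \<partial>ball_law)" .
  have "a \<bullet> smoothing_grad \<rho> x
      = (\<integral>w. a \<bullet> ((?d / (2 * \<rho>) * (f (x + \<rho> *\<^sub>R w) - f (x - \<rho> *\<^sub>R w))) *\<^sub>R w) \<partial>uniform_sphere)"
    unfolding smoothing_grad_def
    by (rule integral_inner_right[symmetric]) (rule integrable_smoothing_grad[OF \<rho>])
  also have "\<dots> = (\<integral>u. ?d / (2 * \<rho>) * (f (x + \<rho> *\<^sub>R sgn u) * (sgn u \<bullet> a) - f (x - \<rho> *\<^sub>R sgn u) * (sgn u \<bullet> a)) \<partial>ball_law)"
    by (subst integral_uniform_sphere)
      (simp_all add: inner_commute[of a] left_diff_distrib right_diff_distrib mult.assoc)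
  also have "\<dots> = ?d / (2 * \<rho>) * (2 * (\<integral>u. f (x + \<rho> *\<^sub>R sgn u) * (sgn u \<bullet> a) \<partial>ball_law))"
    using int refl by simp
  finally show ?thesis using A by simp
qed

lemma smoothing_subgradient:
  assumes \<rho>: "\<rho> > 0"
  shows "smoothing \<rho> x + smoothing_grad \<rho> x \<bullet> (y - x) \<le> smoothing \<rho> y"
proof -
  have int: "integrable ball_law (\<lambda>u. dir_deriv f (y - x) (x + \<rho> *\<^sub>R u))"
    using abs_dir_deriv_le by (intro integrable_ball_law) auto
  have "smoothing \<rho> x + smoothing_grad \<rho> x \<bullet> (y - x)
      = (\<integral>u. f (x + \<rho> *\<^sub>R u) + dir_deriv f (y - x) (x + \<rho> *\<^sub>R u) \<partial>ball_law)"
    using int integrable_smoothing[of \<rho> x] \<rho>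
    by (simp add: inner_commute[of "smoothing_grad \<rho> x"] inner_smoothing_grad smoothing_def)
  also have "\<dots> \<le> smoothing \<rho> y"
    unfolding smoothing_def
  proof (intro integral_mono Bochner_Integration.integrable_add int integrable_smoothing)
    show "f (x + \<rho> *\<^sub>R u) + dir_deriv f (y - x) (x + \<rho> *\<^sub>R u) \<le> f (y + \<rho> *\<^sub>R u)" for u
      using dir_deriv_le_quotient[of 1 "y - x" "x + \<rho> *\<^sub>R u"] by (simp add: algebra_simps)
  qed (use \<rho> in auto)
  finally show ?thesis .
qed

end

section \<open>The Goldstein subdifferential of a convex function\<close>

text \<open>Clarke's limiting gradients at \<open>y\<close> are the vectors over \<open>y\<close> in
  the closure of this graph, so closedness and compactness replace the handling of
  sequences.\<close>

definition gderiv_graph :: "('a::euclidean_space \<Rightarrow> real) \<Rightarrow> ('a \<times> 'a) set" where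
  "gderiv_graph f = {(y, g). GDERIV f y :> g}"

lemma clarke_subdiff_eq: "clarke_subdiff f y = convex hull {g. (y, g) \<in> closure (gderiv_graph f)}"
proof -
  have "(\<exists>X G. X \<longlonglongrightarrow> y \<and> (\<forall>k. GDERIV f (X k) :> G k) \<and> G \<longlonglongrightarrow> g) \<longleftrightarrow>
      (y, g) \<in> closure (gderiv_graph f)" for g
  proof
    assume "\<exists>X G. X \<longlonglongrightarrow> y \<and> (\<forall>k. GDERIV f (X k) :> G k) \<and> G \<longlonglongrightarrow> g"
    then obtain X G where "X \<longlonglongrightarrow> y" "\<And>k. GDERIV f (X k) :> G k" "G \<longlonglongrightarrow> g" by blast
    then show "(y, g) \<in> closure (gderiv_graph f)"
      unfolding closure_sequential
      by (intro exI[of _ "\<lambda>k. (X k, G k)"]) (auto simp: gderiv_graph_def intro: tendsto_Pair)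
  next
    assume "(y, g) \<in> closure (gderiv_graph f)"
    then obtain Z where Z: "\<And>k. Z k \<in> gderiv_graph f" "Z \<longlonglongrightarrow> (y, g)"
      unfolding closure_sequential by blast
    then show "\<exists>X G. X \<longlonglongrightarrow> y \<and> (\<forall>k. GDERIV f (X k) :> G k) \<and> G \<longlonglongrightarrow> g"
      using tendsto_fst[OF Z(2)] tendsto_snd[OF Z(2)]
      by (intro exI[of _ "fst \<circ> Z"] exI[of _ "snd \<circ> Z"])
        (auto simp: gderiv_graph_def case_prod_beta comp_def)
  qed
  then show ?thesis by (simp add: clarke_subdiff_def)
qed

definition near_gradients :: "('a::euclidean_space \<Rightarrow> real) \<Rightarrow> real \<Rightarrow> 'a \<Rightarrow> 'a set" where
  "near_gradients f \<delta> x = {g. \<exists>y\<in>cball x \<delta>. (y, g) \<in> closure (gderiv_graph f)}"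

text \<open>The inner hulls are absorbed by the outer one, so topological arguments concern only the
  generators.\<close>

lemma goldstein_subdiff_eq: "goldstein_subdiff f \<delta> x = convex hull (near_gradients f \<delta> x)"
proof (rule antisym)
  have "clarke_subdiff f y \<subseteq> convex hull (near_gradients f \<delta> x)" if "y \<in> cball x \<delta>" for y
    unfolding clarke_subdiff_eq using that by (intro hull_mono) (auto simp: near_gradients_def)
  then show "goldstein_subdiff f \<delta> x \<subseteq> convex hull (near_gradients f \<delta> x)"
    unfolding goldstein_subdiff_def by (intro hull_minimal UN_least convex_convex_hull) auto
  show "convex hull (near_gradients f \<delta> x) \<subseteq> goldstein_subdiff f \<delta> x"
    unfolding goldstein_subdiff_def
    by (intro hull_mono) (auto simp: near_gradients_def clarke_subdiff_eq intro: hull_inc)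
qed

lemma infdist_lt_obtain:
  assumes "A \<noteq> {}" and "infdist x A < c"
  obtains a where "a \<in> A" "dist x a < c"
proof -
  have "(INF a\<in>A. dist x a) < c" using assms by (simp add: infdist_def)
  then show thesis using assms(1) that by (auto simp: cINF_less_iff)
qed

context lipschitz_convex
begin

lemma norm_gradient_le:
  assumes "GDERIV f y :> g" shows "norm g \<le> L"
proof (cases "g = 0")
  case False
  have "norm g * norm g = dir_deriv f g y"
    using dir_deriv_eq_inner[OF assms, of g] by (simp add: dot_square_norm power2_eq_square)
  also have "\<dots> \<le> L * norm g" using abs_dir_deriv_le[of g y] by linarith
  finally show ?thesis using False by simp
qed (simp add: L_nonneg)

lemma norm_closure_gderiv_graph_le:
  assumes "(y, g) \<in> closure (gderiv_graph f)" shows "norm g \<le> L"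
proof -
  have "gderiv_graph f \<subseteq> UNIV \<times> cball 0 L"
    using norm_gradient_le by (auto simp: gderiv_graph_def)
  then have "closure (gderiv_graph f) \<subseteq> UNIV \<times> cball 0 L"
    by (intro closure_minimal closed_Times) auto
  then show ?thesis using assms by auto
qed

lemma grad_mem_near_gradients:
  assumes "GDERIV f y :> g" and "dist x y \<le> \<delta>" shows "g \<in> near_gradients f \<delta> x"
  using assms closure_subset[of "gderiv_graph f"] by (auto simp: near_gradients_def gderiv_graph_def)

lemma AE_grad_mem_goldstein:
  assumes "\<delta> > 0"
  shows "AE u in ball_law. GDERIV f (x + \<delta> *\<^sub>R u) :> grad (x + \<delta> *\<^sub>R u)
    \<and> grad (x + \<delta> *\<^sub>R u) \<in> goldstein_subdiff f \<delta> x"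
proof -
  have "AE u in ball_law. GDERIV f (x + \<delta> *\<^sub>R u) :> grad (x + \<delta> *\<^sub>R u)"
    using assms by (intro AE_ball_law_affine AE_GDERIV_grad) auto
  then show ?thesis
    using AE_ball_law_norm
  proof eventually_elim
    case (elim u)
    then have "dist x (x + \<delta> *\<^sub>R u) \<le> \<delta>" using assms by (simp add: dist_norm mult_left_le)
    then show ?case
      using elim grad_mem_near_gradients by (auto simp: goldstein_subdiff_eq intro: hull_inc)
  qed
qed

lemma near_gradients_nonempty:
  assumes "\<delta> > 0" shows "near_gradients f \<delta> x \<noteq> {}"
proof
  assume "near_gradients f \<delta> x = {}"
  then have "AE u in (ball_law :: 'a measure). False"
    using AE_grad_mem_goldstein[OF assms, of x] by (simp add: goldstein_subdiff_eq)
  then show False using prob_space.AE_False[OF prob_space_ball_law] by blast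
qed

lemma goldstein_nonempty: "\<delta> > 0 \<Longrightarrow> goldstein_subdiff f \<delta> x \<noteq> {}"
  by (simp add: goldstein_subdiff_eq near_gradients_nonempty)

text \<open>Limiting gradients inherit the Lipschitz bound. This settles all accuracies
  \<open>\<epsilon> \<ge> L\<close> without any iteration.\<close>

lemma infdist_goldstein_le_L:
  assumes "\<delta> > 0" shows "infdist 0 (goldstein_subdiff f \<delta> x) \<le> L"
proof -
  obtain g where g: "g \<in> near_gradients f \<delta> x" using near_gradients_nonempty[OF assms] by blast
  then have "infdist 0 (goldstein_subdiff f \<delta> x) \<le> dist 0 g"
    by (intro infdist_le) (auto simp: goldstein_subdiff_eq intro: hull_inc)
  also have "\<dots> \<le> L" using g norm_closure_gderiv_graph_le by (auto simp: near_gradients_def)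
  finally show ?thesis .
qed

text \<open>An average of points of a convex set cannot be strictly separated from it: integrating
  the separating inequality over the ball contradicts \<open>inner_smoothing_grad\<close>.\<close>

lemma smoothing_grad_mem_closure_goldstein:
  assumes \<delta>: "\<delta> > 0" shows "smoothing_grad \<delta> x \<in> closure (goldstein_subdiff f \<delta> x)"
proof (rule ccontr)
  interpret B: prob_space "ball_law :: 'a measure" by (rule prob_space_ball_law)
  let ?K = "goldstein_subdiff f \<delta> x"
  assume "smoothing_grad \<delta> x \<notin> closure ?K"
  moreover have "convex ?K" by (simp add: goldstein_subdiff_def convex_convex_hull)
  ultimately obtain a b where ab: "a \<bullet> smoothing_grad \<delta> x < b" "\<And>k. k \<in> closure ?K \<Longrightarrow> b < a \<bullet> k"
    using separating_hyperplane_closed_point[of "closure ?K" "smoothing_grad \<delta> x"]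
    by (auto simp: convex_closure)
  have "b = (\<integral>u. b \<partial>(ball_law :: 'a measure))" using B.prob_space by simp
  also have "\<dots> \<le> (\<integral>u. dir_deriv f a (x + \<delta> *\<^sub>R u) \<partial>ball_law)"
  proof (rule integral_mono_AE)
    show "AE u in ball_law. b \<le> dir_deriv f a (x + \<delta> *\<^sub>R u)"
      using AE_grad_mem_goldstein[OF \<delta>, of x]
    proof eventually_elim
      case (elim u)
      then have "b < a \<bullet> grad (x + \<delta> *\<^sub>R u)" using ab(2) closure_subset by blast
      then show ?case using dir_deriv_eq_inner elim by fastforce
    qed
    show "integrable ball_law (\<lambda>u. dir_deriv f a (x + \<delta> *\<^sub>R u))"
      using abs_dir_deriv_le by (intro integrable_ball_law) auto
  qed auto
  also have "\<dots> = a \<bullet> smoothing_grad \<delta> x" by (rule inner_smoothing_grad[OF \<delta>, symmetric])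
  finally show False using ab(1) by simp
qed

lemma infdist_goldstein_le:
  assumes "\<delta> > 0"
  shows "infdist 0 (goldstein_subdiff f \<delta> x) \<le> norm (smoothing_grad \<delta> x)"
proof (rule field_le_epsilon)
  fix e :: real assume "e > 0"
  then obtain g where "g \<in> goldstein_subdiff f \<delta> x" "dist g (smoothing_grad \<delta> x) < e"
    using smoothing_grad_mem_closure_goldstein[OF assms, of x] by (auto simp: closure_approachable)
  then have "infdist 0 (goldstein_subdiff f \<delta> x) \<le> dist 0 g" by (intro infdist_le)
  also have "\<dots> \<le> norm (smoothing_grad \<delta> x) + e"
    using \<open>dist g _ < e\<close> norm_triangle_ineq2[of g "smoothing_grad \<delta> x"] by (simp add: dist_norm)
  finally show "infdist 0 (goldstein_subdiff f \<delta> x) \<le> norm (smoothing_grad \<delta> x) + e" .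
qed

text \<open>The distance is lower semicontinuous, since the graph of limiting gradients is closed and
  bounded in its second component.\<close>

lemma closed_infdist_goldstein:
  assumes \<delta>: "\<delta> > 0" shows "closed {x. infdist 0 (goldstein_subdiff f \<delta> x) \<le> c}"
  unfolding closed_sequential_limits
proof (intro allI impI, elim conjE)
  fix X x assume X: "\<forall>n. X n \<in> {x. infdist 0 (goldstein_subdiff f \<delta> x) \<le> c}" "X \<longlonglongrightarrow> x"
  let ?H = "goldstein_subdiff f \<delta> x"
  have "infdist 0 ?H \<le> c + e" if e: "e > 0" for e
  proof -
    \<comment> \<open>The \<open>e / 2\<close>-neighbourhood of \<open>?H\<close>. It is convex as a
      sum of convex sets, so it contains a whole hull once it contains the generators.\<close>
    define V where "V = (\<Union>h\<in>?H. \<Union>z\<in>ball 0 (e / 2). {h + z})"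
    have Vopen: "open V"
    proof -
      have "V = (\<Union>h\<in>?H. ball h (e / 2))"
      proof (rule set_eqI)
        fix v :: 'a
        have "v = h + z \<longleftrightarrow> z = v - h" for h z :: 'a by (auto simp: algebra_simps)
        then show "v \<in> V \<longleftrightarrow> v \<in> (\<Union>h\<in>?H. ball h (e / 2))"
          by (auto simp: V_def dist_norm norm_minus_commute)
      qed
      then show ?thesis by auto
    qed
    have Vconvex: "convex V"
      unfolding V_def goldstein_subdiff_def by (intro convex_sums convex_convex_hull convex_ball)
    have HV: "?H \<subseteq> V"
    proof
      fix h assume "h \<in> ?H"
      then show "h \<in> V" unfolding V_def using e by (intro UN_I[of h] UN_I[of 0]) auto
    qed
    \<comment> \<open>Compactness: otherwise gradients outside \<open>V\<close> subconverge to a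
      limiting gradient within \<open>\<delta>\<close> of \<open>x\<close>. It belongs to
      \<open>?H\<close> and hence to \<open>V\<close>, although the complement of \<open>V\<close>
      is closed.\<close>
    have "\<exists>n. near_gradients f \<delta> (X n) \<subseteq> V"
    proof (rule ccontr)
      assume "\<nexists>n. near_gradients f \<delta> (X n) \<subseteq> V"
      then have "\<forall>n. \<exists>y g. dist (X n) y \<le> \<delta> \<and> (y, g) \<in> closure (gderiv_graph f) \<and> g \<notin> V"
        by (force simp: near_gradients_def)
      then obtain Y G where YG: "\<And>n. dist (X n) (Y n) \<le> \<delta>"
        "\<And>n. (Y n, G n) \<in> closure (gderiv_graph f)" "\<And>n. G n \<notin> V" by metis
      obtain B where B: "\<And>n. norm (X n) \<le> B"
        using convergent_imp_Bseq[OF convergentI[OF X(2)]] by (auto simp: Bseq_def)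
      have YG_mem: "\<forall>n. (Y n, G n) \<in> cball 0 (B + \<delta>) \<times> cball 0 L"
      proof
        fix n
        have "norm (Y n) \<le> B + \<delta>"
          using B[of n] YG(1)[of n] norm_triangle_ineq2[of "Y n" "X n"]
          by (simp add: dist_norm norm_minus_commute)
        then show "(Y n, G n) \<in> cball 0 (B + \<delta>) \<times> cball 0 L"
          using norm_closure_gderiv_graph_le[OF YG(2)] by auto
      qed
      have "seq_compact (cball (0::'a) (B + \<delta>) \<times> cball (0::'a) L)"
        by (intro compact_imp_seq_compact compact_Times compact_cball)
      then obtain p r where p: "strict_mono r" "((\<lambda>n. (Y n, G n)) \<circ> r) \<longlonglongrightarrow> p"
        using YG_mem by (rule seq_compactE)
      obtain y g where yg: "p = (y, g)" by (cases p)
      have "(y, g) \<in> closure (gderiv_graph f)"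
        using closed_sequentially[OF closed_closure _ p(2)[unfolded yg]] YG(2) by simp
      moreover have "dist x y \<le> \<delta>"
      proof (rule LIMSEQ_le_const2)
        show "(\<lambda>n. dist (X (r n)) (Y (r n))) \<longlonglongrightarrow> dist x y"
          using tendsto_dist[OF LIMSEQ_subseq_LIMSEQ[OF X(2) p(1)] tendsto_fst[OF p(2)]]
          by (simp add: yg comp_def)
      qed (use YG(1) in auto)
      ultimately have "g \<in> ?H"
        unfolding goldstein_subdiff_eq by (intro hull_inc) (auto simp: near_gradients_def)
      moreover have "g \<in> - V"
      proof (rule closed_sequentially)
        show "closed (- V)" using Vopen by (simp add: closed_def)
        show "(\<lambda>n. G (r n)) \<longlonglongrightarrow> g" using tendsto_snd[OF p(2)] by (simp add: yg comp_def)
      qed (use YG(3) in auto)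
      ultimately show False using HV by auto
    qed
    then obtain n where "goldstein_subdiff f \<delta> (X n) \<subseteq> V"
      unfolding goldstein_subdiff_eq using Vconvex hull_minimal by blast
    moreover have "infdist 0 (goldstein_subdiff f \<delta> (X n)) < c + e / 2"
      using X(1)[rule_format, of n] e by simp
    then obtain g where g: "g \<in> goldstein_subdiff f \<delta> (X n)" "dist 0 g < c + e / 2"
      by (rule infdist_lt_obtain[OF goldstein_nonempty[OF \<delta>]])
    ultimately obtain h z where hz: "h \<in> ?H" "norm z < e / 2" "g = h + z"
      by (auto simp: V_def)
    have "infdist 0 ?H \<le> dist 0 h" using hz by (intro infdist_le)
    also have "\<dots> \<le> c + e"
      using hz g(2) norm_triangle_ineq4[of g z] by simp
    finally show ?thesis .
  qed
  then show "x \<in> {x. infdist 0 (goldstein_subdiff f \<delta> x) \<le> c}"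
    by (auto intro: field_le_epsilon)
qed

lemma borel_measurable_infdist_goldstein:
  "\<delta> > 0 \<Longrightarrow> (\<lambda>x. infdist 0 (goldstein_subdiff f \<delta> x)) \<in> borel_measurable borel"
  by (subst borel_measurable_iff_le) (use closed_infdist_goldstein in auto)

end

section \<open>Rotations\<close>

lemma nn_integral_lborel_shift:
  fixes g :: "'a::euclidean_space \<Rightarrow> ennreal"
  assumes [measurable]: "g \<in> borel_measurable borel"
  shows "(\<integral>\<^sup>+u. g (u + c) \<partial>lborel) = (\<integral>\<^sup>+u. g u \<partial>lborel)"
proof -
  have "(\<integral>\<^sup>+u. g u \<partial>lborel) = (\<integral>\<^sup>+u. g u \<partial>distr lborel borel ((+) c))"
    by (simp add: lborel_distr_plus)
  then show ?thesis by (simp add: nn_integral_distr add.commute)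
qed

lemma nn_integral_lborel_scale:
  fixes g :: "'a::euclidean_space \<Rightarrow> ennreal"
  assumes [measurable]: "g \<in> borel_measurable borel" and "c \<noteq> 0"
  shows "(\<integral>\<^sup>+u. g u \<partial>lborel) = ennreal (\<bar>c\<bar> ^ DIM('a)) * (\<integral>\<^sup>+u. g (c *\<^sub>R u) \<partial>lborel)"
proof -
  have "(\<integral>\<^sup>+u. g u \<partial>lborel) = (\<integral>\<^sup>+u. g u \<partial>density (distr lborel borel (\<lambda>x. 0 + c *\<^sub>R x)) (\<lambda>_. ennreal (\<bar>c\<bar> ^ DIM('a))))"
    using lborel_affine[of c "0::'a"] assms(2) by (simp add: ennreal_power)
  also have "\<dots> = ennreal (\<bar>c\<bar> ^ DIM('a)) * (\<integral>\<^sup>+u. g (c *\<^sub>R u) \<partial>lborel)"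
    by (simp add: nn_integral_density nn_integral_distr nn_integral_cmult)
  finally show ?thesis .
qed

lemma borel_measurable_pair_map:
  fixes A B C D :: real
  shows "(\<lambda>p. (A *\<^sub>R fst p + B *\<^sub>R snd p, C *\<^sub>R fst p + D *\<^sub>R snd p)) \<in>
    borel_measurable (borel :: ('a::euclidean_space \<times> 'a) measure)"
  by (intro borel_measurable_continuous_onI continuous_intros)

lemma nn_integral_lborel_fst:
  fixes H :: "'a::euclidean_space \<times> 'b::euclidean_space \<Rightarrow> ennreal"
  assumes "H \<in> borel_measurable borel"
  shows "(\<integral>\<^sup>+p. H p \<partial>lborel) = (\<integral>\<^sup>+x. \<integral>\<^sup>+y. H (x, y) \<partial>lborel \<partial>lborel)"
  using assms by (subst lborel.nn_integral_fst) (simp_all add: lborel_prod flip: borel_prod)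

lemma nn_integral_lborel_snd:
  fixes H :: "'a::euclidean_space \<times> 'b::euclidean_space \<Rightarrow> ennreal"
  assumes "H \<in> borel_measurable borel"
  shows "(\<integral>\<^sup>+p. H p \<partial>lborel) = (\<integral>\<^sup>+y. \<integral>\<^sup>+x. H (x, y) \<partial>lborel \<partial>lborel)"
proof -
  have "H \<in> borel_measurable (lborel \<Otimes>\<^sub>M lborel)" using assms by (simp add: lborel_prod)
  then show ?thesis by (subst lborel_pair.nn_integral_snd) (simp_all add: lborel_prod)
qed

lemma borel_measurable_Pair1:
  "H \<in> borel_measurable (borel :: ('a::euclidean_space \<times> 'b::euclidean_space) measure) \<Longrightarrow>
    (\<lambda>y. H (x, y)) \<in> borel_measurable borel"
  by (rule measurable_compose[of "Pair x" borel]) (auto intro!: borel_measurable_continuous_onI continuous_intros)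

lemma borel_measurable_Pair2:
  "H \<in> borel_measurable (borel :: ('a::euclidean_space \<times> 'b::euclidean_space) measure) \<Longrightarrow>
    (\<lambda>x. H (x, y)) \<in> borel_measurable borel"
  by (rule measurable_compose[of "\<lambda>x. (x, y)" borel]) (auto intro!: borel_measurable_continuous_onI continuous_intros)

text \<open>For each fixed second component the shear is a translation of the first one.\<close>

lemma nn_integral_shear1:
  fixes H :: "'a::euclidean_space \<times> 'a \<Rightarrow> ennreal"
  assumes H: "H \<in> borel_measurable borel"
  shows "(\<integral>\<^sup>+p. H (fst p + \<alpha> *\<^sub>R snd p, snd p) \<partial>lborel) = (\<integral>\<^sup>+p. H p \<partial>lborel)"
proof -
  have "(\<lambda>p. H (fst p + \<alpha> *\<^sub>R snd p, snd p)) \<in> borel_measurable borel"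
    using measurable_compose[OF borel_measurable_pair_map[of 1 \<alpha> 0 1] H] by simp
  then have "(\<integral>\<^sup>+p. H (fst p + \<alpha> *\<^sub>R snd p, snd p) \<partial>lborel)
      = (\<integral>\<^sup>+y. \<integral>\<^sup>+x. H (x + \<alpha> *\<^sub>R y, y) \<partial>lborel \<partial>lborel)"
    by (subst nn_integral_lborel_snd) simp_all
  also have "\<dots> = (\<integral>\<^sup>+y. \<integral>\<^sup>+x. H (x, y) \<partial>lborel \<partial>lborel)"
    by (intro nn_integral_cong nn_integral_lborel_shift[of "\<lambda>x. H (x, _)"] borel_measurable_Pair2 H)
  also have "\<dots> = (\<integral>\<^sup>+p. H p \<partial>lborel)"
    by (rule nn_integral_lborel_snd[OF H, symmetric])
  finally show ?thesis .
qed

lemma nn_integral_shear2: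
  fixes H :: "'a::euclidean_space \<times> 'a \<Rightarrow> ennreal"
  assumes H: "H \<in> borel_measurable borel"
  shows "(\<integral>\<^sup>+p. H (fst p, snd p + \<beta> *\<^sub>R fst p) \<partial>lborel) = (\<integral>\<^sup>+p. H p \<partial>lborel)"
proof -
  have "(\<lambda>p. H (fst p, snd p + \<beta> *\<^sub>R fst p)) \<in> borel_measurable borel"
    using measurable_compose[OF borel_measurable_pair_map[of 1 0 \<beta> 1] H] by (simp add: add.commute)
  then have "(\<integral>\<^sup>+p. H (fst p, snd p + \<beta> *\<^sub>R fst p) \<partial>lborel)
      = (\<integral>\<^sup>+x. \<integral>\<^sup>+y. H (x, y + \<beta> *\<^sub>R x) \<partial>lborel \<partial>lborel)"
    by (subst nn_integral_lborel_fst) simp_all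
  also have "\<dots> = (\<integral>\<^sup>+x. \<integral>\<^sup>+y. H (x, y) \<partial>lborel \<partial>lborel)"
    by (intro nn_integral_cong nn_integral_lborel_shift[of "\<lambda>y. H (_, y)"] borel_measurable_Pair1 H)
  also have "\<dots> = (\<integral>\<^sup>+p. H p \<partial>lborel)"
    by (rule nn_integral_lborel_fst[OF H, symmetric])
  finally show ?thesis .
qed

text \<open>A rotation in the plane of the two coordinates is a product of three shears.\<close>

lemma nn_integral_rotation:
  fixes H :: "'a::euclidean_space \<times> 'a \<Rightarrow> ennreal"
  assumes H: "H \<in> borel_measurable borel" and cs: "c\<^sup>2 + s\<^sup>2 = 1" "s \<noteq> 0"
  shows "(\<integral>\<^sup>+p. H (c *\<^sub>R fst p + s *\<^sub>R snd p, (- s) *\<^sub>R fst p + c *\<^sub>R snd p) \<partial>lborel) = (\<integral>\<^sup>+p. H p \<partial>lborel)"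
proof -
  \<comment> \<open>The tangent of half the angle whose cosine and sine are \<open>c\<close> and
    \<open>s\<close>, the coefficient of the outer shears.\<close>
  define \<alpha> where "\<alpha> = (1 - c) / s"
  define S where "S p = (fst p + \<alpha> *\<^sub>R snd p, snd p)" for p :: "'a \<times> 'a"
  define T where "T p = (fst p, snd p + (- s) *\<^sub>R fst p)" for p :: "'a \<times> 'a"
  have S: "S \<in> borel_measurable borel" and T: "T \<in> borel_measurable borel"
    unfolding S_def[abs_def] T_def[abs_def]
    by (intro borel_measurable_continuous_onI continuous_intros)+
  have c: "1 - \<alpha> * s = c" using cs by (simp add: \<alpha>_def)
  have "(1 - c) * (1 + c) = s * s" using cs by (simp add: algebra_simps power2_eq_square)
  then have s: "\<alpha> + \<alpha> * c = s" using cs by (simp add: \<alpha>_def field_simps)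
  have "S (T (S p)) = (c *\<^sub>R fst p + s *\<^sub>R snd p, (- s) *\<^sub>R fst p + c *\<^sub>R snd p)" for p
  proof (rule prod_eqI)
    show "snd (S (T (S p))) = snd (c *\<^sub>R fst p + s *\<^sub>R snd p, (- s) *\<^sub>R fst p + c *\<^sub>R snd p)"
      by (simp add: S_def T_def algebra_simps flip: c)
    have "fst (S (T (S p))) = (1 - \<alpha> * s) *\<^sub>R fst p + (\<alpha> *\<^sub>R snd p + (\<alpha> * (1 - \<alpha> * s)) *\<^sub>R snd p)"
      by (simp add: S_def T_def algebra_simps)
    then show "fst (S (T (S p))) = fst (c *\<^sub>R fst p + s *\<^sub>R snd p, (- s) *\<^sub>R fst p + c *\<^sub>R snd p)"
      unfolding c by (simp flip: s scaleR_add_left)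
  qed
  then have "(\<integral>\<^sup>+p. H (c *\<^sub>R fst p + s *\<^sub>R snd p, (- s) *\<^sub>R fst p + c *\<^sub>R snd p) \<partial>lborel)
      = (\<integral>\<^sup>+p. (\<lambda>q. H (S (T q))) (S p) \<partial>lborel)" by simp
  also have "\<dots> = (\<integral>\<^sup>+q. (\<lambda>q. H (S q)) (T q) \<partial>lborel)"
    unfolding S_def[of p for p] T_def
    by (subst nn_integral_shear1[symmetric, of _ \<alpha>])
      (use measurable_compose[OF T measurable_compose[OF S H]] in \<open>simp_all add: S_def T_def\<close>)
  also have "\<dots> = (\<integral>\<^sup>+q. H (S q) \<partial>lborel)"
    using nn_integral_shear2[OF measurable_compose[OF S H], of "- s"] by (simp add: T_def)
  also have "\<dots> = (\<integral>\<^sup>+q. H q \<partial>lborel)"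
    using nn_integral_shear1[OF H, of \<alpha>] by (simp add: S_def)
  finally show ?thesis .
qed

lemma norm_rotation:
  fixes x y :: "'a::euclidean_space"
  assumes "c\<^sup>2 + s\<^sup>2 = 1"
  shows "norm (c *\<^sub>R x + s *\<^sub>R y, (- s) *\<^sub>R x + c *\<^sub>R y) = norm (x, y)"
proof -
  have "(norm (c *\<^sub>R x + s *\<^sub>R y))\<^sup>2 + (norm ((- s) *\<^sub>R x + c *\<^sub>R y))\<^sup>2
      = (c\<^sup>2 + s\<^sup>2) * (norm x)\<^sup>2 + (c\<^sup>2 + s\<^sup>2) * (norm y)\<^sup>2"
    unfolding power2_norm_eq_inner
    by (simp add: inner_simps inner_commute power2_eq_square algebra_simps)
  then show ?thesis using assms by (simp add: norm_Pair)
qed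

section \<open>Radial integrals\<close>

text \<open>Integration against the uniform law on the sphere, up to the volume of the ball; see
  \<open>nn_integral_uniform_sphere\<close>.\<close>

definition ball_angular :: "('a::euclidean_space \<Rightarrow> ennreal) \<Rightarrow> ennreal" where
  "ball_angular k = (\<integral>\<^sup>+u. indicator (ball 0 1) u * k (sgn u) \<partial>lborel)"

text \<open>The weight \<open>(norm u)\<^sup>2\<close> turns an angular function into the degree-two
  homogeneous functions that occur in the Poincare inequality.\<close>

definition ball_moment :: "('a::euclidean_space \<Rightarrow> ennreal) \<Rightarrow> ennreal" where
  "ball_moment k = (\<integral>\<^sup>+u. indicator (ball 0 1) u * (ennreal ((norm u)\<^sup>2) * k (sgn u)) \<partial>lborel)"

context
  fixes k :: "'a::euclidean_space \<Rightarrow> ennreal"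
  assumes k [measurable]: "k \<in> borel_measurable borel"
begin

lemma ball_angular_scale:
  assumes "r > 0"
  shows "(\<integral>\<^sup>+u. indicator (ball 0 r) u * k (sgn u) \<partial>lborel) = ennreal (r ^ DIM('a)) * ball_angular k"
proof -
  have "indicator (ball 0 r) (r *\<^sub>R u) = (indicator (ball 0 1) u :: ennreal)" for u :: 'a
    using assms by (auto simp: indicator_def)
  then show ?thesis
    using assms by (subst nn_integral_lborel_scale[of _ r]) (auto simp: sgn_scaleR ball_angular_def)
qed

lemma ball_moment_scale:
  assumes "r > 0"
  shows "(\<integral>\<^sup>+u. indicator (ball 0 r) u * (ennreal ((norm u)\<^sup>2) * k (sgn u)) \<partial>lborel)
    = ennreal (r ^ DIM('a) * r\<^sup>2) * ball_moment k"
proof -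
  have *: "indicator (ball 0 r) (r *\<^sub>R u) = (indicator (ball 0 1) u :: ennreal)" for u :: 'a
    using assms by (auto simp: indicator_def)
  have "(\<integral>\<^sup>+u. indicator (ball 0 r) u * (ennreal ((norm u)\<^sup>2) * k (sgn u)) \<partial>lborel)
    = ennreal (r ^ DIM('a)) * (\<integral>\<^sup>+u. ennreal (r\<^sup>2) * (indicator (ball 0 1) u * (ennreal ((norm u)\<^sup>2) * k (sgn u))) \<partial>lborel)"
    using assms
    by (subst nn_integral_lborel_scale[of _ r])
      (auto simp: sgn_scaleR * power_mult_distrib ennreal_mult' mult_ac)
  also have "\<dots> = ennreal (r ^ DIM('a)) * (ennreal (r\<^sup>2) * ball_moment k)"
    by (subst nn_integral_cmult) (auto simp: ball_moment_def)
  finally show ?thesis using assms by (simp add: ennreal_mult' mult_ac)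
qed

text \<open>Writing \<open>1 - norm u ^ 2\<close> as the length of the interval \<open>(norm u ^ 2, 1)\<close> and exchanging
  the integrals shows that the angular part factors out of the radial integral.\<close>

lemma ball_complement_moment:
  "(\<integral>\<^sup>+u. indicator (ball 0 1) u * (ennreal (1 - (norm u)\<^sup>2) * k (sgn u)) \<partial>lborel)
    = (\<integral>\<^sup>+s. indicator {0<..<1} s * ennreal (sqrt s ^ DIM('a)) \<partial>lborel) * ball_angular k"
proof -
  have [measurable]: "(\<lambda>(u::'a, s::real). indicator {(norm u)\<^sup>2<..<1} s :: ennreal) \<in> borel_measurable (borel \<Otimes>\<^sub>M borel)"
  proof -
    have "(\<lambda>(u::'a, s::real). indicator {(norm u)\<^sup>2<..<1} s :: ennreal)
        = (\<lambda>x. if (norm (fst x))\<^sup>2 < snd x \<and> snd x < 1 then 1 else 0)"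
      by (auto simp: indicator_def fun_eq_iff)
    then show ?thesis by simp
  qed
  have "indicator (ball 0 1) u * (ennreal (1 - (norm u)\<^sup>2) * k (sgn u))
      = (\<integral>\<^sup>+s. indicator {(norm u)\<^sup>2<..<1} s * k (sgn u) \<partial>lborel)" for u :: 'a
  proof -
    have "(\<integral>\<^sup>+s. indicator {(norm u)\<^sup>2<..<1} s * k (sgn u) \<partial>lborel) = emeasure lborel {(norm u)\<^sup>2<..<1} * k (sgn u)"
      by (subst nn_integral_multc) auto
    also have "emeasure lborel {(norm u)\<^sup>2<..<1} = indicator (ball 0 1) u * ennreal (1 - (norm u)\<^sup>2)"
    proof (cases "norm u < 1")
      case True
      then have "(norm u)\<^sup>2 \<le> 1" by (simp add: power_le_one)
      then show ?thesis using True by simp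
    next
      case False
      then have "1 \<le> (norm u)\<^sup>2" by (simp add: one_le_power)
      then show ?thesis using False by simp
    qed
    finally show ?thesis by (simp add: mult.assoc)
  qed
  then have "(\<integral>\<^sup>+u. indicator (ball 0 1) u * (ennreal (1 - (norm u)\<^sup>2) * k (sgn u)) \<partial>lborel)
      = (\<integral>\<^sup>+u. \<integral>\<^sup>+s. indicator {(norm u)\<^sup>2<..<1} s * k (sgn u) \<partial>lborel \<partial>lborel)" by simp
  also have "\<dots> = (\<integral>\<^sup>+s. \<integral>\<^sup>+u. indicator {(norm u)\<^sup>2<..<1} s * k (sgn u) \<partial>lborel \<partial>lborel)"
    by (rule lborel_pair.Fubini') measurable
  also have "\<dots> = (\<integral>\<^sup>+s. indicator {0<..<1} s * ennreal (sqrt s ^ DIM('a)) * ball_angular k \<partial>lborel)"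
  proof (rule nn_integral_cong_AE, rule AE_I2)
    fix s :: real
    have ind: "indicator {(norm u)\<^sup>2<..<1} s = (indicator {0<..<1} s * indicator (ball 0 (sqrt s)) u :: ennreal)"
      if "s > 0" for u :: 'a
    proof -
      have "(norm u)\<^sup>2 < s \<longleftrightarrow> norm u < sqrt s"
        using real_sqrt_less_iff[of "(norm u)\<^sup>2" s] by (simp del: real_sqrt_less_iff)
      then show ?thesis using that by (auto simp: indicator_def)
    qed
    show "(\<integral>\<^sup>+u. indicator {(norm u)\<^sup>2<..<1} s * k (sgn u) \<partial>lborel)
        = indicator {0<..<1} s * ennreal (sqrt s ^ DIM('a)) * ball_angular k"
    proof (cases "s \<in> {0<..<1}")
      case True
      then show ?thesis using ball_angular_scale[of "sqrt s"] by (simp add: ind)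
    next
      case False
      then have "indicator {(norm u)\<^sup>2<..<1} s = (0::ennreal)" for u :: 'a
        using order_le_less_trans[OF zero_le_power2[of "norm u"], of s] by (simp add: indicator_def)
      then show ?thesis using False by simp
    qed
  qed
  also have "\<dots> = (\<integral>\<^sup>+s. indicator {0<..<1} s * ennreal (sqrt s ^ DIM('a)) \<partial>lborel) * ball_angular k"
    by (rule nn_integral_multc) measurable
  finally show ?thesis .
qed

lemma ball_angular_split:
  "(\<integral>\<^sup>+u. indicator (ball 0 1) u * (ennreal (1 - (norm u)\<^sup>2) * k (sgn u)) \<partial>lborel) + ball_moment k = ball_angular k"
proof -
  have "(\<integral>\<^sup>+u. indicator (ball 0 1) u * (ennreal (1 - (norm u)\<^sup>2) * k (sgn u)) \<partial>lborel) + ball_moment k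
      = (\<integral>\<^sup>+u. indicator (ball 0 1) u * (ennreal (1 - (norm u)\<^sup>2) * k (sgn u))
          + indicator (ball 0 1) u * (ennreal ((norm u)\<^sup>2) * k (sgn u)) \<partial>lborel)"
    unfolding ball_moment_def by (rule nn_integral_add[symmetric]) measurable
  also have "\<dots> = ball_angular k"
    unfolding ball_angular_def
  proof (rule nn_integral_cong)
    fix u :: 'a
    have "ennreal (1 - (norm u)\<^sup>2) + ennreal ((norm u)\<^sup>2) = 1" if "norm u < 1"
    proof -
      have "(norm u)\<^sup>2 \<le> 1" using that by (simp add: power_le_one)
      then show ?thesis by (simp flip: ennreal_plus)
    qed
    then show "indicator (ball 0 1) u * (ennreal (1 - (norm u)\<^sup>2) * k (sgn u))
          + indicator (ball 0 1) u * (ennreal ((norm u)\<^sup>2) * k (sgn u)) = indicator (ball 0 1) u * k (sgn u)"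
      by (auto simp: indicator_def simp flip: distrib_right)
  qed
  finally show ?thesis .
qed

end

text \<open>The radial constant \<open>C\<close> is the same for every angular function. Hence the
  moment is a fixed fraction of the angular integral, and proportionality passes from one to the
  other. Finiteness permits the cancellation in \<open>ennreal\<close>.\<close>

lemma ball_moment_eq:
  fixes k :: "'a::euclidean_space \<Rightarrow> ennreal"
  assumes k: "k \<in> borel_measurable borel" and I: "ball_angular k = ennreal \<kappa> * ball_angular (\<lambda>_::'a. 1)"
    and \<kappa>: "\<kappa> \<ge> 0"
  shows "ball_moment k = ennreal \<kappa> * ball_moment (\<lambda>_::'a. 1)"
proof -
  define C where "C = (\<integral>\<^sup>+s. indicator {0<..<1} s * ennreal (sqrt s ^ DIM('a)) \<partial>lborel)"
  let ?I = "ball_angular (\<lambda>_::'a. 1)"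
  have fin: "?I < \<top>"
    using emeasure_lborel_ball_finite[of "0::'a" 1] by (simp add: ball_angular_def)
  have A: "C * ball_angular k + ball_moment k = ball_angular k"
    using ball_angular_split[OF k] ball_complement_moment[OF k] by (simp add: C_def)
  have B: "C * ?I + ball_moment (\<lambda>_::'a. 1) = ?I"
    using ball_angular_split[of "\<lambda>_::'a. 1"] ball_complement_moment[of "\<lambda>_::'a. 1"] by (simp add: C_def)
  have "C * ball_angular k + ennreal \<kappa> * ball_moment (\<lambda>_::'a. 1) = ennreal \<kappa> * (C * ?I + ball_moment (\<lambda>_::'a. 1))"
    unfolding I by (simp add: distrib_left mult_ac)
  also have "\<dots> = ball_angular k" by (simp only: B I)
  also have "\<dots> = C * ball_angular k + ball_moment k" by (rule A[symmetric])
  finally have "C * ball_angular k + ennreal \<kappa> * ball_moment (\<lambda>_::'a. 1) = C * ball_angular k + ball_moment k" .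
  moreover have "C * ball_angular k < \<top>"
  proof -
    have "C * ball_angular k \<le> ball_angular k" using A by (metis le_iff_add)
    also have "\<dots> < \<top>" unfolding I using fin by (simp add: ennreal_mult_less_top)
    finally show ?thesis .
  qed
  ultimately show ?thesis by (auto simp: ennreal_add_left_cancel)
qed

lemma nn_integral_ball_law:
  fixes g :: "'a::euclidean_space \<Rightarrow> ennreal"
  assumes [measurable]: "g \<in> borel_measurable borel"
  shows "(\<integral>\<^sup>+u. indicator (ball 0 1) u * g u \<partial>lborel) = ball_angular (\<lambda>_::'a. 1) * (\<integral>\<^sup>+u. g u \<partial>ball_law)"
proof -
  let ?v = "ennreal (measure lborel (cball (0::'a) 1))"
  have *: "(\<integral>\<^sup>+u. h u * indicator (cball 0 1) u \<partial>lborel) = (\<integral>\<^sup>+u. indicator (ball 0 1) u * h u \<partial>lborel)"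
    for h :: "'a \<Rightarrow> ennreal"
  proof (rule nn_integral_cong_AE)
    show "AE u in lborel. h u * indicator (cball 0 1) u = indicator (ball 0 1) u * h u"
      using AE_lborel_norm_neq[of 1] by eventually_elim (auto simp: indicator_def)
  qed
  have v: "ball_angular (\<lambda>_::'a. 1) = ?v"
    using *[of "\<lambda>_. 1"] by (simp add: ball_angular_def emeasure_unit_ball)
  have "(\<integral>\<^sup>+u. g u \<partial>ball_law) = (\<integral>\<^sup>+u. indicator (ball 0 1) u * g u \<partial>lborel) / ?v"
    by (subst nn_integral_uniform_measure) (auto simp: * emeasure_unit_ball)
  then show ?thesis
    unfolding v using content_unit_ball_pos[where 'a='a]
    by (simp add: ennreal_mult_divide_eq ennreal_times_divide mult.commute[of ?v])
qed

lemma nn_integral_uniform_sphere: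
  fixes k :: "'a::euclidean_space \<Rightarrow> ennreal"
  assumes [measurable]: "k \<in> borel_measurable borel"
  shows "ball_angular k = (\<integral>\<^sup>+w. k w \<partial>uniform_sphere) * ball_angular (\<lambda>_::'a. 1)"
proof -
  have "(\<integral>\<^sup>+w. k w \<partial>uniform_sphere) = (\<integral>\<^sup>+u. k (sgn u) \<partial>ball_law)"
    unfolding uniform_sphere_def by (rule nn_integral_distr) auto
  then show ?thesis
    using nn_integral_ball_law[of "\<lambda>u. k (sgn u)"] by (simp add: ball_angular_def mult.commute)
qed

text \<open>The divergence theorem for the linear function \<open>a \<bullet> u\<close>, whose
  derivative in direction \<open>a\<close> is constant. This is the source of the factor
  \<open>1 / DIM('a)\<close>.\<close>

lemma ball_angular_inner_square:
  fixes a :: "'a::euclidean_space"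
  shows "ball_angular (\<lambda>w. ennreal ((a \<bullet> w)\<^sup>2)) = ennreal ((norm a)\<^sup>2 / real DIM('a)) * ball_angular (\<lambda>_::'a. 1)"
proof -
  interpret l: lipschitz_convex "\<lambda>u. a \<bullet> u" "norm a"
  proof
    show "convex_on UNIV (\<lambda>u. a \<bullet> u)" by (simp add: convex_on_def inner_simps)
    show "\<bar>a \<bullet> x - a \<bullet> y\<bar> \<le> norm a * norm (x - y)" for x y
      using Cauchy_Schwarz_ineq2[of a "x - y"] by (simp add: inner_diff_right)
  qed
  have "dir_deriv (\<lambda>u. a \<bullet> u) a u = a \<bullet> a" for u
    by (rule l.dir_deriv_eq_inner) (auto simp: gderiv_def inner_commute intro!: derivative_eq_intros)
  then have eq: "(\<integral>u. indicator (ball (0::'a) 1) u * (a \<bullet> a) \<partial>lborel)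
      = real DIM('a) * (\<integral>u. indicator (ball 0 1) u * (a \<bullet> sgn u)\<^sup>2 \<partial>lborel)"
    using l.ball_integral_dir_deriv[of a] by (simp add: inner_commute[of "sgn _" a] power2_eq_square)
  have bound: "(a \<bullet> sgn u)\<^sup>2 \<le> (norm a)\<^sup>2" for u
  proof -
    have "\<bar>a \<bullet> sgn u\<bar> \<le> norm a * 1"
      using Cauchy_Schwarz_ineq2[of a "sgn u"] by (cases "u = 0") (auto simp: norm_sgn)
    then show ?thesis using abs_le_square_iff[of "a \<bullet> sgn u" "norm a"] by simp
  qed
  have int: "integrable lborel (\<lambda>u. indicator (ball 0 1) u * (a \<bullet> sgn u)\<^sup>2)"
    by (rule integrable_lborel_bounded_support[of _ "(norm a)\<^sup>2" 1]) (auto simp: indicator_def bound)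
  have "ball_angular (\<lambda>w. ennreal ((a \<bullet> w)\<^sup>2)) = (\<integral>\<^sup>+u. ennreal (indicator (ball 0 1) u * (a \<bullet> sgn u)\<^sup>2) \<partial>lborel)"
    unfolding ball_angular_def by (intro nn_integral_cong) (auto simp: indicator_def)
  also have "\<dots> = ennreal (\<integral>u. indicator (ball 0 1) u * (a \<bullet> sgn u)\<^sup>2 \<partial>lborel)"
    using int by (intro nn_integral_eq_integral) auto
  also have "(\<integral>u. indicator (ball 0 1) u * (a \<bullet> sgn u)\<^sup>2 \<partial>lborel)
      = (norm a)\<^sup>2 / real DIM('a) * measure lborel (ball (0::'a) 1)"
    using eq by (simp add: dot_square_norm field_simps)
  also have "ennreal \<dots> = ennreal ((norm a)\<^sup>2 / real DIM('a)) * ball_angular (\<lambda>_::'a. 1)"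
    using emeasure_lborel_ball_finite[of "0::'a" 1]
    by (subst ennreal_mult) (auto simp: ball_angular_def emeasure_eq_ennreal_measure)
  finally show ?thesis .
qed

section \<open>Mollification\<close>

text \<open>An unnormalised mollifier. It is even, has compact support, and squaring the positive
  part makes it smooth enough for an explicit second-order remainder.\<close>

definition bump :: "real \<Rightarrow> 'a::euclidean_space \<Rightarrow> real" where
  "bump \<sigma> z = (max 0 (\<sigma>\<^sup>2 - (norm z)\<^sup>2))\<^sup>2"

text \<open>The gradient of \<open>bump \<sigma>\<close>; the 4 comes from differentiating two
  nested squares.\<close>

definition bump_slope :: "real \<Rightarrow> 'a::euclidean_space \<Rightarrow> 'a" where
  "bump_slope \<sigma> z = (- 4 * max 0 (\<sigma>\<^sup>2 - (norm z)\<^sup>2)) *\<^sub>R z"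

lemma borel_measurable_bump [measurable]: "bump \<sigma> \<in> borel_measurable borel"
  unfolding bump_def by measurable

lemma borel_measurable_bump_slope [measurable]: "bump_slope \<sigma> \<in> borel_measurable borel"
  unfolding bump_slope_def by measurable

lemma bump_nonneg: "bump \<sigma> z \<ge> 0" by (simp add: bump_def)

lemma bump_minus [simp]: "bump \<sigma> (- z) = bump \<sigma> z" by (simp add: bump_def)

lemma bump_eq_0: "\<sigma> \<ge> 0 \<Longrightarrow> norm z \<ge> \<sigma> \<Longrightarrow> bump \<sigma> z = 0"
  and bump_slope_eq_0: "\<sigma> \<ge> 0 \<Longrightarrow> norm z \<ge> \<sigma> \<Longrightarrow> bump_slope \<sigma> z = 0"
  by (simp_all add: bump_def bump_slope_def max_absorb1 power_mono)

lemma bump_le: "bump \<sigma> z \<le> (\<sigma>\<^sup>2)\<^sup>2"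
  unfolding bump_def by (intro power_mono) auto

text \<open>The squared positive part is convex with a 2-Lipschitz derivative, which gives both
  bounds on the first-order remainder.\<close>

lemma max_square_taylor:
  fixes s t c :: real
  shows "0 \<le> (max 0 (c - (s + t)))\<^sup>2 - (max 0 (c - s))\<^sup>2 + 2 * max 0 (c - s) * t"
    and "(max 0 (c - (s + t)))\<^sup>2 - (max 0 (c - s))\<^sup>2 + 2 * max 0 (c - s) * t \<le> t\<^sup>2"
proof -
  define a where "a = c - s"
  have *: "c - (s + t) = a - t" "c - s = a" by (auto simp: a_def)
  have sq: "0 \<le> (a - t)\<^sup>2" "(a - t)\<^sup>2 = a\<^sup>2 - 2 * a * t + t\<^sup>2" by (rule zero_le_power2) (simp add: power2_diff)
  show "0 \<le> (max 0 (c - (s + t)))\<^sup>2 - (max 0 (c - s))\<^sup>2 + 2 * max 0 (c - s) * t"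
  proof (cases "a \<ge> 0 \<and> a - t < 0")
    case True
    then have "a * a \<le> a * t" "0 \<le> a * t" by (auto intro: mult_left_mono)
    then have "a * a \<le> 2 * (a * t)" by linarith
    then show ?thesis using True unfolding * by (simp add: power2_eq_square mult.assoc)
  qed (use sq in \<open>auto simp: * max_def\<close>)
  show "(max 0 (c - (s + t)))\<^sup>2 - (max 0 (c - s))\<^sup>2 + 2 * max 0 (c - s) * t \<le> t\<^sup>2"
  proof (cases "a < 0 \<and> a - t \<ge> 0")
    case True
    then have "(a - t)\<^sup>2 \<le> (- t)\<^sup>2" by (intro power_mono) auto
    then show ?thesis using True unfolding * by simp
  qed (use sq in \<open>auto simp: * max_def\<close>)
qed

text \<open>A remainder uniform in \<open>z\<close> allows differentiation of the convolution. In
  the constant, \<open>(2 * \<sigma> + 3)\<^sup>2\<close> controls the squared increment of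
  \<open>(norm z)\<^sup>2\<close>, and \<open>2 * \<sigma>\<^sup>2\<close> the quadratic part of
  that increment multiplied by the slope.\<close>

lemma bump_taylor:
  assumes "\<sigma> > 0" and v: "norm v \<le> 1"
  shows "\<bar>bump \<sigma> (z + v) - bump \<sigma> z - v \<bullet> bump_slope \<sigma> z\<bar> \<le> (2 * \<sigma>\<^sup>2 + (2 * \<sigma> + 3)\<^sup>2) * (norm v)\<^sup>2"
proof (cases "norm z \<le> \<sigma> + 1")
  case False
  then have "norm (z + v) \<ge> \<sigma>" using v norm_diff_ineq[of z v] by linarith
  then show ?thesis using False assms(1) by (simp add: bump_eq_0 bump_slope_eq_0)
next
  case True
  define s t m where "s = (norm z)\<^sup>2" and "t = 2 * (z \<bullet> v) + (norm v)\<^sup>2" and "m = max 0 (\<sigma>\<^sup>2 - s)"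
  have st: "(norm (z + v))\<^sup>2 = s + t"
    unfolding s_def t_def power2_norm_eq_inner by (simp add: inner_simps inner_commute)
  define r where "r = (max 0 (\<sigma>\<^sup>2 - (s + t)))\<^sup>2 - m\<^sup>2 + 2 * m * t"
  have r: "0 \<le> r" "r \<le> t\<^sup>2" unfolding r_def m_def by (rule max_square_taylor)+
  have m: "0 \<le> m" "m \<le> \<sigma>\<^sup>2" by (auto simp: m_def s_def)
  have "bump \<sigma> (z + v) - bump \<sigma> z - v \<bullet> bump_slope \<sigma> z = r - 2 * m * (norm v)\<^sup>2"
    unfolding bump_def bump_slope_def st by (simp add: r_def m_def s_def t_def inner_commute algebra_simps)
  moreover have "t\<^sup>2 \<le> (2 * \<sigma> + 3)\<^sup>2 * (norm v)\<^sup>2"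
  proof -
    have "\<bar>t\<bar> \<le> 2 * (norm z * norm v) + norm v * norm v"
      unfolding t_def power2_eq_square
      using Cauchy_Schwarz_ineq2[of z v] mult_nonneg_nonneg[OF norm_ge_zero norm_ge_zero, of v v] by linarith
    also have "\<dots> = (2 * norm z + norm v) * norm v" by (simp add: algebra_simps)
    also have "\<dots> \<le> (2 * \<sigma> + 3) * norm v" using True v by (intro mult_right_mono) auto
    finally have "\<bar>t\<bar>\<^sup>2 \<le> ((2 * \<sigma> + 3) * norm v)\<^sup>2" by (intro power_mono) auto
    then show ?thesis by (simp add: power_mult_distrib)
  qed
  moreover have "m * (norm v)\<^sup>2 \<le> \<sigma>\<^sup>2 * (norm v)\<^sup>2" "0 \<le> m * (norm v)\<^sup>2"
    using m by (auto intro: mult_right_mono)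
  ultimately show ?thesis using r by (simp add: algebra_simps abs_le_iff)
qed

lemma integrable_bump:
  assumes "\<sigma> > 0" shows "integrable lborel (bump \<sigma> :: 'a::euclidean_space \<Rightarrow> real)"
proof (rule integrable_lborel_bounded_support)
  show "\<bar>bump \<sigma> z\<bar> \<le> (\<sigma>\<^sup>2)\<^sup>2" for z :: 'a using bump_le[of \<sigma> z] bump_nonneg[of \<sigma> z] by linarith
  show "norm z > \<sigma> \<Longrightarrow> bump \<sigma> z = 0" for z :: 'a using assms by (intro bump_eq_0) auto
qed measurable

lemma integral_bump_pos:
  assumes "\<sigma> > 0" shows "0 < integral\<^sup>L lborel (bump \<sigma> :: 'a::euclidean_space \<Rightarrow> real)"
proof -
  note int = integrable_bump[OF assms, where 'a='a]
  have "integral\<^sup>L lborel (bump \<sigma> :: 'a \<Rightarrow> real) \<noteq> 0"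
  proof
    assume "integral\<^sup>L lborel (bump \<sigma> :: 'a \<Rightarrow> real) = 0"
    then have "AE z::'a in lborel. bump \<sigma> z = 0"
      using int bump_nonneg by (subst (asm) integral_nonneg_eq_0_iff_AE) auto
    then have "AE u::'a in ball_law. bump \<sigma> (0 + \<sigma> *\<^sub>R u) = 0"
      using assms by (intro AE_ball_law_affine[where P="\<lambda>z. bump \<sigma> z = 0"]) auto
    moreover have "AE u::'a in ball_law. norm u < 1"
      using AE_lborel_norm_neq[of 1] by (intro AE_uniform_measureI) (auto elim!: eventually_mono)
    ultimately have "AE u::'a in ball_law. False"
    proof eventually_elim
      case (elim u)
      have "\<sigma>\<^sup>2 * (norm u)\<^sup>2 < \<sigma>\<^sup>2 * 1"
        using elim assms by (intro mult_strict_left_mono) (auto simp: power_less_one_iff abs_square_less_1)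
      then show ?case using elim assms by (simp add: bump_def power_mult_distrib max_def split: if_splits)
    qed
    then show False using prob_space.AE_False[OF prob_space_ball_law] by blast
  qed
  moreover have "integral\<^sup>L lborel (bump \<sigma> :: 'a \<Rightarrow> real) \<ge> 0" by (simp add: bump_nonneg)
  ultimately show ?thesis by linarith
qed

text \<open>Convolution with a probability density keeps the Lipschitz constant, an even density
  keeps oddness, and the derivative falls on the smooth bump.\<close>

lemma mollification:
  fixes \<phi> :: "'a::euclidean_space \<Rightarrow> real"
  assumes lip: "\<And>x y. \<bar>\<phi> x - \<phi> y\<bar> \<le> M * norm (x - y)" and odd: "\<And>x. \<phi> (- x) = - \<phi> x" and \<sigma>: "\<sigma> > 0"
  obtains \<psi> g where "\<And>x. GDERIV \<psi> x :> g x" "\<And>x y. \<bar>\<psi> x - \<psi> y\<bar> \<le> M * norm (x - y)"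
    "\<And>x. \<psi> (- x) = - \<psi> x" "\<And>x. \<bar>\<psi> x - \<phi> x\<bar> \<le> M * \<sigma>"
proof -
  have M: "M \<ge> 0"
  proof -
    obtain b :: 'a where "b \<in> Basis" by (meson nonempty_Basis ex_in_conv)
    then show ?thesis using lip[of b 0] by simp
  qed
  have "M-lipschitz_on UNIV \<phi>"
    using lip M by (auto simp: lipschitz_on_def dist_norm dist_real_def)
  then have [measurable]: "\<phi> \<in> borel_measurable borel"
    by (intro borel_measurable_continuous_onI lipschitz_on_continuous_on)
  have \<phi>0: "\<phi> 0 = 0" using odd[of 0] by simp
  have \<phi>_le: "\<bar>\<phi> x\<bar> \<le> M * norm x" for x using lip[of x 0] by (simp add: \<phi>0)
  define c where "c = integral\<^sup>L lborel (bump \<sigma> :: 'a \<Rightarrow> real)"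
  have c: "c > 0" unfolding c_def by (rule integral_bump_pos[OF \<sigma>])
  define \<psi> where "\<psi> x = (\<integral>z. \<phi> (x - z) * bump \<sigma> z \<partial>lborel) / c" for x
  note int_bump = integrable_bump[OF \<sigma>, where 'a='a]
  have int: "integrable lborel (\<lambda>z. \<phi> (x - z) * bump \<sigma> z)" for x
  proof (rule integrable_lborel_bounded_support)
    show "\<bar>\<phi> (x - z) * bump \<sigma> z\<bar> \<le> M * (norm x + \<sigma>) * (\<sigma>\<^sup>2)\<^sup>2" for z
    proof (cases "norm z \<le> \<sigma>")
      case True
      have "M * norm (x - z) \<le> M * (norm x + \<sigma>)"
        using M True norm_triangle_ineq4[of x z] by (intro mult_left_mono) auto
      then have "\<bar>\<phi> (x - z)\<bar> \<le> M * (norm x + \<sigma>)" using \<phi>_le[of "x - z"] by linarith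
      then show ?thesis
        unfolding abs_mult using bump_le[of \<sigma> z] bump_nonneg[of \<sigma> z] M \<sigma>
        by (intro mult_mono) auto
    qed (use M \<sigma> in \<open>simp add: bump_eq_0\<close>)
    show "norm z > \<sigma> \<Longrightarrow> \<phi> (x - z) * bump \<sigma> z = 0" for z
      using \<sigma> by (simp add: bump_eq_0)
  qed measurable
  have lip': "\<bar>\<psi> x - \<psi> y\<bar> \<le> M * norm (x - y)" for x y
  proof -
    have "\<bar>(\<integral>z. \<phi> (x - z) * bump \<sigma> z \<partial>lborel) - (\<integral>z. \<phi> (y - z) * bump \<sigma> z \<partial>lborel)\<bar>
        = \<bar>\<integral>z. \<phi> (x - z) * bump \<sigma> z - \<phi> (y - z) * bump \<sigma> z \<partial>lborel\<bar>"
      by (simp only: Bochner_Integration.integral_diff[OF int int])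
    also have "\<dots> \<le> (\<integral>z. \<bar>\<phi> (x - z) * bump \<sigma> z - \<phi> (y - z) * bump \<sigma> z\<bar> \<partial>lborel)"
      by (rule integral_abs_bound)
    also have "\<dots> \<le> (\<integral>z. M * norm (x - y) * bump \<sigma> (z::'a) \<partial>lborel)"
    proof (rule integral_mono)
      show "integrable lborel (\<lambda>z. \<bar>\<phi> (x - z) * bump \<sigma> z - \<phi> (y - z) * bump \<sigma> z\<bar>)"
        by (intro integrable_abs Bochner_Integration.integrable_diff int)
      show "integrable lborel (\<lambda>z::'a. M * norm (x - y) * bump \<sigma> z)"
        by (intro integrable_mult_right int_bump)
      fix z :: 'a
      have "\<bar>\<phi> (x - z) - \<phi> (y - z)\<bar> * bump \<sigma> z \<le> M * norm (x - y) * bump \<sigma> z"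
        using lip[of "x - z" "y - z"] bump_nonneg by (intro mult_right_mono) auto
      then show "\<bar>\<phi> (x - z) * bump \<sigma> z - \<phi> (y - z) * bump \<sigma> z\<bar> \<le> M * norm (x - y) * bump \<sigma> z"
        using bump_nonneg[of \<sigma> z] by (simp add: abs_mult flip: left_diff_distrib)
    qed
    also have "\<dots> = M * norm (x - y) * c" by (simp add: c_def)
    finally show ?thesis using c by (simp add: \<psi>_def divide_le_eq abs_divide flip: diff_divide_distrib)
  qed
  have close: "\<bar>\<psi> x - \<phi> x\<bar> \<le> M * \<sigma>" for x
  proof -
    have "(\<integral>z. \<phi> (x - z) * bump \<sigma> z \<partial>lborel) - \<phi> x * c
        = (\<integral>z. \<phi> (x - z) * bump \<sigma> z - \<phi> x * bump \<sigma> z \<partial>lborel)"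
      unfolding c_def using int int_bump by simp
    also have "\<bar>\<dots>\<bar> \<le> (\<integral>z. \<bar>\<phi> (x - z) * bump \<sigma> z - \<phi> x * bump \<sigma> z\<bar> \<partial>lborel)"
      by (rule integral_abs_bound)
    also have "\<dots> \<le> (\<integral>z. M * \<sigma> * bump \<sigma> (z::'a) \<partial>lborel)"
    proof (rule integral_mono)
      show "integrable lborel (\<lambda>z. \<bar>\<phi> (x - z) * bump \<sigma> z - \<phi> x * bump \<sigma> z\<bar>)"
        by (intro integrable_abs Bochner_Integration.integrable_diff int integrable_mult_right int_bump)
      show "integrable lborel (\<lambda>z::'a. M * \<sigma> * bump \<sigma> z)"
        by (intro integrable_mult_right int_bump)
      fix z :: 'a
      have "\<bar>\<phi> (x - z) - \<phi> x\<bar> * bump \<sigma> z \<le> M * \<sigma> * bump \<sigma> z"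
      proof (cases "norm z \<le> \<sigma>")
        case True
        have "M * norm (x - z - x) \<le> M * \<sigma>" using M True by (intro mult_left_mono) auto
        then show ?thesis
          using lip[of "x - z" x] bump_nonneg by (intro mult_right_mono) auto
      qed (use \<sigma> in \<open>simp add: bump_eq_0\<close>)
      then show "\<bar>\<phi> (x - z) * bump \<sigma> z - \<phi> x * bump \<sigma> z\<bar> \<le> M * \<sigma> * bump \<sigma> z"
        using bump_nonneg[of \<sigma> z] by (simp add: abs_mult flip: left_diff_distrib)
    qed
    also have "\<dots> = M * \<sigma> * c" by (simp add: c_def)
    finally have "\<bar>(\<integral>z. \<phi> (x - z) * bump \<sigma> z \<partial>lborel) - \<phi> x * c\<bar> \<le> M * \<sigma> * c" .
    moreover have "\<psi> x - \<phi> x = ((\<integral>z. \<phi> (x - z) * bump \<sigma> z \<partial>lborel) - \<phi> x * c) / c"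
      using c by (simp add: \<psi>_def diff_divide_distrib)
    ultimately show ?thesis using c by (simp add: divide_le_eq abs_divide)
  qed
  have odd': "\<psi> (- x) = - \<psi> x" for x
  proof -
    have "(\<integral>z. \<phi> (- x - z) * bump \<sigma> z \<partial>lborel) = (\<integral>z. \<phi> (- x - (-1) *\<^sub>R z) * bump \<sigma> ((-1) *\<^sub>R z) \<partial>lborel)"
      using lborel_integral_scale[of "\<lambda>z. \<phi> (- x - z) * bump \<sigma> z" "-1"] by simp
    also have "\<dots> = (\<integral>z. - (\<phi> (x - z) * bump \<sigma> z) \<partial>lborel)"
    proof (rule Bochner_Integration.integral_cong)
      fix z :: 'a
      show "\<phi> (- x - (-1) *\<^sub>R z) * bump \<sigma> ((-1) *\<^sub>R z) = - (\<phi> (x - z) * bump \<sigma> z)"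
        using odd[of "x - z"] by simp
    qed simp
    finally show ?thesis by (simp add: \<psi>_def)
  qed
  \<comment> \<open>The change of variables moves \<open>x\<close> from \<open>\<phi>\<close> into
    the bump, the factor that can be differentiated.\<close>
  have conv: "\<psi> x = (\<integral>u. \<phi> u * bump \<sigma> (x - u) \<partial>lborel) / c" for x
  proof -
    have "(\<integral>u. \<phi> u * bump \<sigma> (x - u) \<partial>lborel) = (\<integral>u. \<phi> (x + u) * bump \<sigma> (x - (x + u)) \<partial>lborel)"
      by (rule lborel_integral_shift[of "\<lambda>u. \<phi> u * bump \<sigma> (x - u)" x, symmetric]) measurable
    also have "\<dots> = (\<integral>u. \<phi> (x + (-1) *\<^sub>R u) * bump \<sigma> (x - (x + (-1) *\<^sub>R u)) \<partial>lborel)"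
      using lborel_integral_scale[of "\<lambda>u. \<phi> (x + u) * bump \<sigma> (x - (x + u))" "-1"] by simp
    finally show ?thesis by (simp add: \<psi>_def)
  qed
  have int2: "integrable lborel (\<lambda>u. \<phi> u * bump \<sigma> (x - u))" for x
  proof (rule integrable_lborel_bounded_support)
    have supp: "bump \<sigma> (x - u) = 0" if "norm u > norm x + \<sigma>" for u
      using that \<sigma> norm_triangle_ineq2[of u x] by (intro bump_eq_0) (auto simp: norm_minus_commute)
    then show "norm u > norm x + \<sigma> \<Longrightarrow> \<phi> u * bump \<sigma> (x - u) = 0" for u by simp
    show "\<bar>\<phi> u * bump \<sigma> (x - u)\<bar> \<le> M * (norm x + \<sigma>) * (\<sigma>\<^sup>2)\<^sup>2" for u
    proof (cases "norm u \<le> norm x + \<sigma>")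
      case True
      then have "\<bar>\<phi> u\<bar> \<le> M * (norm x + \<sigma>)"
        using \<phi>_le[of u] mult_left_mono[OF True M] by linarith
      then show ?thesis
        unfolding abs_mult using bump_le[of \<sigma> "x - u"] bump_nonneg[of \<sigma> "x - u"] M \<sigma>
        by (intro mult_mono) auto
    qed (use M \<sigma> supp in auto)
  qed measurable
  define g where "g x = (1 / c) *\<^sub>R (\<integral>u. \<phi> u *\<^sub>R bump_slope \<sigma> (x - u) \<partial>lborel)" for x
  have int3: "integrable lborel (\<lambda>u. \<phi> u *\<^sub>R bump_slope \<sigma> (x - u))" for x
  proof (rule Bochner_Integration.integrable_bound)
    show "integrable lborel (\<lambda>u::'a. M * (norm x + \<sigma>) * (4 * \<sigma>\<^sup>2 * \<sigma>) * indicator (cball 0 (norm x + \<sigma>)) u)"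
      using emeasure_lborel_cball_finite[of "0::'a" "norm x + \<sigma>"]
      by (intro integrable_mult_right integrable_real_indicator) auto
    have le: "norm (\<phi> u *\<^sub>R bump_slope \<sigma> (x - u)) \<le>
        M * (norm x + \<sigma>) * (4 * \<sigma>\<^sup>2 * \<sigma>) * indicator (cball 0 (norm x + \<sigma>)) u" for u
    proof (cases "norm (x - u) \<le> \<sigma>")
      case True
      then have u: "norm u \<le> norm x + \<sigma>"
        using norm_triangle_ineq2[of u x] by (simp add: norm_minus_commute)
      then have "\<bar>\<phi> u\<bar> \<le> M * (norm x + \<sigma>)"
        using \<phi>_le[of u] mult_left_mono[OF u M] by linarith
      moreover have "norm (bump_slope \<sigma> (x - u)) \<le> 4 * \<sigma>\<^sup>2 * \<sigma>"
        unfolding bump_slope_def norm_scaleR using True \<sigma> by (intro mult_mono) (auto simp: abs_mult)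
      ultimately have "\<bar>\<phi> u\<bar> * norm (bump_slope \<sigma> (x - u)) \<le> M * (norm x + \<sigma>) * (4 * \<sigma>\<^sup>2 * \<sigma>)"
        using M \<sigma> by (intro mult_mono) auto
      then show ?thesis using u by simp
    qed (use M \<sigma> in \<open>simp add: bump_slope_eq_0\<close>)
    show "AE u in lborel. norm (\<phi> u *\<^sub>R bump_slope \<sigma> (x - u)) \<le>
        norm (M * (norm x + \<sigma>) * (4 * \<sigma>\<^sup>2 * \<sigma>) * indicator (cball 0 (norm x + \<sigma>)) u)"
      by (intro AE_I2 order_trans[OF le]) (simp only: real_norm_def abs_ge_self)
  qed measurable
  have "GDERIV \<psi> x :> g x" for x
  proof -
    \<comment> \<open>The extra 1 covers the supports of the bumps around both \<open>x\<close> and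
      \<open>x + v\<close> whenever \<open>norm v \<le> 1\<close>.\<close>
    define r where "r = norm x + \<sigma> + 1"
    define C where "C = M * r * (2 * \<sigma>\<^sup>2 + (2 * \<sigma> + 3)\<^sup>2)"
    define V where "V = (\<integral>u. indicator (cball (0::'a) r) u \<partial>lborel) / c"
    have r: "r > 0" using \<sigma> by (simp add: r_def add_nonneg_pos add_pos_nonneg)
    have C: "C \<ge> 0" using M r by (simp add: C_def)
    have V: "V \<ge> 0" using c by (simp add: V_def)
    have err: "\<bar>\<psi> (x + v) - \<psi> x - v \<bullet> g x\<bar> \<le> C * V * (norm v)\<^sup>2" if v: "norm v \<le> 1" for v
    proof -
      let ?e = "\<lambda>u. \<phi> u * bump \<sigma> (x + v - u) - \<phi> u * bump \<sigma> (x - u) - v \<bullet> (\<phi> u *\<^sub>R bump_slope \<sigma> (x - u))"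
      have inte: "integrable lborel ?e"
        by (intro Bochner_Integration.integrable_diff int2 integrable_inner_right int3)
      have eq: "\<psi> (x + v) - \<psi> x - v \<bullet> g x = (\<integral>u. ?e u \<partial>lborel) / c"
      proof -
        have "(\<integral>u. ?e u \<partial>lborel) = (\<integral>u. \<phi> u * bump \<sigma> (x + v - u) - \<phi> u * bump \<sigma> (x - u) \<partial>lborel)
            - (\<integral>u. v \<bullet> (\<phi> u *\<^sub>R bump_slope \<sigma> (x - u)) \<partial>lborel)"
          by (intro Bochner_Integration.integral_diff Bochner_Integration.integrable_diff int2
              integrable_inner_right int3)
        also have "(\<integral>u. \<phi> u * bump \<sigma> (x + v - u) - \<phi> u * bump \<sigma> (x - u) \<partial>lborel)
            = c * \<psi> (x + v) - c * \<psi> x"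
          using c by (subst Bochner_Integration.integral_diff[OF int2 int2]) (simp add: conv)
        also have "(\<integral>u. v \<bullet> (\<phi> u *\<^sub>R bump_slope \<sigma> (x - u)) \<partial>lborel) = c * (v \<bullet> g x)"
          using c by (subst integral_inner_right[OF int3]) (simp add: g_def)
        finally show ?thesis using c by (simp add: field_simps)
      qed
      have pt: "\<bar>?e u\<bar> \<le> C * (norm v)\<^sup>2 * indicator (cball (0::'a) r) u" for u
      proof (cases "norm u \<le> r")
        case True
        have "?e u = \<phi> u * (bump \<sigma> (x - u + v) - bump \<sigma> (x - u) - v \<bullet> bump_slope \<sigma> (x - u))"
          by (simp add: algebra_simps)
        also have "\<bar>\<dots>\<bar> \<le> M * r * ((2 * \<sigma>\<^sup>2 + (2 * \<sigma> + 3)\<^sup>2) * (norm v)\<^sup>2)"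
          unfolding abs_mult
          using order_trans[OF \<phi>_le[of u] mult_left_mono[OF True M]] M r bump_taylor[OF \<sigma> v, of "x - u"]
          by (intro mult_mono) auto
        finally show ?thesis using True by (simp add: C_def mult_ac)
      next
        case False
        have "norm u - norm x - norm v \<le> norm (x + v - u)" "norm u - norm x \<le> norm (x - u)"
          using norm_triangle_ineq2[of u "x + v"] norm_triangle_ineq2[of u x] norm_triangle_ineq[of x v]
          by (auto simp: norm_minus_commute)
        then have "\<sigma> \<le> norm (x + v - u)" "\<sigma> \<le> norm (x - u)" using False v by (auto simp: r_def)
        then show ?thesis using False \<sigma> by (simp add: bump_eq_0 bump_slope_eq_0)
      qed
      have "\<bar>\<integral>u. ?e u \<partial>lborel\<bar> \<le> (\<integral>u. \<bar>?e u\<bar> \<partial>lborel)" by (rule integral_abs_bound)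
      also have "\<dots> \<le> (\<integral>u. C * (norm v)\<^sup>2 * indicator (cball (0::'a) r) u \<partial>lborel)"
        using emeasure_lborel_cball_finite[of "0::'a" r]
        by (intro integral_mono integrable_abs inte integrable_mult_right integrable_real_indicator pt) auto
      also have "\<dots> = C * (norm v)\<^sup>2 * (V * c)" using c by (simp add: V_def)
      finally show ?thesis using c unfolding eq by (simp add: abs_divide divide_le_eq mult_ac)
    qed
    show ?thesis
      unfolding gderiv_def has_derivative_at_alt
    proof (intro conjI allI impI)
      show "bounded_linear (\<lambda>h. h \<bullet> g x)" by (rule bounded_linear_inner_left)
      fix e :: real assume e: "e > 0"
      define d where "d = min 1 (e / (C * V + 1))"
      have CV: "C * V + 1 > 0" using C V by (simp add: add_nonneg_pos)
      then have "d > 0" using e by (simp add: d_def)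
      moreover have "norm (\<psi> y - \<psi> x - (y - x) \<bullet> g x) \<le> e * norm (y - x)" if y: "norm (y - x) < d" for y
      proof -
        have "norm (y - x) \<le> e / (C * V + 1)" using y by (simp add: d_def)
        then have "(C * V + 1) * norm (y - x) \<le> e" using CV by (simp add: le_divide_eq mult.commute)
        then have "C * V * norm (y - x) \<le> e"
          unfolding distrib_right using norm_ge_zero[of "y - x"] by linarith
        then have "C * V * norm (y - x) * norm (y - x) \<le> e * norm (y - x)" by (intro mult_right_mono) auto
        moreover have "norm (y - x) \<le> 1" using y by (simp add: d_def)
        ultimately show ?thesis using err[of "y - x"] by (simp add: power2_eq_square mult.assoc)
      qed
      ultimately show "\<exists>d>0. \<forall>y. norm (y - x) < d \<longrightarrow> norm (\<psi> y - \<psi> x - (y - x) \<bullet> g x) \<le> e * norm (y - x)"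
        by blast
    qed
  qed
  then show thesis using that lip' odd' close by blast
qed

section \<open>A Poincare inequality for odd functions on the sphere\<close>

abbreviation ind_ball :: "'a::euclidean_space \<times> 'a \<Rightarrow> ennreal" where
  "ind_ball \<equiv> indicator (ball 0 1)"

lemma cos_minus_one_le: "\<bar>cos t - 1\<bar> \<le> \<bar>t\<bar>" for t :: real
proof -
  have "\<bar>cos t - 1\<bar> = 2 * (\<bar>sin (t / 2)\<bar> * \<bar>sin (t / 2)\<bar>)"
    using cos_double_sin[of "t / 2"] by (simp add: power2_eq_square abs_mult)
  also have "\<dots> \<le> 2 * (\<bar>t / 2\<bar> * 1)"
    by (intro mult_left_mono mult_mono abs_sin_x_le_abs_x) auto
  finally show ?thesis by simp
qed

lemma measurable_rotated [measurable]:
  fixes \<phi> :: "'a::euclidean_space \<Rightarrow> real"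
  assumes "\<phi> \<in> borel_measurable borel"
  shows "(\<lambda>p. \<phi> (c *\<^sub>R fst p + s *\<^sub>R snd p)) \<in> borel_measurable borel"
  by (rule measurable_compose[OF _ assms]) (intro borel_measurable_continuous_onI continuous_intros)

lemma measurable_fst_borel [measurable]:
  fixes \<phi> :: "'a::euclidean_space \<Rightarrow> real"
  assumes "\<phi> \<in> borel_measurable borel"
  shows "(\<lambda>p :: 'a \<times> 'a. \<phi> (fst p)) \<in> borel_measurable borel"
  using measurable_rotated[OF assms, of 1 0] by simp

context
  fixes \<phi> :: "'a::euclidean_space \<Rightarrow> real"
  assumes \<phi> [measurable]: "\<phi> \<in> borel_measurable borel"
begin

text \<open>The change of \<open>\<phi>\<close> along an arc of the ellipse spanned by the two
  components of \<open>p\<close>. Taking \<open>p\<close> uniform in the ball of the product space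
  makes the law of these arcs rotation invariant.\<close>

definition increment :: "real \<Rightarrow> real \<Rightarrow> 'a \<times> 'a \<Rightarrow> real" where
  "increment \<theta> h p = \<phi> (cos (\<theta> + h) *\<^sub>R fst p + sin (\<theta> + h) *\<^sub>R snd p) - \<phi> (cos \<theta> *\<^sub>R fst p + sin \<theta> *\<^sub>R snd p)"

lemma measurable_increment [measurable]: "increment \<theta> h \<in> borel_measurable borel"
  unfolding increment_def by measurable

text \<open>Rotating the pair \<open>p\<close> by the starting angle preserves both the unit ball
  and Lebesgue measure.\<close>

lemma nn_integral_increment:
  "(\<integral>\<^sup>+p. ind_ball p * ennreal ((increment \<theta> h p)\<^sup>2) \<partial>lborel)
    = (\<integral>\<^sup>+p. ind_ball p * ennreal ((increment 0 h p)\<^sup>2) \<partial>lborel)" if "sin \<theta> \<noteq> 0"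
proof -
  let ?R = "\<lambda>p. (cos \<theta> *\<^sub>R fst p + sin \<theta> *\<^sub>R snd p, (- sin \<theta>) *\<^sub>R fst p + cos \<theta> *\<^sub>R snd p)"
  have ind: "ind_ball (?R p) = ind_ball p" for p :: "'a \<times> 'a"
    using norm_rotation[of "cos \<theta>" "sin \<theta>" "fst p" "snd p"] by (simp add: indicator_def)
  have inc: "increment 0 h (?R p) = increment \<theta> h p" for p
  proof -
    have "cos h *\<^sub>R (cos \<theta> *\<^sub>R fst p + sin \<theta> *\<^sub>R snd p) + sin h *\<^sub>R ((- sin \<theta>) *\<^sub>R fst p + cos \<theta> *\<^sub>R snd p)
        = cos (\<theta> + h) *\<^sub>R fst p + sin (\<theta> + h) *\<^sub>R snd p"
      by (simp add: cos_add sin_add algebra_simps)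
    then show ?thesis by (simp add: increment_def)
  qed
  have "(\<integral>\<^sup>+p. ind_ball p * ennreal ((increment 0 h p)\<^sup>2) \<partial>lborel)
      = (\<integral>\<^sup>+p. ind_ball (?R p) * ennreal ((increment 0 h (?R p))\<^sup>2) \<partial>lborel)"
    by (rule nn_integral_rotation[symmetric]) (use that in auto)
  then show ?thesis by (simp only: ind inc)
qed

text \<open>The half circle from \<open>x\<close> to \<open>- x\<close> in the direction of \<open>y\<close>, cut into \<open>N\<close> arcs.\<close>

lemma odd_le_increments:
  assumes odd: "\<And>x. \<phi> (- x) = - \<phi> x" and N: "N \<ge> 1"
  shows "(\<integral>\<^sup>+p. ind_ball p * ennreal (4 * (\<phi> (fst p))\<^sup>2) \<partial>lborel)
    \<le> (\<integral>\<^sup>+p. ind_ball p * ennreal ((real N * increment 0 (pi / real N) p)\<^sup>2) \<partial>lborel)"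
proof -
  define h where "h = pi / real N"
  have Nh: "real N * h = pi" using N by (simp add: h_def)
  have pt: "4 * (\<phi> (fst p))\<^sup>2 \<le> real N * (\<Sum>k<N. (increment (real k * h) h p)\<^sup>2)" for p
  proof -
    let ?\<gamma> = "\<lambda>k. \<phi> (cos (real k * h) *\<^sub>R fst p + sin (real k * h) *\<^sub>R snd p)"
    have "(\<Sum>k<N. increment (real k * h) h p) = (\<Sum>k<N. ?\<gamma> (Suc k) - ?\<gamma> k)"
      by (intro sum.cong) (simp_all add: increment_def algebra_simps)
    \<comment> \<open>Telescoping over a half turn: the end point is \<open>- fst p\<close>, and
      oddness doubles the value instead of cancelling it.\<close>
    also have "\<dots> = - 2 * \<phi> (fst p)"
      by (subst sum_lessThan_telescope) (simp add: Nh odd)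
    finally have "4 * (\<phi> (fst p))\<^sup>2 = (\<Sum>k<N. increment (real k * h) h p)\<^sup>2"
      by (simp add: power_mult_distrib)
    \<comment> \<open>Cauchy-Schwarz costs a factor \<open>N\<close>. Together with the
      \<open>N\<close> equal summands it makes \<open>N\<^sup>2\<close>, which is the square of the
      factor in the difference quotient.\<close>
    also have "\<dots> \<le> (\<Sum>k<N. (increment (real k * h) h p)\<^sup>2) * real (card {..<N})"
      by (rule sum_squared_le_sum_of_squares)
    finally show ?thesis by (simp add: mult.commute)
  qed
  have eq: "(\<integral>\<^sup>+p. ind_ball p * ennreal ((increment (real k * h) h p)\<^sup>2) \<partial>lborel)
      = (\<integral>\<^sup>+p. ind_ball p * ennreal ((increment 0 h p)\<^sup>2) \<partial>lborel)" if "k < N" for k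
  \<comment> \<open>The shear factorisation needs a nonzero sine. The arc at angle 0 is the
    reference itself, and the later ones start strictly between 0 and \<open>pi\<close>.\<close>
  proof (cases "k = 0")
    case False
    have "h > 0" using N by (simp add: h_def)
    then have "real k * h < real N * h" using that by (intro mult_strict_right_mono) auto
    moreover have "0 < real k * h" using False \<open>h > 0\<close> by simp
    ultimately have "sin (real k * h) > 0" unfolding Nh by (intro sin_gt_zero)
    then show ?thesis by (intro nn_integral_increment) simp
  qed simp
  have "(\<integral>\<^sup>+p. ind_ball p * ennreal (4 * (\<phi> (fst p))\<^sup>2) \<partial>lborel)
      \<le> (\<integral>\<^sup>+p. ennreal (real N) * (\<Sum>k<N. ind_ball p * ennreal ((increment (real k * h) h p)\<^sup>2)) \<partial>lborel)"
  proof (rule nn_integral_mono)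
    fix p :: "'a \<times> 'a"
    have "ind_ball p * ennreal (4 * (\<phi> (fst p))\<^sup>2)
        \<le> ind_ball p * ennreal (real N * (\<Sum>k<N. (increment (real k * h) h p)\<^sup>2))"
      by (intro mult_left_mono ennreal_leI pt) auto
    also have "\<dots> = ennreal (real N) * (\<Sum>k<N. ind_ball p * ennreal ((increment (real k * h) h p)\<^sup>2))"
    proof -
      have "ennreal (real N * (\<Sum>k<N. (increment (real k * h) h p)\<^sup>2))
          = ennreal (real N) * (\<Sum>k<N. ennreal ((increment (real k * h) h p)\<^sup>2))"
        by (simp add: ennreal_mult sum_nonneg sum_ennreal)
      then show ?thesis by (simp only: sum_distrib_left[symmetric] mult.left_commute)
    qed
    finally show "ind_ball p * ennreal (4 * (\<phi> (fst p))\<^sup>2)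
        \<le> ennreal (real N) * (\<Sum>k<N. ind_ball p * ennreal ((increment (real k * h) h p)\<^sup>2))" .
  qed
  also have "\<dots> = ennreal (real N) * (\<integral>\<^sup>+p. (\<Sum>k<N. ind_ball p * ennreal ((increment (real k * h) h p)\<^sup>2)) \<partial>lborel)"
    by (rule nn_integral_cmult) measurable
  also have "(\<integral>\<^sup>+p. (\<Sum>k<N. ind_ball p * ennreal ((increment (real k * h) h p)\<^sup>2)) \<partial>lborel)
      = (\<Sum>k<N. \<integral>\<^sup>+p. ind_ball p * ennreal ((increment (real k * h) h p)\<^sup>2) \<partial>lborel)"
    by (rule nn_integral_sum) measurable
  also have "(\<Sum>k<N. \<integral>\<^sup>+p. ind_ball p * ennreal ((increment (real k * h) h p)\<^sup>2) \<partial>lborel)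
      = (\<Sum>k<N. \<integral>\<^sup>+p. ind_ball p * ennreal ((increment 0 h p)\<^sup>2) \<partial>lborel)"
    by (intro sum.cong refl eq) simp
  also have "\<dots> = ennreal (real N) * (\<integral>\<^sup>+p. ind_ball p * ennreal ((increment 0 h p)\<^sup>2) \<partial>lborel)"
    by (simp only: sum_constant card_lessThan ennreal_of_nat_eq_real_of_nat)
  also have "ennreal (real N) * (ennreal (real N) * (\<integral>\<^sup>+p. ind_ball p * ennreal ((increment 0 h p)\<^sup>2) \<partial>lborel))
      = (\<integral>\<^sup>+p. ennreal (real N * real N) * (ind_ball p * ennreal ((increment 0 h p)\<^sup>2)) \<partial>lborel)"
    by (subst nn_integral_cmult) (simp_all add: ennreal_mult mult.assoc)
  also have "\<dots> = (\<integral>\<^sup>+p. ind_ball p * ennreal ((real N * increment 0 h p)\<^sup>2) \<partial>lborel)"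
  proof (rule nn_integral_cong)
    fix p
    have "(real N * increment 0 h p)\<^sup>2 = (real N * real N) * (increment 0 h p)\<^sup>2"
      by (simp add: power_mult_distrib power2_eq_square)
    then have "ennreal ((real N * increment 0 h p)\<^sup>2) = ennreal (real N * real N) * ennreal ((increment 0 h p)\<^sup>2)"
      by (simp only: ennreal_mult[OF mult_nonneg_nonneg[OF of_nat_0_le_iff of_nat_0_le_iff] zero_le_power2])
    then show "ennreal (real N * real N) * (ind_ball p * ennreal ((increment 0 h p)\<^sup>2))
        = ind_ball p * ennreal ((real N * increment 0 h p)\<^sup>2)"
      by (simp only: mult.left_commute)
  qed
  finally show ?thesis by (simp add: h_def)
qed

text \<open>As the number of arcs grows, the increment at angle 0 times \<open>N\<close> becomes
  \<open>pi\<close> times the derivative along the tangent \<open>snd p\<close>.\<close>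

lemma odd_le_gradient:
  assumes odd: "\<And>x. \<phi> (- x) = - \<phi> x" and g: "\<And>x. GDERIV \<phi> x :> g x"
    and lip: "\<And>x y. \<bar>\<phi> x - \<phi> y\<bar> \<le> M * norm (x - y)" and M: "M \<ge> 0"
  shows "(\<lambda>p. snd p \<bullet> g (fst p)) \<in> borel_measurable borel"
    and "(\<integral>\<^sup>+p. ind_ball p * ennreal (4 * (\<phi> (fst p))\<^sup>2) \<partial>lborel)
      \<le> (\<integral>\<^sup>+p. ind_ball p * ennreal ((pi * (snd p \<bullet> g (fst p)))\<^sup>2) \<partial>lborel)"
proof -
  define q where "q n p = real (Suc n) * increment 0 (pi / real (Suc n)) p" for n and p :: "'a \<times> 'a"
  have [measurable]: "q n \<in> borel_measurable borel" for n unfolding q_def by measurable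
  have q_lim: "(\<lambda>n. q n p) \<longlonglongrightarrow> pi * (snd p \<bullet> g (fst p))" for p
  proof -
    let ?\<gamma> = "\<lambda>t. cos t *\<^sub>R fst p + sin t *\<^sub>R snd p"
    have "(?\<gamma> has_derivative (\<lambda>t. t *\<^sub>R snd p)) (at 0)"
      by (auto intro!: derivative_eq_intros)
    moreover have "(\<phi> has_derivative (\<lambda>v. v \<bullet> g (fst p))) (at (?\<gamma> 0))"
      using g[of "fst p"] by (simp add: gderiv_def)
    ultimately have "((\<lambda>t. \<phi> (?\<gamma> t)) has_derivative (\<lambda>t. (t *\<^sub>R snd p) \<bullet> g (fst p))) (at 0)"
      by (rule has_derivative_compose)
    from has_derivative_seq_quotient[OF this, of pi]
    show ?thesis by (simp add: q_def increment_def)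
  qed
  have "(\<lambda>p. pi * (snd p \<bullet> g (fst p))) \<in> borel_measurable borel"
    by (rule borel_measurable_LIMSEQ_real[OF q_lim]) measurable
  from borel_measurable_divide[OF this borel_measurable_const[of pi]]
  show meas [measurable]: "(\<lambda>p. snd p \<bullet> g (fst p)) \<in> borel_measurable borel" by simp
  \<comment> \<open>For \<open>p\<close> in the unit ball an arc of angle \<open>?h\<close>
    displaces the point by at most \<open>2 * ?h\<close>, one \<open>?h\<close> from the cosine and
    one from the sine. This bounds all quotients uniformly.\<close>
  have q_le: "(q n p)\<^sup>2 \<le> (2 * pi * M)\<^sup>2" if p: "p \<in> ball 0 1" for n p
  proof -
    let ?h = "pi / real (Suc n)"
    have "norm (fst p) \<le> norm p" "norm (snd p) \<le> norm p"
      by (cases p; simp add: norm_fst_le norm_snd_le)+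
    then have xy: "norm (fst p) \<le> 1" "norm (snd p) \<le> 1" using p by auto
    have h: "\<bar>?h\<bar> = ?h" by simp
    have "norm (cos ?h *\<^sub>R fst p + sin ?h *\<^sub>R snd p - fst p) = norm ((cos ?h - 1) *\<^sub>R fst p + sin ?h *\<^sub>R snd p)"
      by (simp add: algebra_simps)
    also have "\<dots> \<le> \<bar>cos ?h - 1\<bar> * norm (fst p) + \<bar>sin ?h\<bar> * norm (snd p)"
      by (rule norm_triangle_le) simp
    also have "\<dots> \<le> ?h * 1 + ?h * 1"
      using cos_minus_one_le[of ?h] abs_sin_x_le_abs_x[of ?h] xy unfolding h
      by (intro add_mono mult_mono) auto
    finally have "M * norm (cos ?h *\<^sub>R fst p + sin ?h *\<^sub>R snd p - fst p) \<le> M * (2 * pi) / real (Suc n)"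
      using M by (simp add: mult_left_mono field_simps del: of_nat_Suc)
    then have "\<bar>increment 0 ?h p\<bar> \<le> (2 * pi * M) / real (Suc n)"
      using lip[of "cos ?h *\<^sub>R fst p + sin ?h *\<^sub>R snd p" "fst p"] by (simp add: increment_def mult_ac del: of_nat_Suc)
    then have "\<bar>q n p\<bar> \<le> 2 * pi * M" unfolding q_def by (rule abs_Suc_times_le)
    then show ?thesis using M by (simp add: abs_le_square_iff flip: abs_le_square_iff)
  qed
  have "(\<lambda>n. \<integral>\<^sup>+p. ind_ball p * ennreal ((q n p)\<^sup>2) \<partial>lborel)
      \<longlonglongrightarrow> (\<integral>\<^sup>+p. ind_ball p * ennreal ((pi * (snd p \<bullet> g (fst p)))\<^sup>2) \<partial>lborel)"
  proof (rule nn_integral_dominated_convergence[where w="\<lambda>p. ennreal ((2 * pi * M)\<^sup>2) * ind_ball p"])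
    show "AE p in lborel. ind_ball p * ennreal ((q n p)\<^sup>2) \<le> ennreal ((2 * pi * M)\<^sup>2) * ind_ball p" for n
      using q_le by (intro AE_I2) (auto simp: indicator_def intro!: ennreal_leI)
    show "(\<integral>\<^sup>+p. ennreal ((2 * pi * M)\<^sup>2) * ind_ball p \<partial>(lborel :: ('a \<times> 'a) measure)) < \<infinity>"
      using emeasure_lborel_ball_finite[of "0 :: 'a \<times> 'a" 1]
      by (subst nn_integral_cmult) (auto simp: ennreal_mult_less_top)
    show "AE p in lborel. (\<lambda>n. ind_ball p * ennreal ((q n p)\<^sup>2))
        \<longlonglongrightarrow> ind_ball p * ennreal ((pi * (snd p \<bullet> g (fst p)))\<^sup>2)"
    proof (rule AE_I2)
      fix p :: "'a \<times> 'a"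
      have "(\<lambda>n. ennreal ((q n p)\<^sup>2)) \<longlonglongrightarrow> ennreal ((pi * (snd p \<bullet> g (fst p)))\<^sup>2)"
        by (intro tendsto_ennrealI tendsto_power q_lim)
      then show "(\<lambda>n. ind_ball p * ennreal ((q n p)\<^sup>2))
        \<longlonglongrightarrow> ind_ball p * ennreal ((pi * (snd p \<bullet> g (fst p)))\<^sup>2)"
        by (cases "p \<in> ball 0 1") simp_all
    qed
  qed measurable
  then show "(\<integral>\<^sup>+p. ind_ball p * ennreal (4 * (\<phi> (fst p))\<^sup>2) \<partial>lborel)
      \<le> (\<integral>\<^sup>+p. ind_ball p * ennreal ((pi * (snd p \<bullet> g (fst p)))\<^sup>2) \<partial>lborel)"
    by (rule LIMSEQ_le_const) (use odd_le_increments[OF odd] in \<open>auto simp: q_def simp del: of_nat_Suc\<close>)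
qed

end

text \<open>The slice of the unit ball of the product space at \<open>x\<close> is the ball of radius
  \<open>sqrt (1 - norm x ^ 2)\<close>.\<close>

definition slice_weight :: "'a::euclidean_space \<Rightarrow> ennreal" where
  "slice_weight x = (if norm x < 1 then ennreal (sqrt (1 - (norm x)\<^sup>2) ^ DIM('a) * (1 - (norm x)\<^sup>2)) else 0)"

lemma ind_ball_slice:
  fixes x y :: "'a::euclidean_space"
  shows "ind_ball (x, y) = (if norm x < 1 then indicator (ball 0 (sqrt (1 - (norm x)\<^sup>2))) y else 0)"
proof -
  have "norm (x, y) < 1 \<longleftrightarrow> (norm x)\<^sup>2 + (norm y)\<^sup>2 < 1" by (simp add: norm_Pair)
  also have "\<dots> \<longleftrightarrow> norm x < 1 \<and> norm y < sqrt (1 - (norm x)\<^sup>2)"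
  proof
    assume *: "(norm x)\<^sup>2 + (norm y)\<^sup>2 < 1"
    then have "(norm x)\<^sup>2 < 1" using zero_le_power2[of "norm y"] by linarith
    then have "norm x < 1" by (simp add: abs_square_less_1)
    then show "norm x < 1 \<and> norm y < sqrt (1 - (norm x)\<^sup>2)"
      using * by (simp add: real_less_rsqrt)
  next
    assume "norm x < 1 \<and> norm y < sqrt (1 - (norm x)\<^sup>2)"
    then show "(norm x)\<^sup>2 + (norm y)\<^sup>2 < 1"
      using real_sqrt_less_iff[of "(norm y)\<^sup>2" "1 - (norm x)\<^sup>2"] by (simp del: real_sqrt_less_iff)
  qed
  finally show ?thesis by (auto simp: indicator_def)
qed

lemma ind_ball_swap: "ind_ball (x, y) = ind_ball (y, x)"
  by (simp add: indicator_def norm_Pair add.commute)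

lemma nn_integral_slice:
  fixes x :: "'a::euclidean_space"
  assumes k: "k \<in> borel_measurable borel"
  shows "(\<integral>\<^sup>+y. ind_ball (x, y) * (ennreal ((norm y)\<^sup>2) * k (sgn y)) \<partial>lborel) = slice_weight x * ball_moment k"
proof (cases "norm x < 1")
  case True
  then have "(norm x)\<^sup>2 < 1" by (simp add: abs_square_less_1)
  then show ?thesis
    using True ball_moment_scale[OF k, of "sqrt (1 - (norm x)\<^sup>2)"] by (simp add: ind_ball_slice slice_weight_def)
qed (simp add: ind_ball_slice slice_weight_def)

lemma borel_measurable_slice_weight [measurable]: "slice_weight \<in> borel_measurable borel"
  unfolding slice_weight_def[abs_def] by measurable

text \<open>The integral of the squared norm of either component over the unit ball of the product.
  Both sides of the Poincare inequality carry it as a common factor.\<close>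

definition slice_total :: "'a::euclidean_space itself \<Rightarrow> ennreal" where
  "slice_total _ = (\<integral>\<^sup>+x. slice_weight (x::'a) \<partial>lborel) * ball_moment (\<lambda>_::'a. 1)"

text \<open>By the symmetry of the ball the slices may be taken over the second component, and the
  slice formula then evaluates the inner integral over the first.\<close>

lemma nn_integral_fst_moment:
  fixes k :: "'a::euclidean_space \<Rightarrow> ennreal"
  assumes k [measurable]: "k \<in> borel_measurable borel"
    and I: "ball_angular k = ennreal \<kappa> * ball_angular (\<lambda>_::'a. 1)" "\<kappa> \<ge> 0"
  shows "(\<integral>\<^sup>+p. ind_ball p * (ennreal ((norm (fst p))\<^sup>2) * k (sgn (fst p))) \<partial>lborel) = ennreal \<kappa> * slice_total TYPE('a)"
proof -
  have "(\<lambda>x. ennreal ((norm x)\<^sup>2) * k (sgn x)) \<in> borel_measurable borel" by measurable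
  then have [measurable]: "(\<lambda>p :: 'a \<times> 'a. ennreal ((norm (fst p))\<^sup>2) * k (sgn (fst p))) \<in> borel_measurable borel"
    by (rule measurable_compose[rotated]) (intro borel_measurable_continuous_onI continuous_intros)
  have "(\<integral>\<^sup>+p. ind_ball p * (ennreal ((norm (fst p))\<^sup>2) * k (sgn (fst p))) \<partial>lborel)
      = (\<integral>\<^sup>+y. \<integral>\<^sup>+x. ind_ball (x, y) * (ennreal ((norm x)\<^sup>2) * k (sgn x)) \<partial>lborel \<partial>lborel)"
    by (subst nn_integral_lborel_snd) simp_all
  also have "\<dots> = (\<integral>\<^sup>+y. slice_weight y * ball_moment k \<partial>(lborel :: 'a measure))"
    by (subst ind_ball_swap) (simp only: nn_integral_slice[OF k])
  also have "\<dots> = (\<integral>\<^sup>+y. slice_weight y \<partial>(lborel :: 'a measure)) * ball_moment k"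
    by (rule nn_integral_multc) measurable
  finally show ?thesis by (simp add: ball_moment_eq[OF k I] slice_total_def mult_ac)
qed

text \<open>Both facts serve to cancel the common factor. If it were 0, both components would vanish
  almost everywhere on a ball of positive measure.\<close>

lemma slice_total_finite: "slice_total TYPE('a::euclidean_space) < \<top>"
  and slice_total_pos: "slice_total TYPE('a) > 0"
proof -
  have [measurable]: "(\<lambda>p :: 'a \<times> 'a. ennreal ((norm (fst p))\<^sup>2)) \<in> borel_measurable borel"
    "(\<lambda>p :: 'a \<times> 'a. ennreal ((norm (snd p))\<^sup>2)) \<in> borel_measurable borel"
    by (intro measurable_compose[OF _ measurable_ennreal] borel_measurable_continuous_onI continuous_intros)+
  have 1: "(\<integral>\<^sup>+p. ind_ball p * ennreal ((norm (fst p))\<^sup>2) \<partial>(lborel :: ('a \<times> 'a) measure)) = slice_total TYPE('a)"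
    using nn_integral_fst_moment[of "\<lambda>_::'a. 1" 1] by simp
  have 2: "(\<integral>\<^sup>+p. ind_ball p * ennreal ((norm (snd p))\<^sup>2) \<partial>(lborel :: ('a \<times> 'a) measure)) = slice_total TYPE('a)"
  proof -
    have "(\<integral>\<^sup>+p. ind_ball p * ennreal ((norm (snd p))\<^sup>2) \<partial>(lborel :: ('a \<times> 'a) measure))
        = (\<integral>\<^sup>+x. \<integral>\<^sup>+y. ind_ball (x, y) * (ennreal ((norm y)\<^sup>2) * 1) \<partial>lborel \<partial>(lborel :: 'a measure))"
      by (subst nn_integral_lborel_fst) simp_all
    also have "\<dots> = (\<integral>\<^sup>+x. slice_weight x * ball_moment (\<lambda>_::'a. 1) \<partial>(lborel :: 'a measure))"
      by (simp only: nn_integral_slice[of "\<lambda>_. 1"] borel_measurable_const)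
    also have "\<dots> = slice_total TYPE('a)"
      unfolding slice_total_def by (rule nn_integral_multc) measurable
    finally show ?thesis .
  qed
  have "slice_total TYPE('a) \<le> (\<integral>\<^sup>+p. ind_ball p \<partial>(lborel :: ('a \<times> 'a) measure))"
    unfolding 1[symmetric]
  proof (rule nn_integral_mono)
    fix p :: "'a \<times> 'a"
    have "norm (fst p) \<le> norm p" by (cases p) (simp add: norm_fst_le)
    then show "ind_ball p * ennreal ((norm (fst p))\<^sup>2) \<le> ind_ball p"
      by (auto simp: indicator_def intro!: power_le_one ennreal_le_1[THEN iffD2])
  qed
  also have "\<dots> < \<top>" using emeasure_lborel_ball_finite[of "0 :: 'a \<times> 'a" 1] by simp
  finally show "slice_total TYPE('a) < \<top>" .
  show "slice_total TYPE('a) > 0"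
  proof (rule ccontr)
    assume "\<not> slice_total TYPE('a) > 0"
    then have 0: "slice_total TYPE('a) = 0" by (simp add: not_less)
    have "AE p :: 'a \<times> 'a in lborel. ind_ball p * ennreal ((norm (fst p))\<^sup>2) = 0"
      "AE p :: 'a \<times> 'a in lborel. ind_ball p * ennreal ((norm (snd p))\<^sup>2) = 0"
      using 1 2 0 by (subst nn_integral_0_iff_AE[symmetric]; simp)+
    then have "AE p :: 'a \<times> 'a in lborel. p \<notin> ball 0 1"
      using AE_lborel_norm_neq[of 0]
    proof eventually_elim
      case (elim p)
      have "p \<noteq> 0" using elim(3) by auto
      then have "fst p \<noteq> 0 \<or> snd p \<noteq> 0" by (simp add: prod_eq_iff)
      then show ?case using elim(1,2) by (auto simp: indicator_def)
    qed
    then have "AE p :: 'a \<times> 'a in lborel. p \<in> cball 0 1 \<longrightarrow> False"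
      using AE_lborel_norm_neq[of 1] by eventually_elim auto
    then have "AE p :: 'a \<times> 'a in ball_law. False"
      by (intro AE_uniform_measureI) auto
    then show False using prob_space.AE_False[OF prob_space_ball_law] by blast
  qed
qed

text \<open>For fixed \<open>x\<close> the slice averages \<open>(y \<bullet> g x)\<^sup>2\<close>
  over all directions of \<open>y\<close>, which leaves the fraction \<open>1 / DIM('a)\<close> of
  the squared norms. This is the dimensional gain in the second moment of the estimator.\<close>

lemma odd_moment_le_smooth:
  fixes \<phi> :: "'a::euclidean_space \<Rightarrow> real"
  assumes odd: "\<And>x. \<phi> (- x) = - \<phi> x" and g: "\<And>x. GDERIV \<phi> x :> g x"
    and lip: "\<And>x y. \<bar>\<phi> x - \<phi> y\<bar> \<le> M * norm (x - y)" and M: "M \<ge> 0"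
  shows "(\<integral>\<^sup>+p. ind_ball p * ennreal (4 * (\<phi> (fst p))\<^sup>2) \<partial>lborel) \<le> ennreal ((pi * M)\<^sup>2 / real DIM('a)) * slice_total TYPE('a)"
proof -
  have "M-lipschitz_on UNIV \<phi>"
    using lip M by (auto simp: lipschitz_on_def dist_norm dist_real_def)
  then have \<phi> [measurable]: "\<phi> \<in> borel_measurable borel"
    by (intro borel_measurable_continuous_onI lipschitz_on_continuous_on)
  note meas [measurable] = odd_le_gradient(1)[OF \<phi> odd g lip M]
  have g_le: "norm (g x) \<le> M" for x
  proof (cases "g x = 0")
    case False
    have "g x \<bullet> g x \<le> M * norm (g x)"
    proof (rule LIMSEQ_le_const2[OF has_derivative_seq_quotient[OF g[of x, unfolded gderiv_def], of "g x"]], intro exI allI impI)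
      fix n :: nat
      have "\<bar>\<phi> (x + (1 / real (Suc n)) *\<^sub>R g x) - \<phi> x\<bar> \<le> M * norm (g x) / real (Suc n)"
        using lip[of "x + (1 / real (Suc n)) *\<^sub>R g x" x] by simp
      then show "real (Suc n) * (\<phi> (x + (1 / real (Suc n)) *\<^sub>R g x) - \<phi> x) \<le> M * norm (g x)"
        using abs_Suc_times_le abs_le_D1 by blast
    qed
    then show ?thesis using False by (simp add: dot_square_norm power2_eq_square)
  qed (use M in simp)
  have inner: "(\<integral>\<^sup>+y. ind_ball (x, y) * ennreal ((pi * (y \<bullet> g x))\<^sup>2) \<partial>lborel)
      \<le> ennreal ((pi * M)\<^sup>2 / real DIM('a)) * (slice_weight x * ball_moment (\<lambda>_::'a. 1))" for x
  proof -
    let ?a = "pi *\<^sub>R g x" and ?k = "\<lambda>w. ennreal (((pi *\<^sub>R g x) \<bullet> w)\<^sup>2)"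
    have "ennreal ((pi * (y \<bullet> g x))\<^sup>2) = ennreal ((norm y)\<^sup>2) * ?k (sgn y)" for y
    proof -
      have "pi * (y \<bullet> g x) = norm y * (?a \<bullet> sgn y)"
        by (cases "y = 0") (simp_all add: sgn_div_norm inner_commute)
      then show ?thesis by (simp add: power_mult_distrib flip: ennreal_mult')
    qed
    then have "(\<integral>\<^sup>+y. ind_ball (x, y) * ennreal ((pi * (y \<bullet> g x))\<^sup>2) \<partial>lborel) = slice_weight x * ball_moment ?k"
      using nn_integral_slice[of ?k x] by simp
    also have "ball_moment ?k = ennreal ((norm ?a)\<^sup>2 / real DIM('a)) * ball_moment (\<lambda>_::'a. 1)"
      by (rule ball_moment_eq[OF _ ball_angular_inner_square]) auto
    also have "slice_weight x * \<dots> \<le> slice_weight x * (ennreal ((pi * M)\<^sup>2 / real DIM('a)) * ball_moment (\<lambda>_::'a. 1))"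
      using g_le[of x] M by (intro mult_left_mono mult_right_mono ennreal_leI divide_right_mono power_mono) auto
    finally show ?thesis by (simp add: mult_ac)
  qed
  have "(\<integral>\<^sup>+p. ind_ball p * ennreal (4 * (\<phi> (fst p))\<^sup>2) \<partial>lborel)
      \<le> (\<integral>\<^sup>+p. ind_ball p * ennreal ((pi * (snd p \<bullet> g (fst p)))\<^sup>2) \<partial>lborel)"
    by (rule odd_le_gradient(2)[OF \<phi> odd g lip M])
  also have "\<dots> = (\<integral>\<^sup>+x. \<integral>\<^sup>+y. ind_ball (x, y) * ennreal ((pi * (y \<bullet> g x))\<^sup>2) \<partial>lborel \<partial>lborel)"
    by (subst nn_integral_lborel_fst) simp_all
  also have "\<dots> \<le> (\<integral>\<^sup>+x. ennreal ((pi * M)\<^sup>2 / real DIM('a)) * (slice_weight (x::'a) * ball_moment (\<lambda>_::'a. 1)) \<partial>lborel)"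
    by (intro nn_integral_mono inner)
  also have "\<dots> = ennreal ((pi * M)\<^sup>2 / real DIM('a)) * slice_total TYPE('a)"
    unfolding slice_total_def by (simp add: nn_integral_cmult nn_integral_multc)
  finally show ?thesis .
qed

text \<open>Passage to merely Lipschitz functions by mollifying at scale \<open>\<sigma>\<close> and
  letting \<open>\<sigma>\<close> tend to 0.\<close>

lemma odd_moment_le:
  fixes \<phi> :: "'a::euclidean_space \<Rightarrow> real"
  assumes odd: "\<And>x. \<phi> (- x) = - \<phi> x"
    and lip: "\<And>x y. \<bar>\<phi> x - \<phi> y\<bar> \<le> M * norm (x - y)" and M: "M \<ge> 0"
  shows "(\<integral>\<^sup>+p. ind_ball p * ennreal (4 * (\<phi> (fst p))\<^sup>2) \<partial>lborel) \<le> ennreal ((pi * M)\<^sup>2 / real DIM('a)) * slice_total TYPE('a)"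
proof -
  define C where "C = (pi * M)\<^sup>2 / real DIM('a)"
  define k where "k = enn2real (slice_total TYPE('a))"
  define v where "v = measure lborel (ball (0 :: 'a \<times> 'a) 1)"
  have k: "slice_total TYPE('a) = ennreal k" "k \<ge> 0" using slice_total_finite[where 'a='a] by (auto simp: k_def)
  have v: "(\<integral>\<^sup>+p. ind_ball p \<partial>(lborel :: ('a \<times> 'a) measure)) = ennreal v"
    using emeasure_lborel_ball_finite[of "0 :: 'a \<times> 'a" 1] by (simp add: v_def emeasure_eq_ennreal_measure)
  have C: "C \<ge> 0" by (simp add: C_def)
  have v0: "v \<ge> 0" by (simp add: v_def)
  let ?X = "\<integral>\<^sup>+p. ind_ball p * ennreal (4 * (\<phi> (fst p))\<^sup>2) \<partial>lborel"
  have bound: "?X \<le> ennreal ((1 + \<sigma>) * (C * k) + 4 * M\<^sup>2 * (\<sigma>\<^sup>2 + \<sigma>) * v)" if \<sigma>: "\<sigma> > 0" for \<sigma>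
  proof -
    obtain \<psi> g where \<psi>: "\<And>x. GDERIV \<psi> x :> g x" "\<And>x y. \<bar>\<psi> x - \<psi> y\<bar> \<le> M * norm (x - y)"
      "\<And>x. \<psi> (- x) = - \<psi> x" "\<And>x. \<bar>\<psi> x - \<phi> x\<bar> \<le> M * \<sigma>"
      by (rule mollification[OF lip odd \<sigma>]) blast
    have "M-lipschitz_on UNIV \<psi>"
      using \<psi>(2) M by (auto simp: lipschitz_on_def dist_norm dist_real_def)
    then have [measurable]: "\<psi> \<in> borel_measurable borel"
      by (intro borel_measurable_continuous_onI lipschitz_on_continuous_on)
    have pt: "4 * (\<phi> x)\<^sup>2 \<le> (1 + \<sigma>) * (4 * (\<psi> x)\<^sup>2) + 4 * M\<^sup>2 * (\<sigma>\<^sup>2 + \<sigma>)" for x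
    proof -
      \<comment> \<open>Young's inequality with weight \<open>\<sigma>\<close>: the error is at most
        \<open>M * \<sigma>\<close>, so even multiplied by \<open>1 + 1 / \<sigma>\<close> its
        square vanishes with \<open>\<sigma>\<close>.\<close>
      define b where "b = \<phi> x - \<psi> x"
      have "b\<^sup>2 \<le> (M * \<sigma>)\<^sup>2"
        using \<psi>(4)[of x] M \<sigma> by (intro abs_le_square_iff[THEN iffD1]) (simp add: b_def abs_minus_commute)
      then have "(1 + 1 / \<sigma>) * b\<^sup>2 \<le> (1 + 1 / \<sigma>) * (M * \<sigma>)\<^sup>2" using \<sigma> by (intro mult_left_mono) auto
      also have "\<dots> = M\<^sup>2 * (\<sigma>\<^sup>2 + \<sigma>)" using \<sigma> by (simp add: field_simps power2_eq_square)
      finally have 1: "(1 + 1 / \<sigma>) * b\<^sup>2 \<le> M\<^sup>2 * (\<sigma>\<^sup>2 + \<sigma>)" .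
      have "0 \<le> (\<sigma> * \<psi> x - b)\<^sup>2 / \<sigma>" using \<sigma> by simp
      also have "\<dots> = \<sigma> * (\<psi> x)\<^sup>2 - 2 * \<psi> x * b + b\<^sup>2 / \<sigma>"
        using \<sigma> by (simp add: power2_eq_square field_simps)
      finally have "(\<psi> x + b)\<^sup>2 \<le> (1 + \<sigma>) * (\<psi> x)\<^sup>2 + (1 + 1 / \<sigma>) * b\<^sup>2"
        by (simp add: power2_sum distrib_right)
      then show ?thesis using 1 by (simp add: b_def algebra_simps)
    qed
    have "?X \<le> (\<integral>\<^sup>+p. ennreal (1 + \<sigma>) * (ind_ball p * ennreal (4 * (\<psi> (fst p))\<^sup>2))
        + ennreal (4 * M\<^sup>2 * (\<sigma>\<^sup>2 + \<sigma>)) * ind_ball p \<partial>lborel)"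
    proof (rule nn_integral_mono)
      fix p :: "'a \<times> 'a"
      have "ennreal (4 * (\<phi> (fst p))\<^sup>2)
          \<le> ennreal ((1 + \<sigma>) * (4 * (\<psi> (fst p))\<^sup>2) + 4 * M\<^sup>2 * (\<sigma>\<^sup>2 + \<sigma>))"
        by (intro ennreal_leI pt)
      also have "\<dots> = ennreal (1 + \<sigma>) * ennreal (4 * (\<psi> (fst p))\<^sup>2) + ennreal (4 * M\<^sup>2 * (\<sigma>\<^sup>2 + \<sigma>))"
        using \<sigma> by (subst ennreal_plus) (auto simp: ennreal_mult)
      finally show "ind_ball p * ennreal (4 * (\<phi> (fst p))\<^sup>2)
          \<le> ennreal (1 + \<sigma>) * (ind_ball p * ennreal (4 * (\<psi> (fst p))\<^sup>2)) + ennreal (4 * M\<^sup>2 * (\<sigma>\<^sup>2 + \<sigma>)) * ind_ball p"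
        by (cases "p \<in> ball 0 1") simp_all
    qed
    also have "\<dots> = ennreal (1 + \<sigma>) * (\<integral>\<^sup>+p. ind_ball p * ennreal (4 * (\<psi> (fst p))\<^sup>2) \<partial>lborel)
        + ennreal (4 * M\<^sup>2 * (\<sigma>\<^sup>2 + \<sigma>)) * ennreal v"
      unfolding v[symmetric] by (subst nn_integral_add) (simp_all add: nn_integral_cmult)
    also have "\<dots> \<le> ennreal (1 + \<sigma>) * (ennreal C * ennreal k) + ennreal (4 * M\<^sup>2 * (\<sigma>\<^sup>2 + \<sigma>)) * ennreal v"
      using odd_moment_le_smooth[OF \<psi>(3) \<psi>(1) \<psi>(2) M] by (intro add_mono mult_left_mono) (auto simp: C_def k)
    also have "\<dots> = ennreal ((1 + \<sigma>) * (C * k) + 4 * M\<^sup>2 * (\<sigma>\<^sup>2 + \<sigma>) * v)"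
      using \<sigma> C k(2) v0 by (subst ennreal_plus) (auto simp: ennreal_mult)
    finally show ?thesis .
  qed
  have "(\<lambda>n. ennreal ((1 + 1 / real (Suc n)) * (C * k) + 4 * M\<^sup>2 * ((1 / real (Suc n))\<^sup>2 + 1 / real (Suc n)) * v))
      \<longlonglongrightarrow> ennreal ((1 + 0) * (C * k) + 4 * M\<^sup>2 * (0\<^sup>2 + 0) * v)"
    by (intro tendsto_ennrealI tendsto_intros LIMSEQ_Suc[OF lim_1_over_n])
  then have "?X \<le> ennreal ((1 + 0) * (C * k) + 4 * M\<^sup>2 * (0\<^sup>2 + 0) * v)"
    by (rule LIMSEQ_le_const) (intro exI allI impI bound, simp)
  moreover have "ennreal C * slice_total TYPE('a) = ennreal (C * k)"
    unfolding k(1) using C k(2) by (rule ennreal_mult[symmetric])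
  ultimately show ?thesis unfolding C_def by simp
qed

text \<open>The degree-one homogeneous extension \<open>\<phi>\<close> carries the function from the
  sphere to the ball, with Lipschitz constant \<open>3 * H\<close>. The 36 is
  \<open>(3 * 4)\<^sup>2 / 4\<close>, using \<open>pi < 4\<close>.\<close>

lemma sphere_odd_moment_le:
  fixes h :: "'a::euclidean_space \<Rightarrow> real"
  assumes odd: "\<And>x. h (- x) = - h x"
    and lip: "\<And>x y. \<bar>h x - h y\<bar> \<le> H * norm (x - y)" and H: "H \<ge> 0"
  shows "(\<integral>\<^sup>+w. ennreal ((h w)\<^sup>2) \<partial>uniform_sphere) \<le> ennreal (36 * H\<^sup>2 / real DIM('a))"
proof -
  interpret S: prob_space "uniform_sphere :: 'a measure" by (rule prob_space_uniform_sphere)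
  have "H-lipschitz_on UNIV h"
    using lip H by (auto simp: lipschitz_on_def dist_norm dist_real_def)
  then have [measurable]: "h \<in> borel_measurable borel"
    by (intro borel_measurable_continuous_onI lipschitz_on_continuous_on)
  have h_le: "\<bar>h w\<bar> \<le> H * norm w" for w using lip[of w 0] odd[of 0] by simp
  define \<phi> where "\<phi> x = norm x * h (sgn x)" for x
  have \<phi>_odd: "\<phi> (- x) = - \<phi> x" for x by (simp add: \<phi>_def sgn_minus odd)
  have \<phi>_lip: "\<bar>\<phi> x - \<phi> y\<bar> \<le> (3 * H) * norm (x - y)" for x y
  proof -
    have *: "norm z *\<^sub>R sgn z = z" for z :: 'a by (cases "z = 0") (simp_all add: sgn_div_norm)
    \<comment> \<open>\<open>sgn\<close> is not Lipschitz near 0, but the weight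
      \<open>norm x\<close> compensates for this with constant 2; the change of the radius adds the
      third \<open>H\<close>.\<close>
    have "norm x *\<^sub>R (sgn x - sgn y) = (x - y) + (norm y - norm x) *\<^sub>R sgn y"
      by (simp add: scaleR_diff_right scaleR_diff_left *)
    then have "norm x * norm (sgn x - sgn y) = norm ((x - y) + (norm y - norm x) *\<^sub>R sgn y)"
      by (metis abs_norm_cancel norm_scaleR)
    also have "\<dots> \<le> norm (x - y) + \<bar>norm y - norm x\<bar> * norm (sgn y)"
      by (rule norm_triangle_le) simp
    also have "\<dots> \<le> norm (x - y) + norm (x - y) * 1"
      using norm_triangle_ineq3[of y x]
      by (intro add_left_mono mult_mono) (auto simp: norm_sgn norm_minus_commute)
    finally have A: "norm x * norm (sgn x - sgn y) \<le> 2 * norm (x - y)" by simp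
    have "\<phi> x - \<phi> y = norm x * (h (sgn x) - h (sgn y)) + (norm x - norm y) * h (sgn y)"
      by (simp add: \<phi>_def algebra_simps)
    then have "\<bar>\<phi> x - \<phi> y\<bar> \<le> norm x * \<bar>h (sgn x) - h (sgn y)\<bar> + \<bar>norm x - norm y\<bar> * \<bar>h (sgn y)\<bar>"
      using abs_triangle_ineq[of "norm x * (h (sgn x) - h (sgn y))" "(norm x - norm y) * h (sgn y)"]
      by (simp add: abs_mult)
    also have "\<dots> \<le> norm x * (H * norm (sgn x - sgn y)) + norm (x - y) * H"
    proof (intro add_mono mult_left_mono mult_mono)
      show "\<bar>h (sgn y)\<bar> \<le> H" using h_le[of "sgn y"] H by (cases "y = 0") (auto simp: norm_sgn)
    qed (use lip norm_triangle_ineq3 in auto)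
    also have "\<dots> = H * (norm x * norm (sgn x - sgn y)) + norm (x - y) * H" by simp
    also have "\<dots> \<le> H * (2 * norm (x - y)) + norm (x - y) * H"
      using A H by (intro add_right_mono mult_left_mono) auto
    finally show ?thesis by (simp add: algebra_simps)
  qed
  let ?k = "\<lambda>w. ennreal ((h w)\<^sup>2)"
  define \<kappa> where "\<kappa> = enn2real (\<integral>\<^sup>+w. ?k w \<partial>uniform_sphere)"
  have "(\<integral>\<^sup>+w. ?k w \<partial>uniform_sphere) \<le> (\<integral>\<^sup>+w. ennreal (H\<^sup>2) \<partial>(uniform_sphere :: 'a measure))"
  proof (rule nn_integral_mono_AE)
    show "AE w in uniform_sphere. ?k w \<le> ennreal (H\<^sup>2)"
      using AE_uniform_sphere_norm
    proof eventually_elim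
      case (elim w)
      have "\<bar>h w\<bar> \<le> \<bar>H\<bar>"
        using h_le[of w] mult_left_mono[OF elim H] H by simp
      then show ?case by (intro ennreal_leI) (simp add: abs_le_square_iff)
    qed
  qed
  also have "\<dots> < \<top>" using S.emeasure_space_1 by simp
  finally have \<kappa>: "(\<integral>\<^sup>+w. ?k w \<partial>uniform_sphere) = ennreal \<kappa>" "\<kappa> \<ge> 0" by (auto simp: \<kappa>_def)
  have ang: "ball_angular ?k = ennreal \<kappa> * ball_angular (\<lambda>_::'a. 1)"
    by (subst nn_integral_uniform_sphere) (simp_all add: \<kappa>)
  define k where "k = enn2real (slice_total TYPE('a))"
  have k: "slice_total TYPE('a) = ennreal k" "k > 0"
    using slice_total_finite[where 'a='a] slice_total_pos[where 'a='a] by (auto simp: k_def enn2real_positive_iff)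
  have "ennreal (4 * \<kappa> * k) = 4 * (\<integral>\<^sup>+p. ind_ball p * (ennreal ((norm (fst p))\<^sup>2) * ?k (sgn (fst p))) \<partial>lborel)"
    using \<kappa>(2) k by (simp add: nn_integral_fst_moment[OF _ ang] ennreal_mult mult.assoc)
  also have "\<dots> = (\<integral>\<^sup>+p. ind_ball p * ennreal (4 * (\<phi> (fst p))\<^sup>2) \<partial>lborel)"
    by (subst nn_integral_cmult[symmetric])
      (auto intro!: nn_integral_cong simp: \<phi>_def power_mult_distrib ennreal_mult mult.left_commute
        intro!: borel_measurable_times measurable_fst_borel)
  also have "\<dots> \<le> ennreal ((pi * (3 * H))\<^sup>2 / real DIM('a)) * ennreal k"
    using odd_moment_le[OF \<phi>_odd \<phi>_lip] H by (simp add: k)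
  also have "\<dots> = ennreal ((pi * (3 * H))\<^sup>2 / real DIM('a) * k)"
    using k by (intro ennreal_mult[symmetric]) auto
  finally have "4 * \<kappa> * k \<le> (pi * (3 * H))\<^sup>2 / real DIM('a) * k" using k by (simp add: ennreal_le_iff)
  then have "4 * \<kappa> \<le> (pi * (3 * H))\<^sup>2 / real DIM('a)" by (rule mult_right_le_imp_le[OF _ k(2)])
  also have "\<dots> \<le> (4 * (3 * H))\<^sup>2 / real DIM('a)"
    using H pi_less_4 by (intro divide_right_mono power_mono mult_right_mono) auto
  finally have "\<kappa> \<le> 36 * H\<^sup>2 / real DIM('a)" by (simp add: power_mult_distrib)
  then show ?thesis unfolding \<kappa>(1) by (rule ennreal_leI)
qed

section \<open>Moments of the gradient estimator\<close>

lemma (in prob_space) integrable_of_square: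
  fixes Y :: "'a \<Rightarrow> 'b::euclidean_space"
  assumes [measurable]: "Y \<in> borel_measurable M" and S: "(\<integral>\<^sup>+w. ennreal ((norm (Y w))\<^sup>2) \<partial>M) \<le> ennreal S"
  shows "integrable M Y" and "integrable M (\<lambda>w. (norm (Y w))\<^sup>2)"
    and "S \<ge> 0 \<Longrightarrow> (\<integral>w. (norm (Y w))\<^sup>2 \<partial>M) \<le> S"
proof -
  show sq: "integrable M (\<lambda>w. (norm (Y w))\<^sup>2)"
    by (rule integrableI_bounded) (use le_less_trans[OF S] in simp_all)
  have "integrable M (\<lambda>w. 1 + (norm (Y w))\<^sup>2)" using sq by simp
  then show "integrable M Y"
  proof (rule Bochner_Integration.integrable_bound)
    have "norm (Y w) \<le> 1 + (norm (Y w))\<^sup>2" for w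
    proof (cases "norm (Y w) \<le> 1")
      case True
      then show ?thesis using zero_le_power2[of "norm (Y w)"] by linarith
    next
      case False
      then show ?thesis using self_le_power[of "norm (Y w)" 2] by simp
    qed
    then show "AE w in M. norm (Y w) \<le> norm (1 + (norm (Y w))\<^sup>2)"
      unfolding real_norm_def by (intro AE_I2 order_trans[OF _ abs_ge_self])
  qed simp
  show "(\<integral>w. (norm (Y w))\<^sup>2 \<partial>M) \<le> S" if "S \<ge> 0"
    using S that nn_integral_eq_integral[OF sq] by simp
qed

lemma (in prob_space) nn_integral_norm_add_square_le:
  fixes Y :: "'a \<Rightarrow> 'b::euclidean_space"
  assumes Y: "Y \<in> borel_measurable M" and S: "(\<integral>\<^sup>+w. ennreal ((norm (Y w))\<^sup>2) \<partial>M) \<le> ennreal S" "S \<ge> 0"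
  shows "(\<integral>\<^sup>+w. ennreal ((norm (a + Y w))\<^sup>2) \<partial>M) \<le> ennreal ((norm a)\<^sup>2 + 2 * (a \<bullet> expectation Y) + S)"
proof -
  note int = integrable_of_square[OF Y S(1)]
  have expand: "(norm (a + Y w))\<^sup>2 = (norm a)\<^sup>2 + 2 * (a \<bullet> Y w) + (norm (Y w))\<^sup>2" for w
    by (simp add: power2_norm_eq_inner inner_simps inner_commute)
  have "(\<integral>\<^sup>+w. ennreal ((norm (a + Y w))\<^sup>2) \<partial>M) = ennreal (\<integral>w. (norm (a + Y w))\<^sup>2 \<partial>M)"
  proof (rule nn_integral_eq_integral)
    show "integrable M (\<lambda>w. (norm (a + Y w))\<^sup>2)" unfolding expand using int(1,2) by simp
  qed simp
  also have "(\<integral>w. (norm (a + Y w))\<^sup>2 \<partial>M) = (norm a)\<^sup>2 + 2 * (a \<bullet> expectation Y) + (\<integral>w. (norm (Y w))\<^sup>2 \<partial>M)"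
    unfolding expand using int(1,2) by (simp add: prob_space)
  also have "ennreal \<dots> \<le> ennreal ((norm a)\<^sup>2 + 2 * (a \<bullet> expectation Y) + S)"
    using int(3)[OF S(2)] by (intro ennreal_leI) simp
  finally show ?thesis .
qed

text \<open>The cross term vanishes for centred noise, and the variance is at most the second
  moment.\<close>

lemma (in prob_space) nn_integral_centered_square_le:
  fixes Y :: "'a \<Rightarrow> 'b::euclidean_space"
  assumes Y: "Y \<in> borel_measurable M" and S: "(\<integral>\<^sup>+w. ennreal ((norm (Y w))\<^sup>2) \<partial>M) \<le> ennreal S" "S \<ge> 0"
  shows "(\<integral>\<^sup>+w. ennreal ((norm (a + (Y w - expectation Y)))\<^sup>2) \<partial>M) \<le> ennreal ((norm a)\<^sup>2 + S)"
proof -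
  let ?\<mu> = "expectation Y"
  have "(\<integral>\<^sup>+w. ennreal ((norm (a + (Y w - ?\<mu>)))\<^sup>2) \<partial>M) = (\<integral>\<^sup>+w. ennreal ((norm ((a - ?\<mu>) + Y w))\<^sup>2) \<partial>M)"
    by (simp add: algebra_simps)
  also have "\<dots> \<le> ennreal ((norm (a - ?\<mu>))\<^sup>2 + 2 * ((a - ?\<mu>) \<bullet> ?\<mu>) + S)"
    by (rule nn_integral_norm_add_square_le[OF Y S])
  also have "\<dots> \<le> ennreal ((norm a)\<^sup>2 + S)"
    by (intro ennreal_leI) (simp add: power2_norm_eq_inner inner_simps inner_commute)
  finally show ?thesis .
qed

lemma (in prob_space) norm_expectation_square_le:
  fixes Y :: "'a \<Rightarrow> 'b::euclidean_space"
  assumes Y: "Y \<in> borel_measurable M" and S: "(\<integral>\<^sup>+w. ennreal ((norm (Y w))\<^sup>2) \<partial>M) \<le> ennreal S" "S \<ge> 0"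
  shows "(norm (expectation Y))\<^sup>2 \<le> S"
proof -
  note int = integrable_of_square[OF Y S(1)]
  let ?\<mu> = "expectation Y"
  have "0 \<le> (\<integral>w. (norm ?\<mu>)\<^sup>2 - 2 * (?\<mu> \<bullet> Y w) + (norm (Y w))\<^sup>2 \<partial>M)"
  proof (rule integral_nonneg_AE, rule AE_I2)
    fix w
    have "(norm (?\<mu> - Y w))\<^sup>2 = (norm ?\<mu>)\<^sup>2 - 2 * (?\<mu> \<bullet> Y w) + (norm (Y w))\<^sup>2"
      by (simp add: power2_norm_eq_inner inner_simps inner_commute)
    then show "0 \<le> (norm ?\<mu>)\<^sup>2 - 2 * (?\<mu> \<bullet> Y w) + (norm (Y w))\<^sup>2"
      by (metis zero_le_power2)
  qed
  also have "\<dots> = (\<integral>w. (norm (Y w))\<^sup>2 \<partial>M) - (norm ?\<mu>)\<^sup>2"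
    using int(1,2) by (simp add: prob_space dot_square_norm)
  finally show ?thesis using int(3)[OF S(2)] by simp
qed

text \<open>The batch mean is a chain that adds one centred sample at a time, each contributing at
  most \<open>S / (real b)\<^sup>2\<close>. The offset \<open>a\<close> carries the estimation error
  from before the batch.\<close>

lemma nn_integral_batch_le:
  fixes Y :: "'w \<Rightarrow> 'b::euclidean_space"
  assumes "prob_space M" and Y [measurable]: "Y \<in> borel_measurable M"
    and S: "(\<integral>\<^sup>+w. ennreal ((norm (Y w))\<^sup>2) \<partial>M) \<le> ennreal S" "S \<ge> 0" and b: "b \<ge> 1"
  shows "(\<integral>\<^sup>+s. ennreal ((norm (a + ((1 / real b) *\<^sub>R (\<Sum>i<b. Y (s i)) - (\<integral>w. Y w \<partial>M))))\<^sup>2) \<partial>PiM {..<b} (\<lambda>_. M))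
    \<le> ennreal ((norm a)\<^sup>2 + S / real b)"
proof -
  interpret M: prob_space M by fact
  define \<mu> where "\<mu> = (\<integral>w. Y w \<partial>M)"
  define step where "step n z w = z + (1 / real b) *\<^sub>R (Y w - \<mu>)" for n :: nat and z w
  have step: "(\<lambda>(z, w). step n z w) \<in> borel \<Otimes>\<^sub>M M \<rightarrow>\<^sub>M borel" for n
    unfolding step_def by measurable
  have drift: "(\<integral>\<^sup>+w. ennreal ((norm (step n z w))\<^sup>2) \<partial>M) + 0 \<le> ennreal ((norm z)\<^sup>2) + ennreal (S / (real b)\<^sup>2)" for n z
  proof -
    let ?Y = "\<lambda>w. (1 / real b) *\<^sub>R Y w"
    have "(\<integral>\<^sup>+w. ennreal ((norm (?Y w))\<^sup>2) \<partial>M) = ennreal (1 / (real b)\<^sup>2) * (\<integral>\<^sup>+w. ennreal ((norm (Y w))\<^sup>2) \<partial>M)"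
    proof -
      have "ennreal ((norm (?Y w))\<^sup>2) = ennreal (1 / (real b)\<^sup>2) * ennreal ((norm (Y w))\<^sup>2)" for w
      proof -
        have "(norm (?Y w))\<^sup>2 = 1 / (real b)\<^sup>2 * (norm (Y w))\<^sup>2" by (simp add: power_divide)
        then show ?thesis by (simp only: ennreal_mult[OF divide_nonneg_nonneg[OF zero_le_one zero_le_power2] zero_le_power2])
      qed
      then show ?thesis by (simp only:) (rule nn_integral_cmult, measurable)
    qed
    also have "\<dots> \<le> ennreal (1 / (real b)\<^sup>2) * ennreal S" by (intro mult_left_mono S(1)) auto
    also have "\<dots> = ennreal (1 / (real b)\<^sup>2 * S)" using S(2) by (intro ennreal_mult[symmetric]) auto
    finally have "(\<integral>\<^sup>+w. ennreal ((norm (?Y w))\<^sup>2) \<partial>M) \<le> ennreal (S / (real b)\<^sup>2)" by simp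
    moreover have "step n z w = z + (?Y w - (\<integral>w. ?Y w \<partial>M))" for w
      by (simp add: step_def \<mu>_def scaleR_diff_right)
    ultimately have "(\<integral>\<^sup>+w. ennreal ((norm (step n z w))\<^sup>2) \<partial>M) \<le> ennreal ((norm z)\<^sup>2 + S / (real b)\<^sup>2)"
      using M.nn_integral_centered_square_le[of ?Y "S / (real b)\<^sup>2" z] S(2) by simp
    then show ?thesis using S(2) by simp
  qed
  have chain: "chain step a s n = a + (1 / real b) *\<^sub>R (\<Sum>i<n. Y (s i) - \<mu>)" for s n
    by (induction n) (simp_all add: step_def scaleR_add_right)
  have "chain step a s b = a + ((1 / real b) *\<^sub>R (\<Sum>i<b. Y (s i)) - \<mu>)" for s
    using b unfolding chain by (simp add: sum_subtractf scaleR_diff_right sum_constant_scaleR)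
  moreover have "(\<integral>\<^sup>+s. ennreal ((norm (chain step a s b))\<^sup>2) \<partial>PiM {..<b} (\<lambda>_. M)) \<le> ennreal ((norm a)\<^sup>2) + (\<Sum>n<b. ennreal (S / (real b)\<^sup>2))"
    using chain_drift[of "\<lambda>_. M" step "\<lambda>_ z. ennreal ((norm z)\<^sup>2)" "\<lambda>_ _. 0" "\<lambda>_. ennreal (S / (real b)\<^sup>2)" b a]
      step drift M.prob_space_axioms by simp
  moreover have "ennreal ((norm a)\<^sup>2) + (\<Sum>n<b. ennreal (S / (real b)\<^sup>2)) = ennreal ((norm a)\<^sup>2 + S / real b)"
  proof -
    have "(\<Sum>n<b. ennreal (S / (real b)\<^sup>2)) = ennreal (\<Sum>n<b. S / (real b)\<^sup>2)"
      using S(2) by (intro sum_ennreal) auto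
    also have "(\<Sum>n<b. S / (real b)\<^sup>2) = S / real b" using b by (simp add: power2_eq_square)
    finally show ?thesis using S(2) by (simp add: ennreal_plus)
  qed
  ultimately show ?thesis by (simp add: \<mu>_def)
qed

text \<open>A Caratheodory function is the pointwise limit of its compositions with countably valued
  roundings of the first argument.\<close>

lemma measurable_caratheodory:
  fixes F :: "'a::euclidean_space \<Rightarrow> 'x \<Rightarrow> real"
  assumes meas: "\<And>x. F x \<in> borel_measurable M"
    and lip: "\<And>\<xi> x y. \<xi> \<in> space M \<Longrightarrow> \<bar>F x \<xi> - F y \<xi>\<bar> \<le> c \<xi> * norm (x - y)"
  shows "(\<lambda>(x, \<xi>). F x \<xi>) \<in> borel \<Otimes>\<^sub>M M \<rightarrow>\<^sub>M borel"
proof -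
  obtain q :: "nat \<Rightarrow> 'a" where q: "\<And>x e. e > 0 \<Longrightarrow> \<exists>i. dist x (q i) < e"
  proof -
    obtain D :: "'a set" where D: "countable D" "\<And>X. open X \<Longrightarrow> X \<noteq> {} \<Longrightarrow> \<exists>d\<in>D. d \<in> X"
      by (rule countable_dense_setE) blast
    have "D \<noteq> {}" using D(2)[of UNIV] by auto
    show thesis
    proof
      fix x :: 'a and e :: real assume "e > 0"
      then obtain d where d: "d \<in> D" "d \<in> ball x e" using D(2)[of "ball x e"] by auto
      then show "\<exists>i. dist x (from_nat_into D i) < e"
        using from_nat_into_to_nat_on[OF D(1) d(1)] by (intro exI[of _ "to_nat_on D d"]) simp
    qed
  qed
  define r where "r n x = (LEAST i. dist x (q i) < 1 / real (Suc n))" for n x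
  have r: "dist x (q (r n x)) < 1 / real (Suc n)" for n x
    unfolding r_def by (rule LeastI_ex) (rule q, simp)
  have r_meas: "r n \<in> borel \<rightarrow>\<^sub>M count_space UNIV" for n
    unfolding r_def by measurable
  have "(\<lambda>z. F (q (r n (fst z))) (snd z)) \<in> borel \<Otimes>\<^sub>M M \<rightarrow>\<^sub>M borel" for n
    by (rule measurable_compose_countable[where f="\<lambda>i z. F (q i) (snd z)" and g="\<lambda>z. r n (fst z)"])
      (auto intro: measurable_compose[OF measurable_snd meas] measurable_compose[OF measurable_fst r_meas])
  moreover have "(\<lambda>n. F (q (r n (fst z))) (snd z)) \<longlonglongrightarrow> F (fst z) (snd z)" if "z \<in> space (borel \<Otimes>\<^sub>M M)" for z
  proof -
    have \<xi>: "snd z \<in> space M" using that by (auto simp: space_pair_measure)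
    have le: "norm (F (q (r n (fst z))) (snd z) - F (fst z) (snd z)) \<le> \<bar>c (snd z)\<bar> * (1 / real (Suc n))" for n
    proof -
      have "norm (F (q (r n (fst z))) (snd z) - F (fst z) (snd z)) \<le> c (snd z) * norm (q (r n (fst z)) - fst z)"
        using lip[OF \<xi>] by simp
      also have "\<dots> \<le> \<bar>c (snd z)\<bar> * (1 / real (Suc n))"
        using r[of "fst z" n] by (intro mult_mono) (auto simp: dist_norm norm_minus_commute)
      finally show ?thesis .
    qed
    have "(\<lambda>n. \<bar>c (snd z)\<bar> * (1 / real (Suc n))) \<longlonglongrightarrow> \<bar>c (snd z)\<bar> * 0"
      by (intro tendsto_intros LIMSEQ_Suc[OF lim_1_over_n])
    then have "(\<lambda>n. F (q (r n (fst z))) (snd z) - F (fst z) (snd z)) \<longlonglongrightarrow> 0"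
      by (intro Lim_null_comparison[OF always_eventually[OF allI[OF le]]]) simp
    then show ?thesis by (simp add: LIM_zero_iff)
  qed
  ultimately have "(\<lambda>z. F (fst z) (snd z)) \<in> borel \<Otimes>\<^sub>M M \<rightarrow>\<^sub>M borel"
    by (rule borel_measurable_LIMSEQ_real[rotated])
  then show ?thesis by (simp add: split_beta)
qed

section \<open>The stochastic objective and its two-point estimator\<close>

locale stochastic_objective =
  fixes \<Xi> :: "'x measure" and F :: "'a::euclidean_space \<Rightarrow> 'x \<Rightarrow> real" and Lc :: "'x \<Rightarrow> real" and L :: real
  assumes msl: "mean_square_lipschitz \<Xi> F Lc L" and L_pos: "L > 0"
    and convex_objective: "convex_on UNIV (expected_objective \<Xi> F)"
begin

sublocale \<Xi>: prob_space \<Xi>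
  using msl by (simp add: mean_square_lipschitz_def)

lemma F_integrable: "integrable \<Xi> (F x)"
  and F_lip: "\<xi> \<in> space \<Xi> \<Longrightarrow> \<bar>F x \<xi> - F y \<xi>\<bar> \<le> Lc \<xi> * norm (x - y)"
  and Lc_square: "integrable \<Xi> (\<lambda>\<xi>. (Lc \<xi>)\<^sup>2)" "(\<integral>\<xi>. (Lc \<xi>)\<^sup>2 \<partial>\<Xi>) \<le> L\<^sup>2"
  using msl by (auto simp: mean_square_lipschitz_def)

lemma Lc_nonneg: "\<xi> \<in> space \<Xi> \<Longrightarrow> Lc \<xi> \<ge> 0"
proof -
  assume "\<xi> \<in> space \<Xi>"
  obtain b :: 'a where "b \<in> Basis" by (meson nonempty_Basis ex_in_conv)
  then show ?thesis using F_lip[OF \<open>\<xi> \<in> space \<Xi>\<close>, of b 0] by simp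
qed

text \<open>The hypotheses give measurability of the square only; \<open>Lc\<close> is its root,
  because the Lipschitz bound forces it to be nonnegative.\<close>

lemma Lc_measurable [measurable]: "Lc \<in> borel_measurable \<Xi>"
proof -
  have "(\<lambda>\<xi>. sqrt ((Lc \<xi>)\<^sup>2)) \<in> borel_measurable \<Xi>"
    using borel_measurable_integrable[OF Lc_square(1)] by measurable
  then show ?thesis by (rule measurable_cong[THEN iffD1, rotated]) (simp add: Lc_nonneg)
qed

lemma Lc_integrable: "integrable \<Xi> Lc" and Lc_mean: "(\<integral>\<xi>. Lc \<xi> \<partial>\<Xi>) \<le> L"
proof -
  \<comment> \<open>AM-GM weighted by \<open>L\<close> bounds the first moment by the
    second.\<close>
  have le: "Lc \<xi> \<le> (Lc \<xi>)\<^sup>2 / (2 * L) + L / 2" for \<xi>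
  proof -
    have "0 \<le> (Lc \<xi> - L)\<^sup>2 / (2 * L)" using L_pos by simp
    also have "\<dots> = (Lc \<xi>)\<^sup>2 / (2 * L) + L / 2 - Lc \<xi>"
      using L_pos by (simp add: power2_eq_square field_simps)
    finally show ?thesis by simp
  qed
  have int: "integrable \<Xi> (\<lambda>\<xi>. (Lc \<xi>)\<^sup>2 / (2 * L) + L / 2)" using Lc_square(1) by simp
  show Lc: "integrable \<Xi> Lc"
  proof (rule Bochner_Integration.integrable_bound[OF int])
    show "AE \<xi> in \<Xi>. norm (Lc \<xi>) \<le> norm ((Lc \<xi>)\<^sup>2 / (2 * L) + L / 2)"
    proof (rule AE_I2)
      fix \<xi> assume "\<xi> \<in> space \<Xi>"
      then have "norm (Lc \<xi>) = Lc \<xi>" by (simp add: Lc_nonneg)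
      also have "\<dots> \<le> \<bar>(Lc \<xi>)\<^sup>2 / (2 * L) + L / 2\<bar>" by (rule order_trans[OF le abs_ge_self])
      finally show "norm (Lc \<xi>) \<le> norm ((Lc \<xi>)\<^sup>2 / (2 * L) + L / 2)" by simp
    qed
  qed measurable
  have "(\<integral>\<xi>. Lc \<xi> \<partial>\<Xi>) \<le> (\<integral>\<xi>. (Lc \<xi>)\<^sup>2 / (2 * L) + L / 2 \<partial>\<Xi>)"
    by (intro integral_mono Lc int le)
  also have "\<dots> = (\<integral>\<xi>. (Lc \<xi>)\<^sup>2 \<partial>\<Xi>) / (2 * L) + L / 2"
    using Lc_square(1) \<Xi>.prob_space by simp
  also have "\<dots> \<le> L\<^sup>2 / (2 * L) + L / 2"
    using Lc_square(2) L_pos by (intro add_right_mono divide_right_mono) auto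
  also have "\<dots> = L" using L_pos by (simp add: power2_eq_square)
  finally show "(\<integral>\<xi>. Lc \<xi> \<partial>\<Xi>) \<le> L" .
qed

abbreviation f :: "'a \<Rightarrow> real" where "f \<equiv> expected_objective \<Xi> F"

sublocale lipschitz_convex f L
proof
  fix x y :: 'a
  have "\<bar>f x - f y\<bar> = \<bar>\<integral>\<xi>. F x \<xi> - F y \<xi> \<partial>\<Xi>\<bar>"
    by (simp add: expected_objective_def F_integrable)
  also have "\<dots> \<le> (\<integral>\<xi>. \<bar>F x \<xi> - F y \<xi>\<bar> \<partial>\<Xi>)" by (rule integral_abs_bound)
  also have "\<dots> \<le> (\<integral>\<xi>. Lc \<xi> * norm (x - y) \<partial>\<Xi>)"
    using F_integrable Lc_integrable F_lip by (intro integral_mono) auto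
  also have "\<dots> = (\<integral>\<xi>. Lc \<xi> \<partial>\<Xi>) * norm (x - y)" by simp
  also have "\<dots> \<le> L * norm (x - y)" by (intro mult_right_mono Lc_mean) simp
  finally show "\<bar>f x - f y\<bar> \<le> L * norm (x - y)" .
qed (rule convex_objective)

lemma F_measurable: "(\<lambda>(x, \<xi>). F x \<xi>) \<in> borel \<Otimes>\<^sub>M \<Xi> \<rightarrow>\<^sub>M borel"
  by (rule measurable_caratheodory[OF borel_measurable_integrable[OF F_integrable] F_lip])

abbreviation samples :: "('x \<times> 'a) measure" where "samples \<equiv> sample_law \<Xi>"

lemma sets_samples [measurable_cong]: "sets samples = sets (\<Xi> \<Otimes>\<^sub>M borel)"
  unfolding sample_law_def by (intro sets_pair_measure_cong) auto

lemma space_samples: "space samples = space \<Xi> \<times> UNIV"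
  by (simp add: sample_law_def space_pair_measure)

sublocale S: prob_space "uniform_sphere :: 'a measure"
  by (rule prob_space_uniform_sphere)

lemma prob_space_samples: "prob_space samples"
  unfolding sample_law_def by (intro prob_space_pair \<Xi>.prob_space_axioms S.prob_space_axioms)

lemma AE_samples_norm: "AE z in samples. norm (snd z) \<le> 1"
  unfolding sample_law_def
proof (rule pair_sigma_finite.AE_pair_measure)
  show "pair_sigma_finite \<Xi> (uniform_sphere :: 'a measure)"
    by (intro pair_sigma_finite.intro \<Xi>.sigma_finite_measure_axioms S.sigma_finite_measure_axioms)
  show "{z \<in> space (\<Xi> \<Otimes>\<^sub>M (uniform_sphere :: 'a measure)). norm (snd z) \<le> 1} \<in> sets (\<Xi> \<Otimes>\<^sub>M uniform_sphere)"
  proof -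
    have "{z \<in> space (\<Xi> \<Otimes>\<^sub>M (uniform_sphere :: 'a measure)). norm (snd z) \<le> 1} = space \<Xi> \<times> cball 0 1"
      by (auto simp: space_pair_measure)
    moreover have "cball 0 1 \<in> sets (uniform_sphere :: 'a measure)" by simp
    ultimately show ?thesis using pair_measureI[OF sets.top[of \<Xi>]] by (simp only:)
  qed
  have "AE w in (uniform_sphere :: 'a measure). norm (snd (\<xi>, w)) \<le> 1" for \<xi> :: 'x
    unfolding snd_conv by (rule AE_uniform_sphere_norm)
  then show "AE \<xi> in \<Xi>. AE w in (uniform_sphere :: 'a measure). norm (snd (\<xi>, w)) \<le> 1"
    by (rule AE_I2)
qed

lemma measurable_samples_fst: "fst \<in> samples \<rightarrow>\<^sub>M \<Xi>"
  and measurable_samples_snd: "snd \<in> samples \<rightarrow>\<^sub>M borel"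
proof -
  show "fst \<in> samples \<rightarrow>\<^sub>M \<Xi>" unfolding sample_law_def by (rule measurable_fst)
  have "snd \<in> samples \<rightarrow>\<^sub>M (uniform_sphere :: 'a measure)" unfolding sample_law_def by (rule measurable_snd)
  then show "snd \<in> samples \<rightarrow>\<^sub>M borel" 
    unfolding measurable_cong_sets[OF refl sets_uniform_sphere] .
qed

lemma grad_est_measurable:
  "(\<lambda>(x, z). grad_est F \<rho> x z) \<in> borel \<Otimes>\<^sub>M samples \<rightarrow>\<^sub>M borel"
proof -
  have w: "(\<lambda>p. snd (snd p)) \<in> borel \<Otimes>\<^sub>M samples \<rightarrow>\<^sub>M borel"
    by (rule measurable_compose[OF measurable_snd measurable_samples_snd])
  have F': "(\<lambda>p. F (fst p + c *\<^sub>R snd (snd p)) (fst (snd p))) \<in> borel \<Otimes>\<^sub>M samples \<rightarrow>\<^sub>M borel" for c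
  proof -
    have "(\<lambda>p. (fst p + c *\<^sub>R snd (snd p), fst (snd p))) \<in> borel \<Otimes>\<^sub>M samples \<rightarrow>\<^sub>M borel \<Otimes>\<^sub>M \<Xi>"
      by (intro measurable_Pair borel_measurable_add borel_measurable_scaleR borel_measurable_const measurable_fst w
          measurable_compose[OF measurable_snd measurable_samples_fst])
    from measurable_compose[OF this F_measurable] show ?thesis by (simp only: split_conv)
  qed
  have "(\<lambda>(x, z). grad_est F \<rho> x z) = (\<lambda>p. (real DIM('a) / (2 * \<rho>) * (F (fst p + \<rho> *\<^sub>R snd (snd p)) (fst (snd p))
      - F (fst p + (- \<rho>) *\<^sub>R snd (snd p)) (fst (snd p)))) *\<^sub>R snd (snd p))"
    by (simp add: fun_eq_iff grad_est_def split_beta)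
  then show ?thesis
    by (rule ssubst) (intro borel_measurable_scaleR borel_measurable_times borel_measurable_diff borel_measurable_const F' w)
qed

lemma grad_est_measurable_sample [measurable]: "grad_est F \<rho> x \<in> borel_measurable samples"
proof -
  have "Pair x \<in> samples \<rightarrow>\<^sub>M borel \<Otimes>\<^sub>M samples" by (rule measurable_Pair1') simp
  from measurable_compose[OF this grad_est_measurable[of \<rho>]] show ?thesis by (simp only: split_conv)
qed

text \<open>The factor \<open>d\<close> instead of \<open>d ^ 2\<close> comes from the Poincare inequality on the sphere.\<close>

lemma grad_est_second_moment:
  assumes \<rho>: "\<rho> > 0"
  shows "(\<integral>\<^sup>+z. ennreal ((norm (grad_est F \<rho> x z))\<^sup>2) \<partial>samples) \<le> ennreal (36 * real DIM('a) * L\<^sup>2)"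
proof -
  let ?d = "real DIM('a)"
  have inner: "(\<integral>\<^sup>+w. ennreal ((norm (grad_est F \<rho> x (\<xi>, w)))\<^sup>2) \<partial>uniform_sphere) \<le> ennreal (36 * ?d * (Lc \<xi>)\<^sup>2)"
    if \<xi>: "\<xi> \<in> space \<Xi>" for \<xi>
  proof -
    define h where "h w = F (x + \<rho> *\<^sub>R w) \<xi> - F (x - \<rho> *\<^sub>R w) \<xi>" for w
    have odd: "h (- w) = - h w" for w by (simp add: h_def)
    have lip: "\<bar>h v - h w\<bar> \<le> (2 * \<rho> * Lc \<xi>) * norm (v - w)" for v w
      using F_lip[OF \<xi>, of "x + \<rho> *\<^sub>R v" "x + \<rho> *\<^sub>R w"] F_lip[OF \<xi>, of "x - \<rho> *\<^sub>R w" "x - \<rho> *\<^sub>R v"] \<rho>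
      by (simp add: h_def mult_ac flip: scaleR_diff_right)
    have Lc0: "0 \<le> 2 * \<rho> * Lc \<xi>" using \<rho> Lc_nonneg[OF \<xi>] by simp
    have "(2 * \<rho> * Lc \<xi>)-lipschitz_on UNIV h"
      using lip Lc0 by (auto simp: lipschitz_on_def dist_norm dist_real_def)
    then have [measurable]: "h \<in> borel_measurable borel"
      by (intro borel_measurable_continuous_onI lipschitz_on_continuous_on)
    have "(\<integral>\<^sup>+w. ennreal ((norm (grad_est F \<rho> x (\<xi>, w)))\<^sup>2) \<partial>uniform_sphere)
        \<le> (\<integral>\<^sup>+w. ennreal ((?d / (2 * \<rho>))\<^sup>2) * ennreal ((h w)\<^sup>2) \<partial>uniform_sphere)"
    proof (rule nn_integral_mono_AE)
      show "AE w in uniform_sphere. ennreal ((norm (grad_est F \<rho> x (\<xi>, w)))\<^sup>2) \<le> ennreal ((?d / (2 * \<rho>))\<^sup>2) * ennreal ((h w)\<^sup>2)"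
        using AE_uniform_sphere_norm
      proof eventually_elim
        case (elim w)
        have "norm (grad_est F \<rho> x (\<xi>, w)) = \<bar>?d / (2 * \<rho>) * h w\<bar> * norm w"
          by (simp add: grad_est_def h_def)
        also have "\<dots> \<le> \<bar>?d / (2 * \<rho>) * h w\<bar> * 1" using elim by (intro mult_left_mono) auto
        finally have "(norm (grad_est F \<rho> x (\<xi>, w)))\<^sup>2 \<le> \<bar>?d / (2 * \<rho>) * h w\<bar>\<^sup>2"
          by (intro power_mono) auto
        also have "\<dots> = (?d / (2 * \<rho>))\<^sup>2 * (h w)\<^sup>2" by (simp only: power2_abs power_mult_distrib)
        finally show ?case by (simp only: ennreal_mult[OF zero_le_power2 zero_le_power2, symmetric] ennreal_leI)
      qed
    qed
    also have "\<dots> = ennreal ((?d / (2 * \<rho>))\<^sup>2) * (\<integral>\<^sup>+w. ennreal ((h w)\<^sup>2) \<partial>uniform_sphere)"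
      by (rule nn_integral_cmult) measurable
    also have "\<dots> \<le> ennreal ((?d / (2 * \<rho>))\<^sup>2) * ennreal (36 * (2 * \<rho> * Lc \<xi>)\<^sup>2 / ?d)"
      by (intro mult_left_mono sphere_odd_moment_le odd lip Lc0) auto
    also have "\<dots> = ennreal ((?d / (2 * \<rho>))\<^sup>2 * (36 * (2 * \<rho> * Lc \<xi>)\<^sup>2 / ?d))"
      by (intro ennreal_mult[symmetric]) auto
    also have "(?d / (2 * \<rho>))\<^sup>2 * (36 * (2 * \<rho> * Lc \<xi>)\<^sup>2 / ?d) = 36 * ?d * (Lc \<xi>)\<^sup>2"
      using \<rho> by (simp add: power2_eq_square)
    finally show ?thesis .
  qed
  have "(\<integral>\<^sup>+z. ennreal ((norm (grad_est F \<rho> x z))\<^sup>2) \<partial>samples)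
      = (\<integral>\<^sup>+\<xi>. \<integral>\<^sup>+w. ennreal ((norm (grad_est F \<rho> x (\<xi>, w)))\<^sup>2) \<partial>uniform_sphere \<partial>\<Xi>)"
    using grad_est_measurable_sample[of \<rho> x] unfolding sample_law_def
    by (subst S.nn_integral_fst[symmetric]) auto
  also have "\<dots> \<le> (\<integral>\<^sup>+\<xi>. ennreal (36 * ?d * (Lc \<xi>)\<^sup>2) \<partial>\<Xi>)"
    by (intro nn_integral_mono inner)
  also have "\<dots> = ennreal (\<integral>\<xi>. 36 * ?d * (Lc \<xi>)\<^sup>2 \<partial>\<Xi>)"
    using Lc_square(1) by (intro nn_integral_eq_integral) auto
  also have "\<dots> \<le> ennreal (36 * ?d * L\<^sup>2)"
    using Lc_square by (intro ennreal_leI) (simp add: mult_left_mono)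
  finally show ?thesis .
qed

text \<open>The same sample is used at both points, so Lipschitz continuity of each component
  applies pathwise. The bound is pathwise in the direction as well, hence the full square of the
  dimension.\<close>

lemma grad_est_diff_second_moment:
  assumes \<rho>: "\<rho> > 0"
  shows "(\<integral>\<^sup>+z. ennreal ((norm (grad_est F \<rho> x z - grad_est F \<rho> y z))\<^sup>2) \<partial>samples)
    \<le> ennreal ((real DIM('a) * L / \<rho>)\<^sup>2 * (norm (x - y))\<^sup>2)"
proof -
  let ?d = "real DIM('a)" and ?c = "(real DIM('a) / \<rho>)\<^sup>2 * (norm (x - y))\<^sup>2"
  have pt: "(norm (grad_est F \<rho> x z - grad_est F \<rho> y z))\<^sup>2 \<le> ?c * (Lc (fst z))\<^sup>2"
    if "norm (snd z) \<le> 1" "z \<in> space samples" for z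
  proof -
    obtain \<xi> w where z: "z = (\<xi>, w)" by (cases z)
    have \<xi>: "\<xi> \<in> space \<Xi>" and w: "norm w \<le> 1" using that by (auto simp: z space_samples)
    define D where "D = (F (x + \<rho> *\<^sub>R w) \<xi> - F (y + \<rho> *\<^sub>R w) \<xi>) - (F (x - \<rho> *\<^sub>R w) \<xi> - F (y - \<rho> *\<^sub>R w) \<xi>)"
    have "\<bar>D\<bar> \<le> 2 * (Lc \<xi> * norm (x - y))"
      using F_lip[OF \<xi>, of "x + \<rho> *\<^sub>R w" "y + \<rho> *\<^sub>R w"] F_lip[OF \<xi>, of "x - \<rho> *\<^sub>R w" "y - \<rho> *\<^sub>R w"]
      by (simp add: D_def abs_le_iff)
    then have "?d / (2 * \<rho>) * \<bar>D\<bar> \<le> ?d / (2 * \<rho>) * (2 * (Lc \<xi> * norm (x - y)))"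
      using \<rho> by (intro mult_left_mono) auto
    moreover have "norm (grad_est F \<rho> x z - grad_est F \<rho> y z) = ?d / (2 * \<rho>) * \<bar>D\<bar> * norm w"
    proof -
      have "grad_est F \<rho> x z - grad_est F \<rho> y z = (?d / (2 * \<rho>) * D) *\<^sub>R w"
        by (simp add: grad_est_def z D_def right_diff_distrib flip: scaleR_diff_left)
      then show ?thesis using \<rho> by (simp add: abs_mult)
    qed
    moreover have "?d / (2 * \<rho>) * \<bar>D\<bar> * norm w \<le> ?d / (2 * \<rho>) * \<bar>D\<bar> * 1"
      using w \<rho> by (intro mult_left_mono) auto
    ultimately have "norm (grad_est F \<rho> x z - grad_est F \<rho> y z) \<le> ?d / \<rho> * norm (x - y) * Lc \<xi>"
      by (simp add: mult_ac)
    then have "(norm (grad_est F \<rho> x z - grad_est F \<rho> y z))\<^sup>2 \<le> (?d / \<rho> * norm (x - y) * Lc \<xi>)\<^sup>2"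
      by (intro power_mono) auto
    then show ?thesis by (simp only: power_mult_distrib z fst_conv)
  qed
  have "(\<integral>\<^sup>+z. ennreal ((norm (grad_est F \<rho> x z - grad_est F \<rho> y z))\<^sup>2) \<partial>samples)
      \<le> (\<integral>\<^sup>+z. ennreal (?c * (Lc (fst z))\<^sup>2) \<partial>samples)"
  proof (rule nn_integral_mono_AE)
    show "AE z in samples. ennreal ((norm (grad_est F \<rho> x z - grad_est F \<rho> y z))\<^sup>2) \<le> ennreal (?c * (Lc (fst z))\<^sup>2)"
      using AE_samples_norm AE_space by eventually_elim (intro ennreal_leI pt)
  qed
  also have "\<dots> = (\<integral>\<^sup>+\<xi>. \<integral>\<^sup>+w. ennreal (?c * (Lc \<xi>)\<^sup>2) \<partial>(uniform_sphere :: 'a measure) \<partial>\<Xi>)"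
    unfolding sample_law_def by (subst S.nn_integral_fst[symmetric]) auto
  also have "\<dots> = (\<integral>\<^sup>+\<xi>. ennreal (?c * (Lc \<xi>)\<^sup>2) \<partial>\<Xi>)"
    using S.emeasure_space_1 by simp
  also have "\<dots> = ennreal (\<integral>\<xi>. ?c * (Lc \<xi>)\<^sup>2 \<partial>\<Xi>)"
    using Lc_square(1) by (intro nn_integral_eq_integral) auto
  also have "\<dots> = ennreal (?c * (\<integral>\<xi>. (Lc \<xi>)\<^sup>2 \<partial>\<Xi>))" by simp
  also have "\<dots> \<le> ennreal (?c * L\<^sup>2)"
    using Lc_square by (intro ennreal_leI mult_left_mono) auto
  also have "?c * L\<^sup>2 = (?d * L / \<rho>)\<^sup>2 * (norm (x - y))\<^sup>2"
    by (simp add: power_mult_distrib power_divide)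
  finally show ?thesis .
qed

lemma integrable_grad_est: "\<rho> > 0 \<Longrightarrow> integrable samples (grad_est F \<rho> x)"
  by (rule prob_space.integrable_of_square(1)[OF prob_space_samples _ grad_est_second_moment]) measurable

text \<open>Fubini with \<open>\<xi>\<close> innermost turns \<open>F\<close> into its mean
  \<open>f\<close>.\<close>

lemma grad_est_mean:
  assumes \<rho>: "\<rho> > 0"
  shows "(\<integral>z. grad_est F \<rho> x z \<partial>samples) = smoothing_grad \<rho> x"
proof -
  have int: "integrable (\<Xi> \<Otimes>\<^sub>M uniform_sphere) (\<lambda>(\<xi>, w). grad_est F \<rho> x (\<xi>, w))"
    using integrable_grad_est[OF \<rho>, of x] by (simp add: sample_law_def)
  interpret \<Xi>S: pair_sigma_finite \<Xi> "uniform_sphere :: 'a measure"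
    by (intro pair_sigma_finite.intro \<Xi>.sigma_finite_measure_axioms S.sigma_finite_measure_axioms)
  have "(\<integral>z. grad_est F \<rho> x z \<partial>samples) = (\<integral>w. \<integral>\<xi>. grad_est F \<rho> x (\<xi>, w) \<partial>\<Xi> \<partial>uniform_sphere)"
    using \<Xi>S.integral_snd[OF int] by (simp add: sample_law_def)
  also have "\<dots> = smoothing_grad \<rho> x"
    unfolding smoothing_grad_def
  proof (rule Bochner_Integration.integral_cong)
    fix w :: 'a
    have "(\<integral>\<xi>. grad_est F \<rho> x (\<xi>, w) \<partial>\<Xi>)
        = (\<integral>\<xi>. real DIM('a) / (2 * \<rho>) * (F (x + \<rho> *\<^sub>R w) \<xi> - F (x - \<rho> *\<^sub>R w) \<xi>) \<partial>\<Xi>) *\<^sub>R w"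
      unfolding grad_est_def split_conv
      by (rule integral_scaleR_left) (use F_integrable in auto)
    also have "\<dots> = (real DIM('a) / (2 * \<rho>) * (f (x + \<rho> *\<^sub>R w) - f (x - \<rho> *\<^sub>R w))) *\<^sub>R w"
      by (simp add: expected_objective_def F_integrable)
    finally show "(\<integral>\<xi>. grad_est F \<rho> x (\<xi>, w) \<partial>\<Xi>)
        = (real DIM('a) / (2 * \<rho>) * (f (x + \<rho> *\<^sub>R w) - f (x - \<rho> *\<^sub>R w))) *\<^sub>R w" .
  qed simp
  finally show ?thesis .
qed

text \<open>The norm of a mean is at most the root mean square, applied to the difference of the two
  coupled estimators.\<close>

lemma smoothing_grad_lipschitz:
  assumes \<rho>: "\<rho> > 0"
  shows "norm (smoothing_grad \<rho> x - smoothing_grad \<rho> y) \<le> real DIM('a) * L / \<rho> * norm (x - y)"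
proof -
  interpret Z: prob_space samples by (rule prob_space_samples)
  let ?Y = "\<lambda>z. grad_est F \<rho> x z - grad_est F \<rho> y z" and ?S = "(real DIM('a) * L / \<rho>)\<^sup>2 * (norm (x - y))\<^sup>2"
  have mean: "Z.expectation ?Y = smoothing_grad \<rho> x - smoothing_grad \<rho> y"
    using integrable_grad_est[OF \<rho>] by (simp add: grad_est_mean[OF \<rho>])
  have "(norm (Z.expectation ?Y))\<^sup>2 \<le> (real DIM('a) * L / \<rho> * norm (x - y))\<^sup>2"
    unfolding power_mult_distrib[of _ "norm (x - y)"]
    by (intro Z.norm_expectation_square_le grad_est_diff_second_moment \<rho>) auto
  then show ?thesis
    unfolding mean by (rule power2_le_imp_le) (use \<rho> L_pos in auto)
qed

end

section \<open>Convergence of the two phases\<close>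

lemma sum_block_starts:
  fixes B :: "'a::comm_semiring_1"
  assumes m: "m \<ge> 1"
  shows "(\<Sum>n<m * k. if n mod m = 0 then B else 0) = of_nat k * B"
proof -
  have "(\<Sum>n\<in>{i * m..<i * m + m}. if n mod m = 0 then B else 0) = B" for i
  proof -
    have "(\<Sum>n\<in>{i * m..<i * m + m}. if n mod m = 0 then B else 0)
        = (\<Sum>n\<in>{i * m..<i * m + m}. if n = i * m then B else 0)"
    proof (rule sum.cong)
      fix n assume n: "n \<in> {i * m..<i * m + m}"
      then have "n = i * m + (n - i * m)" "n - i * m < m" by auto
      then have "n mod m = n - i * m" by (metis mod_less mod_mult_self3)
      then show "(if n mod m = 0 then B else 0) = (if n = i * m then B else 0)" using n by auto
    qed simp
    also have "\<dots> = B" using m by (subst sum.delta) auto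
    finally show ?thesis .
  qed
  then have "(\<Sum>i<k. \<Sum>n\<in>{i * m..<i * m + m}. if n mod m = 0 then B else 0) = of_nat k * B"
    by simp
  then show ?thesis
    unfolding sum.nat_group by (simp only: mult.commute)
qed

lemma ennreal_add_le:
  assumes "a + b \<le> c + d" and "0 \<le> a" "0 \<le> b" "0 \<le> c" "0 \<le> d"
  shows "ennreal a + ennreal b \<le> ennreal c + ennreal d"
proof -
  have "ennreal (a + b) \<le> ennreal (c + d)" by (rule ennreal_leI) fact
  then show ?thesis using assms(2-) by (simp only: ennreal_plus)
qed

lemma norm_add_square: "(norm (a + b))\<^sup>2 = (norm a)\<^sup>2 + 2 * (a \<bullet> b) + (norm b)\<^sup>2"
  for a b :: "'a::real_inner"
  by (simp add: power2_norm_eq_inner inner_simps inner_commute)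

lemma nn_integral_batch_potential_le:
  fixes Y :: "'w \<Rightarrow> 'b::euclidean_space"
  assumes M: "prob_space M" and Y [measurable]: "Y \<in> borel_measurable M"
    and S: "(\<integral>\<^sup>+w. ennreal ((norm (Y w))\<^sup>2) \<partial>M) \<le> ennreal S" "S \<ge> 0" and b: "b \<ge> 1"
    and K: "K \<ge> 0" and r: "r \<ge> 0"
  shows "(\<integral>\<^sup>+s. ennreal (K + r * (norm (a + ((1 / real b) *\<^sub>R (\<Sum>i<b. Y (s i)) - (\<integral>w. Y w \<partial>M))))\<^sup>2) \<partial>PiM {..<b} (\<lambda>_. M))
    \<le> ennreal (K + r * ((norm a)\<^sup>2 + S / real b))"
proof -
  interpret P: prob_space "PiM {..<b} (\<lambda>_. M)" by (intro prob_space_PiM M)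
  let ?N = "\<lambda>s. norm (a + ((1 / real b) *\<^sub>R (\<Sum>i<b. Y (s i)) - (\<integral>w. Y w \<partial>M)))"
  have meas: "(\<lambda>s. ennreal ((?N s)\<^sup>2)) \<in> borel_measurable (PiM {..<b} (\<lambda>_. M))" by measurable
  have "(\<integral>\<^sup>+s. ennreal (K + r * (?N s)\<^sup>2) \<partial>PiM {..<b} (\<lambda>_. M))
      = (\<integral>\<^sup>+s. ennreal K + ennreal r * ennreal ((?N s)\<^sup>2) \<partial>PiM {..<b} (\<lambda>_. M))"
    using K r by (intro nn_integral_cong) (simp add: ennreal_plus ennreal_mult)
  also have "\<dots> = ennreal K + ennreal r * (\<integral>\<^sup>+s. ennreal ((?N s)\<^sup>2) \<partial>PiM {..<b} (\<lambda>_. M))"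
    using meas by (subst nn_integral_add) (auto simp: nn_integral_cmult P.emeasure_space_1)
  also have "\<dots> \<le> ennreal K + ennreal r * ennreal ((norm a)\<^sup>2 + S / real b)"
    by (intro add_left_mono mult_left_mono nn_integral_batch_le M Y S b) auto
  also have "\<dots> = ennreal (K + r * ((norm a)\<^sup>2 + S / real b))"
    using K r S(2) by (simp add: ennreal_plus ennreal_mult)
  finally show ?thesis .
qed

section \<open>First phase: the gap of stochastic subgradient descent\<close>

context stochastic_objective
begin

lemma gfm_iterate_eq_chain:
  "gfm_iterate F \<rho> \<eta> x0 s t = chain (\<lambda>_ x z. x - \<eta> *\<^sub>R grad_est F \<rho> x z) x0 s t"
  by (induction t) simp_all

lemma gfm_step_measurable:
  "(\<lambda>(x, z). x - \<eta> *\<^sub>R grad_est F \<rho> x z) \<in> borel \<Otimes>\<^sub>M samples \<rightarrow>\<^sub>M borel"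
proof -
  have "(\<lambda>(x, z). x - \<eta> *\<^sub>R grad_est F \<rho> x z) = (\<lambda>p. fst p - \<eta> *\<^sub>R (case p of (x, z) \<Rightarrow> grad_est F \<rho> x z))"
    by (simp add: fun_eq_iff split_beta)
  then show ?thesis
    by (rule ssubst) (intro borel_measurable_diff measurable_fst borel_measurable_scaleR borel_measurable_const grad_est_measurable)
qed

lemma ennreal_average_le:
  assumes "A \<le> ennreal a + of_nat T * ennreal \<beta>" and "a \<ge> 0" "\<beta> \<ge> 0" "T \<ge> 1"
  shows "A / of_nat T \<le> ennreal (a / real T + \<beta>)"
proof -
  have "A \<le> ennreal (a + real T * \<beta>)"
    using assms by (simp add: ennreal_of_nat_eq_real_of_nat ennreal_plus ennreal_mult)
  then have "A / of_nat T \<le> ennreal (a + real T * \<beta>) / ennreal (real T)"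
    by (simp only: ennreal_of_nat_eq_real_of_nat divide_right_mono_ennreal)
  also have "\<dots> = ennreal ((a + real T * \<beta>) / real T)" using assms by (intro divide_ennreal) auto
  also have "(a + real T * \<beta>) / real T = a / real T + \<beta>" using assms(4) by (simp add: add_divide_distrib)
  finally show ?thesis .
qed

text \<open>The classical Lyapunov function is the squared distance to \<open>xs\<close> divided by
  \<open>2 * \<eta>\<close>. Half of the second moment 36 gives the 18, and
  \<open>\<rho> * L\<close> is the bias of smoothing at \<open>xs\<close>; at the iterates smoothing
  only increases \<open>f\<close>.\<close>

lemma gfm_gap:
  assumes \<rho>: "\<rho> > 0" and \<eta>: "\<eta> > 0" and T: "T \<ge> 1" and xs: "\<And>y. f xs \<le> f y"
  shows "(\<integral>\<^sup>+x. ennreal (f x - f xs) \<partial>gfm \<Xi> F \<rho> \<eta> T x0)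
    \<le> ennreal ((norm (x0 - xs))\<^sup>2 / (2 * \<eta>) / real T + (18 * real DIM('a) * L\<^sup>2 * \<eta> + \<rho> * L))"
proof -
  interpret Z: prob_space samples by (rule prob_space_samples)
  let ?S = "36 * real DIM('a) * L\<^sup>2" and ?step = "\<lambda>(_::nat) x z. x - \<eta> *\<^sub>R grad_est F \<rho> x z"
  \<comment> \<open>In this scaling a step adds the bare estimator to the vector inside the norm,
    which matches the form of \<open>nn_integral_norm_add_square_le\<close>.\<close>
  define V where "V x = ennreal (\<eta> / 2) * ennreal ((norm ((1 / \<eta>) *\<^sub>R (xs - x)))\<^sup>2)" for x
  define c where "c x = ennreal (f x - f xs)" for x
  define \<beta> where "\<beta> = 18 * real DIM('a) * L\<^sup>2 * \<eta> + \<rho> * L"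
  have \<beta>: "\<beta> \<ge> 0" using \<rho> \<eta> L_pos by (simp add: \<beta>_def)
  have V_eq: "V x = ennreal ((norm (x - xs))\<^sup>2 / (2 * \<eta>))" for x
  proof -
    have "(norm ((1 / \<eta>) *\<^sub>R (xs - x)))\<^sup>2 = (norm (x - xs))\<^sup>2 / \<eta>\<^sup>2"
      using \<eta> by (simp add: power_divide norm_minus_commute)
    then show ?thesis unfolding V_def using \<eta> by (simp add: power2_eq_square flip: ennreal_mult')
  qed
  have [measurable]: "V \<in> borel_measurable borel" "c \<in> borel_measurable borel"
    unfolding V_def c_def by measurable
  have drift: "(\<integral>\<^sup>+z. V (?step n x z) \<partial>samples) + c x \<le> V x + ennreal \<beta>" for n :: nat and x
  proof -
    let ?a = "(1 / \<eta>) *\<^sub>R (xs - x)" and ?G = "smoothing_grad \<rho> x"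
    let ?B = "(norm ?a)\<^sup>2 + 2 * (?a \<bullet> ?G) + ?S"
    have "(\<integral>\<^sup>+z. V (?step n x z) \<partial>samples) = (\<integral>\<^sup>+z. ennreal (\<eta> / 2) * ennreal ((norm (?a + grad_est F \<rho> x z))\<^sup>2) \<partial>samples)"
    proof (intro nn_integral_cong)
      fix z
      have "(1 / \<eta>) *\<^sub>R (xs - ?step n x z) = ?a + grad_est F \<rho> x z"
        using \<eta> by (simp add: algebra_simps)
      then show "V (?step n x z) = ennreal (\<eta> / 2) * ennreal ((norm (?a + grad_est F \<rho> x z))\<^sup>2)"
        by (simp only: V_def)
    qed
    also have "\<dots> = ennreal (\<eta> / 2) * (\<integral>\<^sup>+z. ennreal ((norm (?a + grad_est F \<rho> x z))\<^sup>2) \<partial>samples)"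
      by (rule nn_integral_cmult) measurable
    also have "\<dots> \<le> ennreal (\<eta> / 2) * ennreal ?B"
      using Z.nn_integral_norm_add_square_le[OF grad_est_measurable_sample grad_est_second_moment[OF \<rho>, of x], of ?a]
      by (intro mult_left_mono) (auto simp: grad_est_mean[OF \<rho>])
    also have "\<dots> = ennreal (\<eta> / 2 * ?B)" using \<eta> by (intro ennreal_mult'[symmetric]) simp
    finally have 1: "(\<integral>\<^sup>+z. V (?step n x z) \<partial>samples) \<le> ennreal (\<eta> / 2 * ?B)" .
    \<comment> \<open>\<open>ennreal\<close> sums split only for nonnegative terms.
      \<open>?B\<close> dominates the square of \<open>?a + ?G\<close>, because the mean obeys the
      same second moment bound.\<close>
    have "0 \<le> ?B"
    proof -
      have "0 \<le> (norm (?a + ?G))\<^sup>2" by simp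
      also have "\<dots> = (norm ?a)\<^sup>2 + 2 * (?a \<bullet> ?G) + (norm ?G)\<^sup>2" by (rule norm_add_square)
      also have "(norm ?G)\<^sup>2 \<le> ?S"
        using Z.norm_expectation_square_le[OF grad_est_measurable_sample grad_est_second_moment[OF \<rho>, of x]]
        by (simp add: grad_est_mean[OF \<rho>])
      finally show ?thesis by simp
    qed
    then have B0: "0 \<le> \<eta> / 2 * ?B" using \<eta> by simp
    have "\<eta> / 2 * ?B = (norm (x - xs))\<^sup>2 / (2 * \<eta>) + (xs - x) \<bullet> ?G + 18 * real DIM('a) * L\<^sup>2 * \<eta>"
    proof -
      have "(norm ?a)\<^sup>2 = (norm (x - xs))\<^sup>2 / \<eta>\<^sup>2"
        by (simp add: power_divide norm_minus_commute)
      moreover have "?a \<bullet> ?G = ((xs - x) \<bullet> ?G) / \<eta>" by simp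
      ultimately show ?thesis using \<eta> by (simp only:) (simp add: power2_eq_square field_simps)
    qed
    moreover have "(xs - x) \<bullet> ?G \<le> f xs + \<rho> * L - f x"
      using smoothing_subgradient[OF \<rho>, of x xs] smoothing_ge[of \<rho> x] smoothing_le[of \<rho> xs] \<rho>
      by (simp add: inner_commute)
    ultimately have "\<eta> / 2 * ?B + (f x - f xs) \<le> (norm (x - xs))\<^sup>2 / (2 * \<eta>) + \<beta>"
      unfolding \<beta>_def by linarith
    then have "ennreal (\<eta> / 2 * ?B) + c x \<le> V x + ennreal \<beta>"
      unfolding V_eq c_def by (rule ennreal_add_le) (use B0 \<eta> \<beta> xs[of x] in simp_all)
    then show ?thesis by (rule order_trans[OF add_right_mono[OF 1]])
  qed
  have "(\<Sum>t<T. \<integral>\<^sup>+s. c (gfm_iterate F \<rho> \<eta> x0 s t) \<partial>PiM {..<T} (\<lambda>_. samples))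
      \<le> (\<integral>\<^sup>+s. V (chain ?step x0 s T) \<partial>PiM {..<T} (\<lambda>_. samples))
        + (\<Sum>t<T. \<integral>\<^sup>+s. c (chain ?step x0 s t) \<partial>PiM {..<T} (\<lambda>_. samples))"
    unfolding gfm_iterate_eq_chain by (simp add: add_increasing)
  also have "\<dots> \<le> V x0 + (\<Sum>n<T. ennreal \<beta>)"
    by (rule chain_drift[where V="\<lambda>_. V" and c="\<lambda>_. c"])
      (rule prob_space_samples gfm_step_measurable \<open>V \<in> _\<close> \<open>c \<in> _\<close> drift)+
  also have "\<dots> = ennreal ((norm (x0 - xs))\<^sup>2 / (2 * \<eta>)) + of_nat T * ennreal \<beta>"
    by (simp add: V_eq)
  finally have sum: "(\<Sum>t<T. \<integral>\<^sup>+s. c (gfm_iterate F \<rho> \<eta> x0 s t) \<partial>PiM {..<T} (\<lambda>_. samples)) / of_nat T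
      \<le> ennreal ((norm (x0 - xs))\<^sup>2 / (2 * \<eta>) / real T + \<beta>)"
    by (rule ennreal_average_le) (use \<eta> \<beta> T in auto)
  have "(\<integral>\<^sup>+x. c x \<partial>gfm \<Xi> F \<rho> \<eta> T x0) \<le> (\<Sum>t<T. \<integral>\<^sup>+s. c (gfm_iterate F \<rho> \<eta> x0 s t) \<partial>PiM {..<T} (\<lambda>_. samples)) / of_nat T"
    unfolding gfm_def
  proof (rule nn_integral_uniform_output_le[OF T])
    show "prob_space (PiM {..<T} (\<lambda>_. samples))" by (intro prob_space_PiM prob_space_samples)
    show "(\<lambda>s. gfm_iterate F \<rho> \<eta> x0 s t) \<in> PiM {..<T} (\<lambda>_. samples) \<rightarrow>\<^sub>M borel" if "t < T" for t
      unfolding gfm_iterate_eq_chain using that by (intro measurable_chain_init gfm_step_measurable) auto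
  qed (rule \<open>c \<in> _\<close>)
  with sum show ?thesis unfolding c_def \<beta>_def by (rule order_trans[rotated])
qed

section \<open>Second phase: variance-reduced descent as a chain\<close>

definition plus_step :: "real \<Rightarrow> real \<Rightarrow> nat \<Rightarrow> nat \<Rightarrow> nat \<Rightarrow> nat \<Rightarrow> 'a \<times> 'a \<Rightarrow> (nat \<Rightarrow> 'x \<times> 'a) \<Rightarrow> 'a \<times> 'a" where
  "plus_step \<rho> \<eta> m b b' n z S =
    (if n = 0 then (fst z, batch_est F \<rho> b' (fst z) S)
     else (fst z - \<eta> *\<^sub>R snd z,
       if n mod m = 0 then batch_est F \<rho> b' (fst z - \<eta> *\<^sub>R snd z) S
       else snd z + batch_est F \<rho> b (fst z - \<eta> *\<^sub>R snd z) S - batch_est F \<rho> b (fst z) S))"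

text \<open>The chain runs one index ahead: its step \<open>n\<close> draws the batch of time
  \<open>n\<close>. Step 0 only draws and does not move, so the initial second component 0 is a
  placeholder.\<close>

lemma gfm_plus_state_eq_chain:
  "gfm_plus_state F \<rho> \<eta> m b b' x0 s t = chain (plus_step \<rho> \<eta> m b b') (x0, 0) s (Suc t)"
proof (induction t)
  case (Suc t)
  show ?case
    unfolding gfm_plus_state.simps chain.simps(2)[of _ _ _ "Suc t"] Suc[symmetric]
    by (simp add: plus_step_def Let_def split_beta)
qed (simp add: plus_step_def)

lemma batch_est_measurable:
  assumes u: "u \<in> M \<rightarrow>\<^sub>M borel" and S: "S \<in> M \<rightarrow>\<^sub>M PiM {..<B} (\<lambda>_. samples)"
  shows "(\<lambda>p. batch_est F \<rho> B (u p) (S p)) \<in> M \<rightarrow>\<^sub>M borel"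
proof -
  have "(\<lambda>p. grad_est F \<rho> (u p) (S p i)) \<in> M \<rightarrow>\<^sub>M borel" if "i \<in> {..<B}" for i
  proof -
    have "(\<lambda>p. (u p, S p i)) \<in> M \<rightarrow>\<^sub>M borel \<Otimes>\<^sub>M samples"
      by (intro measurable_Pair u measurable_compose[OF S measurable_component_singleton] that)
    from measurable_compose[OF this grad_est_measurable[of \<rho>]] show ?thesis by (simp only: split_conv)
  qed
  then show ?thesis
    unfolding batch_est_def
    by (intro borel_measurable_scaleR borel_measurable_const borel_measurable_sum)
qed

abbreviation batches :: "nat \<Rightarrow> nat \<Rightarrow> nat \<Rightarrow> nat \<Rightarrow> (nat \<Rightarrow> 'x \<times> 'a) measure" where
  "batches m b b' t \<equiv> PiM {..<(if t mod m = 0 then b' else b)} (\<lambda>_. samples)"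

lemma prob_space_batches: "prob_space (batches m b b' t)"
  by (intro prob_space_PiM prob_space_samples)

lemma plus_step_measurable:
  "(\<lambda>(z, S). plus_step \<rho> \<eta> m b b' n z S) \<in> borel \<Otimes>\<^sub>M batches m b b' n \<rightarrow>\<^sub>M borel"
proof -
  have cont: "(\<lambda>p. fst (fst p) - c *\<^sub>R snd (fst p)) \<in> (borel :: ('a \<times> 'a) measure) \<Otimes>\<^sub>M M \<rightarrow>\<^sub>M borel" for c and M :: "'z measure"
    by (rule measurable_compose[OF measurable_fst, of "\<lambda>z. fst z - c *\<^sub>R snd z"])
      (intro borel_measurable_continuous_onI continuous_intros)
  have cont_fst: "(\<lambda>p. fst (fst p)) \<in> (borel :: ('a \<times> 'a) measure) \<Otimes>\<^sub>M M \<rightarrow>\<^sub>M borel"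
    and cont_snd: "(\<lambda>p. snd (fst p)) \<in> (borel :: ('a \<times> 'a) measure) \<Otimes>\<^sub>M M \<rightarrow>\<^sub>M borel" for M :: "'z measure"
    by (rule measurable_compose[OF measurable_fst]; intro borel_measurable_continuous_onI continuous_intros)+
  consider "n = 0" | "n \<noteq> 0" "n mod m = 0" | "n \<noteq> 0" "n mod m \<noteq> 0" by blast
  then show ?thesis
  proof cases
    case 1
    have "(\<lambda>(z, S). plus_step \<rho> \<eta> m b b' n z S) = (\<lambda>p. (fst (fst p), batch_est F \<rho> b' (fst (fst p)) (snd p)))"
      by (simp add: fun_eq_iff plus_step_def 1)
    moreover have "\<dots> \<in> borel \<Otimes>\<^sub>M PiM {..<b'} (\<lambda>_. samples) \<rightarrow>\<^sub>M borel"
      by (intro borel_measurable_Pair batch_est_measurable cont_fst measurable_snd)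
    ultimately show ?thesis using 1 by simp
  next
    case 2
    have "(\<lambda>(z, S). plus_step \<rho> \<eta> m b b' n z S)
        = (\<lambda>p. (fst (fst p) - \<eta> *\<^sub>R snd (fst p), batch_est F \<rho> b' (fst (fst p) - \<eta> *\<^sub>R snd (fst p)) (snd p)))"
      using 2 by (simp add: fun_eq_iff plus_step_def)
    moreover have "\<dots> \<in> borel \<Otimes>\<^sub>M PiM {..<b'} (\<lambda>_. samples) \<rightarrow>\<^sub>M borel"
      by (intro borel_measurable_Pair batch_est_measurable cont measurable_snd)
    ultimately show ?thesis using 2 by (simp only: if_True refl)
  next
    case 3
    have "(\<lambda>(z, S). plus_step \<rho> \<eta> m b b' n z S)
        = (\<lambda>p. (fst (fst p) - \<eta> *\<^sub>R snd (fst p),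
            snd (fst p) + batch_est F \<rho> b (fst (fst p) - \<eta> *\<^sub>R snd (fst p)) (snd p) - batch_est F \<rho> b (fst (fst p)) (snd p)))"
      using 3 by (simp add: fun_eq_iff plus_step_def)
    moreover have "\<dots> \<in> borel \<Otimes>\<^sub>M PiM {..<b} (\<lambda>_. samples) \<rightarrow>\<^sub>M borel"
      by (intro borel_measurable_Pair borel_measurable_diff borel_measurable_add batch_est_measurable cont cont_fst cont_snd measurable_snd)
    ultimately show ?thesis using 3 by (simp only: if_False)
  qed
qed

lemma smoothing_lipschitz:
  assumes "\<rho> \<ge> 0" shows "\<bar>smoothing \<rho> x - smoothing \<rho> y\<bar> \<le> L * norm (x - y)"
proof -
  interpret B: prob_space "ball_law :: 'a measure" by (rule prob_space_ball_law)
  have "smoothing \<rho> x \<le> smoothing \<rho> y + L * norm (x - y)" for x y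
  proof -
    have "smoothing \<rho> x \<le> (\<integral>u. f (y + \<rho> *\<^sub>R u) + L * norm (x - y) \<partial>ball_law)"
      unfolding smoothing_def
    proof (intro integral_mono Bochner_Integration.integrable_add integrable_smoothing assms)
      show "f (x + \<rho> *\<^sub>R u) \<le> f (y + \<rho> *\<^sub>R u) + L * norm (x - y)" for u
        using lip[of "x + \<rho> *\<^sub>R u" "y + \<rho> *\<^sub>R u"] by simp
    qed simp
    also have "\<dots> = smoothing \<rho> y + L * norm (x - y)"
      using integrable_smoothing[OF assms, of y] B.prob_space by (simp add: smoothing_def)
    finally show ?thesis .
  qed
  from this[of x y] this[of y x] show ?thesis by (simp add: abs_le_iff norm_minus_commute)
qed

lemma smoothing_measurable: "\<rho> \<ge> 0 \<Longrightarrow> smoothing \<rho> \<in> borel_measurable borel"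
proof -
  assume "\<rho> \<ge> 0"
  then have "L-lipschitz_on UNIV (smoothing \<rho>)"
    using smoothing_lipschitz L_nonneg by (auto simp: lipschitz_on_def dist_norm dist_real_def)
  then show ?thesis by (intro borel_measurable_continuous_onI lipschitz_on_continuous_on)
qed

lemma smoothing_grad_measurable: "\<rho> > 0 \<Longrightarrow> smoothing_grad \<rho> \<in> borel_measurable borel"
proof -
  assume \<rho>: "\<rho> > 0"
  then have "(real DIM('a) * L / \<rho>)-lipschitz_on UNIV (smoothing_grad \<rho>)"
    using smoothing_grad_lipschitz[OF \<rho>] L_nonneg by (auto simp: lipschitz_on_def dist_norm)
  then show ?thesis by (intro borel_measurable_continuous_onI lipschitz_on_continuous_on)
qed

text \<open>The subgradient inequality at the new point, combined with the Lipschitz gradient and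
  the polarisation identity. Moving the gradient back to \<open>x\<close> produces the 2 in front of
  \<open>A * \<eta>\<close>-type terms.\<close>

lemma smoothing_descent:
  assumes \<rho>: "\<rho> > 0" and \<eta>: "\<eta> > 0"
  shows "2 / \<eta> * smoothing \<rho> (x - \<eta> *\<^sub>R v) + (norm (smoothing_grad \<rho> x))\<^sup>2
    \<le> 2 / \<eta> * smoothing \<rho> x - (1 - 2 * (real DIM('a) * L / \<rho>) * \<eta>) * (norm v)\<^sup>2 + (norm (v - smoothing_grad \<rho> x))\<^sup>2"
proof -
  define A where "A = real DIM('a) * L / \<rho>"
  let ?y = "x - \<eta> *\<^sub>R v"
  let ?Gx = "smoothing_grad \<rho> x" and ?Gy = "smoothing_grad \<rho> (x - \<eta> *\<^sub>R v)"
  have "\<bar>(?Gx - ?Gy) \<bullet> v\<bar> \<le> A * norm (\<eta> *\<^sub>R v) * norm v"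
    unfolding A_def using Cauchy_Schwarz_ineq2[of "?Gx - ?Gy" v] mult_right_mono[OF smoothing_grad_lipschitz[OF \<rho>, of x ?y], of "norm v"] by simp
  then have 1: "?Gx \<bullet> v - A * \<eta> * (norm v)\<^sup>2 \<le> ?Gy \<bullet> v"
    using \<eta> by (simp add: inner_diff_left power2_eq_square mult_ac abs_le_iff)
  have "smoothing \<rho> ?y + \<eta> * (?Gy \<bullet> v) \<le> smoothing \<rho> x"
    using smoothing_subgradient[OF \<rho>, of ?y x] by simp
  then have "2 / \<eta> * (smoothing \<rho> ?y + \<eta> * (?Gy \<bullet> v)) \<le> 2 / \<eta> * smoothing \<rho> x"
    using \<eta> by (intro mult_left_mono) auto
  then have "2 / \<eta> * smoothing \<rho> ?y + 2 * (?Gy \<bullet> v) \<le> 2 / \<eta> * smoothing \<rho> x"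
    using \<eta> by (simp add: distrib_left)
  moreover have "(norm (v - ?Gx))\<^sup>2 = (norm v)\<^sup>2 - 2 * (?Gx \<bullet> v) + (norm ?Gx)\<^sup>2"
    by (simp add: power2_norm_eq_inner inner_simps inner_commute)
  moreover have "(1 - 2 * A * \<eta>) * (norm v)\<^sup>2 = (norm v)\<^sup>2 - 2 * (A * \<eta> * (norm v)\<^sup>2)"
    by (simp add: left_diff_distrib)
  ultimately show ?thesis using 1 unfolding A_def[symmetric] by linarith
qed

end

context stochastic_objective
begin

text \<open>The potential charges the current estimation error once for every step that remains until
  the next restart.\<close>

lemma gfm_plus_gradient:
  fixes \<rho> \<eta> :: real and m b b' k :: nat
  defines "A \<equiv> real DIM('a) * L / \<rho>"
  assumes \<rho>: "\<rho> > 0" and \<eta>: "\<eta> > 0" and m: "m \<ge> 1" and b: "b \<ge> 1" and b': "b' \<ge> 1" and k: "k \<ge> 1"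
    and cond: "2 * A * \<eta> + real m * (A * \<eta>)\<^sup>2 / real b \<le> 1" and xs: "\<And>y. f xs \<le> f y"
  shows "(\<integral>\<^sup>+x. ennreal ((norm (smoothing_grad \<rho> x))\<^sup>2) \<partial>gfm_plus \<Xi> F \<rho> \<eta> (m * k) m b b' x1)
    \<le> ennreal (2 / \<eta> * (f x1 + \<rho> * L - f xs) / real (m * k) + 36 * real DIM('a) * L\<^sup>2 / real b')"
proof -
  define S G where "S = 36 * real DIM('a) * L\<^sup>2" and "G = smoothing_grad \<rho>"
  \<comment> \<open>The gap is scaled by \<open>2 / \<eta>\<close> so that the squared gradient is
    released with coefficient 1 in each step.\<close>
  define E where "E x = 2 / \<eta> * (smoothing \<rho> x - f xs)" for x
  define r where "r n = real (m - n mod m)" for n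
  \<comment> \<open>Chain state \<open>n\<close> holds the pair of time \<open>n - 1\<close>, hence
    the weight \<open>r (n - 1)\<close>. At \<open>n = 0\<close> the second component is the
    placeholder, and only the gap enters.\<close>
  define V where "V n z = (if n = 0 then ennreal (E (fst z))
      else ennreal (E (fst z) + r (n - 1) * (norm (snd z - G (fst z)))\<^sup>2))" for n :: nat and z
  \<comment> \<open>States 0 and 1 have the same first component; the start is counted once, at
    state 1.\<close>
  define c where "c n z = (if n = 0 then 0 else ennreal ((norm (G (fst z)))\<^sup>2))" for n :: nat and z :: "'a \<times> 'a"
  \<comment> \<open>A restart prepays its fresh error \<open>S / real b'\<close> for the at most
    \<open>m\<close> steps of its block.\<close>
  define \<beta> where "\<beta> n = (if n mod m = 0 then ennreal (real m * (S / real b')) else 0)" for n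
  let ?T = "m * k" and ?step = "plus_step \<rho> \<eta> m b b'"
  have S: "S \<ge> 0" by (simp add: S_def)
  have A: "A \<ge> 0" using \<rho> L_pos by (simp add: A_def)
  have E: "E x \<ge> 0" for x
    using order_trans[OF xs[of x] smoothing_ge[of \<rho> x]] \<rho> \<eta> by (simp add: E_def)
  have r1: "r n \<ge> 1" and rm: "r n \<le> real m" for n
  proof -
    have "Suc (n mod m) \<le> m" using m by (intro Suc_leI mod_less_divisor) simp
    then have "real (Suc (n mod m)) \<le> real m" by (simp only: of_nat_le_iff)
    moreover have "r n = real m - real (n mod m)"
      unfolding r_def using \<open>Suc (n mod m) \<le> m\<close> by (intro of_nat_diff) simp
    ultimately show "r n \<ge> 1" "r n \<le> real m" by simp_all
  qed
  have r0: "0 \<le> r n" for n by (simp add: r_def)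
  have cond': "2 * A * \<eta> \<le> 1"
  proof -
    have "0 \<le> real m * (A * \<eta>)\<^sup>2 / real b" by simp
    then show ?thesis using cond by linarith
  qed
  note bound = grad_est_second_moment[OF \<rho>, folded S_def]
  have descent: "E (x - \<eta> *\<^sub>R v) + (norm (G x))\<^sup>2 \<le> E x - (1 - 2 * A * \<eta>) * (norm v)\<^sup>2 + (norm (v - G x))\<^sup>2" for x v
    using smoothing_descent[OF \<rho> \<eta>, of x v]
    unfolding E_def G_def A_def[symmetric] right_diff_distrib[of "2 / \<eta>"] by linarith
  have fst_m: "(fst :: 'a \<times> 'a \<Rightarrow> 'a) \<in> borel \<rightarrow>\<^sub>M borel" and snd_m: "(snd :: 'a \<times> 'a \<Rightarrow> 'a) \<in> borel \<rightarrow>\<^sub>M borel"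
    by (intro borel_measurable_continuous_onI continuous_intros)+
  have E_m: "(\<lambda>z :: 'a \<times> 'a. E (fst z)) \<in> borel_measurable borel"
    unfolding E_def using \<rho>
    by (intro borel_measurable_times borel_measurable_const borel_measurable_diff
        measurable_compose[OF fst_m smoothing_measurable]) simp
  have G_m: "(\<lambda>z :: 'a \<times> 'a. G (fst z)) \<in> borel_measurable borel"
    unfolding G_def by (rule measurable_compose[OF fst_m smoothing_grad_measurable[OF \<rho>]])
  have V_m: "V n \<in> borel_measurable borel" for n
  proof (cases "n = 0")
    case True
    have V: "V n = (\<lambda>z. ennreal (E (fst z)))" using True by (intro ext) (simp add: V_def)
    show ?thesis unfolding V by (rule measurable_compose[OF E_m measurable_ennreal])
  next
    case False
    have V: "V n = (\<lambda>z. ennreal (E (fst z) + r (n - 1) * (norm (snd z - G (fst z)))\<^sup>2))"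
      using False by (intro ext) (simp add: V_def)
    show ?thesis
      unfolding V
      by (intro measurable_compose[OF _ measurable_ennreal] borel_measurable_add E_m borel_measurable_times
          borel_measurable_const borel_measurable_power measurable_compose[OF _ borel_measurable_norm] borel_measurable_diff snd_m G_m)
  qed
  have G2_m: "(\<lambda>z :: 'a \<times> 'a. ennreal ((norm (G (fst z)))\<^sup>2)) \<in> borel_measurable borel"
    by (intro measurable_compose[OF _ measurable_ennreal] borel_measurable_power measurable_compose[OF _ borel_measurable_norm] G_m)
  have c_m: "c n \<in> borel_measurable borel" for n
  proof (cases "n = 0")
    case True
    have c: "c n = (\<lambda>z. 0)" using True by (intro ext) (simp add: c_def)
    show ?thesis unfolding c by (rule borel_measurable_const)
  next
    case False
    have c: "c n = (\<lambda>z. ennreal ((norm (G (fst z)))\<^sup>2))" using False by (intro ext) (simp add: c_def)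
    show ?thesis unfolding c by (rule G2_m)
  qed
  have restart: "(\<integral>\<^sup>+s. ennreal (E x + r n * (norm (batch_est F \<rho> b' x s - G x))\<^sup>2) \<partial>PiM {..<b'} (\<lambda>_. samples))
      \<le> ennreal (E x + real m * (S / real b'))" for x n
  proof -
    have "(\<integral>\<^sup>+s. ennreal (E x + r n * (norm (batch_est F \<rho> b' x s - G x))\<^sup>2) \<partial>PiM {..<b'} (\<lambda>_. samples))
        \<le> ennreal (E x + r n * (0 + S / real b'))"
      using nn_integral_batch_potential_le[OF prob_space_samples grad_est_measurable_sample bound S b' E[of x] r0[of n], of 0 x]
      by (simp add: grad_est_mean[OF \<rho>] batch_est_def G_def)
    also have "\<dots> \<le> ennreal (E x + real m * (S / real b'))"
      unfolding add_0
      by (intro ennreal_leI add_left_mono mult_right_mono rm divide_nonneg_nonneg S of_nat_0_le_iff)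
    finally show ?thesis .
  qed
  have drift: "(\<integral>\<^sup>+s. V (Suc n) (?step n z s) \<partial>batches m b b' n) + c n z \<le> V n z + \<beta> n" for n z
  proof -
    obtain x v where z: "z = (x, v)" by (cases z)
    let ?y = "x - \<eta> *\<^sub>R v" and ?err = "(norm (v - G x))\<^sup>2"
    have mS: "0 \<le> real m * (S / real b')" using S by simp
    have cz: "c n z = ennreal ((norm (G x))\<^sup>2)" if "n \<noteq> 0" using that by (simp add: c_def z)
    have v2: "2 * A * \<eta> * (norm v)\<^sup>2 \<le> 1 * (norm v)\<^sup>2" using cond' by (intro mult_right_mono) auto
    consider "n = 0" | "n \<noteq> 0" "n mod m = 0" | "n \<noteq> 0" "n mod m \<noteq> 0" by blast
    then show ?thesis
    proof cases
      case 1
      then show ?thesis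
        using restart[of x 0] ennreal_plus[OF E[of x] mS] by (simp add: V_def c_def \<beta>_def plus_step_def z)
    next
      case 2
      have "(\<integral>\<^sup>+s. V (Suc n) (?step n z s) \<partial>batches m b b' n) \<le> ennreal (E ?y + real m * (S / real b'))"
        using restart[of ?y n] 2 by (simp add: V_def plus_step_def z)
      then have "(\<integral>\<^sup>+s. V (Suc n) (?step n z s) \<partial>batches m b b' n) + c n z
          \<le> ennreal (E ?y + real m * (S / real b')) + ennreal ((norm (G x))\<^sup>2)"
        unfolding cz[OF 2(1)] by (rule add_right_mono)
      also have "\<dots> = ennreal (E ?y + real m * (S / real b') + (norm (G x))\<^sup>2)"
        by (rule ennreal_plus[symmetric]) (use E[of ?y] mS in simp_all)
      also have "\<dots> \<le> ennreal (E x + r (n - 1) * ?err + real m * (S / real b'))"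
      proof (rule ennreal_leI)
        have "?err \<le> r (n - 1) * ?err" using mult_right_mono[OF r1[of "n - 1"], of ?err] by simp
        then show "E ?y + real m * (S / real b') + (norm (G x))\<^sup>2 \<le> E x + r (n - 1) * ?err + real m * (S / real b')"
          using descent[of x v] v2 left_diff_distrib[of 1 "2 * A * \<eta>" "(norm v)\<^sup>2"] by linarith
      qed
      also have "\<dots> = V n z + \<beta> n"
      proof -
        have "ennreal (E x + r (n - 1) * ?err + real m * (S / real b'))
            = ennreal (E x + r (n - 1) * ?err) + ennreal (real m * (S / real b'))"
          using E[of x] r0[of "n - 1"] by (intro ennreal_plus mS add_nonneg_nonneg mult_nonneg_nonneg) auto
        then show ?thesis using 2 by (simp add: V_def \<beta>_def z)
      qed
      finally show ?thesis .
    next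
      case 3
      \<comment> \<open>Without a restart one unit of weight is released, and it pays for the
        estimation error in \<open>descent\<close>.\<close>
      have r_dec: "r n = r (n - 1) - 1"
      proof -
        obtain t where t: "n = Suc t" using 3(1) not0_implies_Suc by blast
        have "Suc t mod m = Suc (t mod m)" using 3(2) unfolding t by (simp add: mod_Suc split: if_splits)
        moreover have "Suc (t mod m) \<le> m" using m by (simp add: Suc_leI)
        ultimately show ?thesis by (simp add: r_def t of_nat_diff)
      qed
      let ?Y = "\<lambda>w. grad_est F \<rho> ?y w - grad_est F \<rho> x w" and ?S = "(A * \<eta>)\<^sup>2 * (norm v)\<^sup>2"
      have Y_m: "?Y \<in> borel_measurable samples"
        by (intro borel_measurable_diff grad_est_measurable_sample)
      have Y2: "(\<integral>\<^sup>+w. ennreal ((norm (?Y w))\<^sup>2) \<partial>samples) \<le> ennreal ?S"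
      proof -
        have "(real DIM('a) * L / \<rho>)\<^sup>2 * (norm (?y - x))\<^sup>2 = ?S"
          by (simp add: A_def power_mult_distrib power_divide)
        then show ?thesis using grad_est_diff_second_moment[OF \<rho>, of ?y x] by (simp only:)
      qed
      have Y_mean: "(\<integral>w. ?Y w \<partial>samples) = G ?y - G x"
        using integrable_grad_est[OF \<rho>] by (simp add: grad_est_mean[OF \<rho>] G_def)
      have step: "V (Suc n) (?step n z s)
          = ennreal (E ?y + r n * (norm ((v - G x) + ((1 / real b) *\<^sub>R (\<Sum>i<b. ?Y (s i)) - (\<integral>w. ?Y w \<partial>samples))))\<^sup>2)" for s
      proof -
        have "v + batch_est F \<rho> b ?y s - batch_est F \<rho> b x s - G ?y
            = (v - G x) + ((1 / real b) *\<^sub>R (\<Sum>i<b. ?Y (s i)) - (\<integral>w. ?Y w \<partial>samples))"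
          unfolding Y_mean batch_est_def by (simp add: sum_subtractf scaleR_diff_right algebra_simps)
        moreover have "V (Suc n) (?step n z s)
            = ennreal (E ?y + r n * (norm (v + batch_est F \<rho> b ?y s - batch_est F \<rho> b x s - G ?y))\<^sup>2)"
          using 3 by (simp add: V_def plus_step_def z)
        ultimately show ?thesis by (simp only:)
      qed
      have "(\<integral>\<^sup>+s. V (Suc n) (?step n z s) \<partial>batches m b b' n) \<le> ennreal (E ?y + r n * (?err + ?S / real b))"
        unfolding step using 3(2)
        by (simp only: if_False) (rule nn_integral_batch_potential_le[OF prob_space_samples Y_m Y2 _ b E r0], simp)
      then have "(\<integral>\<^sup>+s. V (Suc n) (?step n z s) \<partial>batches m b b' n) + c n z
          \<le> ennreal (E ?y + r n * (?err + ?S / real b)) + ennreal ((norm (G x))\<^sup>2)"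
        unfolding cz[OF 3(1)] by (rule add_right_mono)
      also have "\<dots> = ennreal (E ?y + r n * (?err + ?S / real b) + (norm (G x))\<^sup>2)"
        using E[of ?y] r0[of n] by (intro ennreal_plus[symmetric] add_nonneg_nonneg mult_nonneg_nonneg) auto
      also have "\<dots> \<le> ennreal (E x + r (n - 1) * ?err)"
      proof (rule ennreal_leI)
        \<comment> \<open>The negative multiple of \<open>(norm v)\<^sup>2\<close> has to absorb the
          curvature and the new sampling error, which is counted at most \<open>m\<close> times;
          \<open>cond\<close> says that it can.\<close>
        have "r n * (?S / real b) \<le> real m * (?S / real b)" using rm[of n] by (intro mult_right_mono) auto
        moreover have "(2 * A * \<eta> + real m * (A * \<eta>)\<^sup>2 / real b) * (norm v)\<^sup>2 \<le> 1 * (norm v)\<^sup>2"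
          using cond by (intro mult_right_mono) auto
        moreover have "(2 * A * \<eta> + real m * (A * \<eta>)\<^sup>2 / real b) * (norm v)\<^sup>2
            = 2 * A * \<eta> * (norm v)\<^sup>2 + real m * (?S / real b)" by (simp add: distrib_right)
        moreover have "r n * (?err + ?S / real b) = r (n - 1) * ?err - ?err + r n * (?S / real b)"
          by (simp add: distrib_left r_dec left_diff_distrib)
        moreover have "(1 - 2 * A * \<eta>) * (norm v)\<^sup>2 = (norm v)\<^sup>2 - 2 * A * \<eta> * (norm v)\<^sup>2"
          by (simp add: left_diff_distrib)
        ultimately show "E ?y + r n * (?err + ?S / real b) + (norm (G x))\<^sup>2 \<le> E x + r (n - 1) * ?err"
          using descent[of x v] by linarith
      qed
      also have "\<dots> = V n z + \<beta> n" using 3 by (simp add: V_def \<beta>_def z)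
      finally show ?thesis .
    qed
  qed
  let ?P = "PiM {..<?T} (batches m b b')"
  let ?z = "\<lambda>s n. chain ?step (x1, 0) s n"
  have main: "(\<integral>\<^sup>+s. V ?T (?z s ?T) \<partial>?P) + (\<Sum>n<?T. \<integral>\<^sup>+s. c n (?z s n) \<partial>?P) \<le> V 0 (x1, 0) + (\<Sum>n<?T. \<beta> n)"
    by (rule chain_drift) (rule prob_space_batches plus_step_measurable V_m c_m drift)+
  \<comment> \<open>The costs below \<open>?T\<close> reach only the iterate of time
    \<open>?T - 2\<close>. The gradient of the last iterate is covered by the final potential, since
    one further descent step would still leave a nonnegative gap.\<close>
  have last: "(\<integral>\<^sup>+s. c ?T (?z s ?T) \<partial>?P) \<le> (\<integral>\<^sup>+s. V ?T (?z s ?T) \<partial>?P)"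
  proof (rule nn_integral_mono)
    fix s
    obtain x v where z: "?z s ?T = (x, v)" by (cases "?z s ?T")
    have "(norm (G x))\<^sup>2 \<le> E x + r (?T - 1) * (norm (v - G x))\<^sup>2"
    proof -
      have "2 * A * \<eta> * (norm v)\<^sup>2 \<le> 1 * (norm v)\<^sup>2" using cond' by (intro mult_right_mono) auto
      moreover have "1 * (norm (v - G x))\<^sup>2 \<le> r (?T - 1) * (norm (v - G x))\<^sup>2"
        using r1 by (intro mult_right_mono) auto
      ultimately show ?thesis
        using descent[of x v] E[of "x - \<eta> *\<^sub>R v"] left_diff_distrib[of 1 "2 * A * \<eta>" "(norm v)\<^sup>2"] by linarith
    qed
    then show "c ?T (?z s ?T) \<le> V ?T (?z s ?T)"
      unfolding z using m k by (simp add: c_def V_def ennreal_leI)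
  qed
  \<comment> \<open>There are \<open>k\<close> restarts, each paying for \<open>m\<close> steps, so
    the noise averages to \<open>S / real b'\<close> per step.\<close>
  have \<beta>_sum: "(\<Sum>n<?T. \<beta> n) = of_nat ?T * ennreal (S / real b')"
  proof -
    have "(\<Sum>n<?T. \<beta> n) = of_nat k * ennreal (real m * (S / real b'))"
      unfolding \<beta>_def by (rule sum_block_starts[OF m])
    also have "ennreal (real m * (S / real b')) = of_nat m * ennreal (S / real b')"
      unfolding ennreal_of_nat_eq_real_of_nat by (rule ennreal_mult') simp
    finally show ?thesis by (simp add: mult_ac)
  qed
  have V0: "V 0 (x1, 0) \<le> ennreal (2 / \<eta> * (f x1 + \<rho> * L - f xs))"
  proof -
    have "E x1 \<le> 2 / \<eta> * (f x1 + \<rho> * L - f xs)"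
      unfolding E_def using smoothing_le[of \<rho> x1] \<rho> \<eta> by (intro mult_left_mono) auto
    moreover have "V 0 (x1, 0) = ennreal (E x1)" by (simp add: V_def)
    ultimately show ?thesis by (simp only: ennreal_leI)
  qed
  have "(\<Sum>n<Suc ?T. \<integral>\<^sup>+s. c n (?z s n) \<partial>?P)
      = (\<integral>\<^sup>+s. c ?T (?z s ?T) \<partial>?P) + (\<Sum>n<?T. \<integral>\<^sup>+s. c n (?z s n) \<partial>?P)"
    unfolding sum.lessThan_Suc by (rule add.commute)
  also have "\<dots> \<le> V 0 (x1, 0) + (\<Sum>n<?T. \<beta> n)" by (rule order_trans[OF add_right_mono[OF last] main])
  also have "\<dots> \<le> ennreal (2 / \<eta> * (f x1 + \<rho> * L - f xs)) + of_nat ?T * ennreal (S / real b')"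
    unfolding \<beta>_sum by (rule add_right_mono[OF V0])
  finally have "(\<Sum>n<Suc ?T. \<integral>\<^sup>+s. c n (?z s n) \<partial>?P)
      \<le> ennreal (2 / \<eta> * (f x1 + \<rho> * L - f xs)) + of_nat ?T * ennreal (S / real b')" .
  moreover have "(\<Sum>n<Suc ?T. \<integral>\<^sup>+s. c n (?z s n) \<partial>?P)
      = (\<Sum>t<?T. \<integral>\<^sup>+s. ennreal ((norm (G (fst (gfm_plus_state F \<rho> \<eta> m b b' x1 s t))))\<^sup>2) \<partial>?P)"
    unfolding sum.lessThan_Suc_shift gfm_plus_state_eq_chain by (simp add: c_def del: chain.simps)
  ultimately have "(\<Sum>t<?T. \<integral>\<^sup>+s. ennreal ((norm (G (fst (gfm_plus_state F \<rho> \<eta> m b b' x1 s t))))\<^sup>2) \<partial>?P) / of_nat ?T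
      \<le> ennreal (2 / \<eta> * (f x1 + \<rho> * L - f xs) / real ?T + S / real b')"
  proof (intro ennreal_average_le)
    have "0 \<le> f x1 + \<rho> * L - f xs" using xs[of x1] mult_pos_pos[OF \<rho> L_pos] by linarith
    then show "0 \<le> 2 / \<eta> * (f x1 + \<rho> * L - f xs)" using \<eta> by simp
  qed (use S m k in auto)
  moreover have "(\<integral>\<^sup>+x. ennreal ((norm (G x))\<^sup>2) \<partial>gfm_plus \<Xi> F \<rho> \<eta> ?T m b b' x1)
      \<le> (\<Sum>t<?T. \<integral>\<^sup>+s. ennreal ((norm (G (fst (gfm_plus_state F \<rho> \<eta> m b b' x1 s t))))\<^sup>2) \<partial>?P) / of_nat ?T"
    unfolding gfm_plus_def
  proof (rule nn_integral_uniform_output_le)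
    show "?T \<ge> 1" using m k by simp
    show "prob_space ?P" by (intro prob_space_PiM prob_space_batches)
    show "(\<lambda>s. fst (gfm_plus_state F \<rho> \<eta> m b b' x1 s t)) \<in> ?P \<rightarrow>\<^sub>M borel" if "t < ?T" for t
      unfolding gfm_plus_state_eq_chain using that
      by (intro measurable_compose[OF measurable_chain_init fst_m] plus_step_measurable) auto
    show "(\<lambda>x. ennreal ((norm (G x))\<^sup>2)) \<in> borel_measurable borel"
      unfolding G_def
      by (intro measurable_compose[OF _ measurable_ennreal] borel_measurable_power measurable_compose[OF _ borel_measurable_norm] smoothing_grad_measurable \<rho>)
  qed
  ultimately show ?thesis unfolding G_def S_def by (rule order_trans[rotated])
qed

end

section \<open>Choice of the parameters\<close>

text \<open>With \<open>b = 1\<close> and \<open>b' = m\<close>, a restart costs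
  \<open>2 * m\<close> once per \<open>m\<close> steps, hence 2 per step on average. Counting 4 more
  for every step gives the 6.\<close>

lemma ws_gfm_plus_calls_le:
  assumes "m \<ge> 1"
  shows "real (ws_gfm_plus_calls T0 (m * k) m 1 m) \<le> 2 * real T0 + 6 * real (m * k)"
proof -
  have "gfm_plus_calls (m * k) m 1 m \<le> (\<Sum>t<m * k. (if t mod m = 0 then 2 * m else 0) + 4)"
    unfolding gfm_plus_calls_def by (rule sum_mono) auto
  also have "\<dots> = k * (2 * m) + 4 * (m * k)"
    unfolding sum.distrib sum_block_starts[OF assms] by simp
  finally have "ws_gfm_plus_calls T0 (m * k) m 1 m \<le> 2 * T0 + 6 * (m * k)"
    by (simp add: ws_gfm_plus_calls_def gfm_calls_def mult.commute)
  then have "real (ws_gfm_plus_calls T0 (m * k) m 1 m) \<le> real (2 * T0 + 6 * (m * k))"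
    by (simp only: of_nat_le_iff)
  then show ?thesis by simp
qed

lemma nat_ceiling_bounds:
  fixes x :: real assumes "x \<ge> 0"
  shows "x \<le> real (nat \<lceil>x\<rceil>)" and "real (nat \<lceil>x\<rceil>) \<le> x + 1"
  using assms by linarith+

text \<open>The squared accuracy is split evenly between the optimisation term, controlled by the
  length \<open>m * k\<close>, and the restart noise, controlled by \<open>m\<close>. The lengths of
  the two phases are then compared with the two terms of the claimed complexity.\<close>

lemma parameter_choice:
  fixes L R \<delta> \<epsilon> d :: real
  assumes L: "L > 0" and R: "R \<ge> 0" and \<delta>: "\<delta> > 0" and \<epsilon>: "0 < \<epsilon>" "\<epsilon> < L" and d: "d \<ge> 1"
  obtains \<eta>0 \<eta> :: real and T0 m k :: nat
  where "\<eta>0 > 0" "\<eta> > 0" "T0 \<ge> 1" "m \<ge> 1" "k \<ge> 1"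
    "2 * (d * L / \<delta>) * \<eta> + real m * (d * L / \<delta> * \<eta>)\<^sup>2 \<le> 1"
    "2 / \<eta> / real (m * k) * ((R\<^sup>2 / (2 * \<eta>0) / real T0 + (18 * d * L\<^sup>2 * \<eta>0 + \<delta> * L)) + \<delta> * L)
      + 36 * d * L\<^sup>2 / real m \<le> \<epsilon>\<^sup>2"
    "2 * real T0 + 6 * real (m * k) \<le> 10 ^ 6 * (d powr (3/2) * L ^ 3 / \<epsilon> ^ 3 +
      d powr (4/3) * L\<^sup>2 * R powr (2/3) / (\<delta> powr (2/3) * \<epsilon>\<^sup>2))"
proof -
  define s where "s = sqrt d"
  have s: "s \<ge> 1" "s * s = d" using d by (simp_all add: s_def)
  define B where "B = L / \<epsilon>"
  have B: "B > 1" using \<epsilon> by (simp add: B_def)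
  define Y where "Y = d powr (3/2) * L ^ 3 / \<epsilon> ^ 3"
  have "d powr (3/2) = d powr (1 + 1/2)" by simp
  also have "\<dots> = d * s" using d unfolding s_def by (subst powr_add) (simp add: powr_half_sqrt)
  finally have Y: "Y = d * s * B ^ 3" by (simp add: Y_def B_def power_divide)
  have dB: "d * B\<^sup>2 \<le> Y" "1 \<le> d * B\<^sup>2"
  proof -
    have "d * B\<^sup>2 * 1 \<le> d * B\<^sup>2 * (s * B)"
      using s(1) B d mult_mono[of 1 s 1 B] by (intro mult_left_mono) auto
    then show "d * B\<^sup>2 \<le> Y" by (simp add: Y power2_eq_square power3_eq_cube mult_ac)
    have "1 * 1 \<le> d * B\<^sup>2" using d B by (intro mult_mono) (auto intro: one_le_power)
    then show "1 \<le> d * B\<^sup>2" by simp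
  qed
  define X where "X = d powr (4/3) * L\<^sup>2 * R powr (2/3) / (\<delta> powr (2/3) * \<epsilon>\<^sup>2)"
  \<comment> \<open>Up to a constant, \<open>Z / sqrt T0\<close> is the part of the second phase
    that depends on \<open>R\<close>. The identity \<open>X ^ 3 = Z\<^sup>2\<close> says that
    \<open>X = Z / sqrt X\<close> for positive \<open>X\<close>, so the first phase of length
    \<open>X\<close> balances it.\<close>
  define Z where "Z = R * d\<^sup>2 * L ^ 3 / (\<delta> * \<epsilon> ^ 3)"
  have X0: "X \<ge> 0" and Z0: "Z \<ge> 0" using L R \<delta> \<epsilon> d by (simp_all add: X_def Z_def)
  have XZ: "X ^ 3 = Z\<^sup>2"
  proof -
    have pow: "(a powr (2/3)) ^ 3 = a\<^sup>2" if "a \<ge> 0" for a :: real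
    proof (cases "a = 0")
      case False
      have "(a powr (2/3)) ^ 3 = a powr (2/3 * real 3)" using False by (simp add: powr_power)
      also have "\<dots> = a powr (real 2)" by simp
      also have "\<dots> = a\<^sup>2" using False that by (subst powr_realpow) auto
      finally show ?thesis .
    qed simp
    have "(d powr (4/3)) ^ 3 = d powr (4/3 * real 3)" using d by (simp add: powr_power)
    also have "\<dots> = d powr (real 4)" by simp
    also have "\<dots> = d ^ 4" using d by (subst powr_realpow) auto
    finally have d4: "(d powr (4/3)) ^ 3 = d ^ 4" .
    have "X ^ 3 = d ^ 4 * (L\<^sup>2) ^ 3 * R\<^sup>2 / (\<delta>\<^sup>2 * (\<epsilon>\<^sup>2) ^ 3)"
      unfolding X_def power_divide power_mult_distrib d4 using pow[OF R] pow[of \<delta>] \<delta> by simp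
    also have "\<dots> = Z\<^sup>2"
      unfolding Z_def power_divide power_mult_distrib by (simp flip: power_mult)
    finally show ?thesis .
  qed
  \<comment> \<open>The added 1 keeps at least one iteration when \<open>R = 0\<close> and hence
    \<open>X = 0\<close>.\<close>
  define T0 where "T0 = nat \<lceil>X\<rceil> + 1"
  have T0: "T0 \<ge> 1" "X \<le> real T0" "real T0 \<le> X + 2"
    using nat_ceiling_bounds[OF X0] by (simp_all add: T0_def)
  define t where "t = sqrt (real T0)"
  have t: "t > 0" "t * t = real T0" using T0(1) by (simp_all add: t_def)
  have Zt: "Z \<le> X * t"
  proof (rule power2_le_imp_le)
    have "Z\<^sup>2 = X\<^sup>2 * X" unfolding XZ[symmetric] by (simp add: power2_eq_square power3_eq_cube)
    also have "\<dots> \<le> X\<^sup>2 * real T0" using T0(2) by (intro mult_left_mono) auto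
    also have "\<dots> = (X * t)\<^sup>2" by (simp add: power_mult_distrib power2_eq_square[of t] t(2))
    finally show "Z\<^sup>2 \<le> (X * t)\<^sup>2" .
  qed (use X0 t in simp)
  \<comment> \<open>The 72 is twice the 36 of the second moment, so the restart noise takes half of
    \<open>\<epsilon>\<^sup>2\<close>.\<close>
  define m where "m = nat \<lceil>72 * (d * B\<^sup>2)\<rceil>"
  have m: "72 * (d * B\<^sup>2) \<le> real m" "real m \<le> 73 * (d * B\<^sup>2)"
    using nat_ceiling_bounds[of "72 * (d * B\<^sup>2)"] dB(2) unfolding m_def by linarith+
  have "72 * 1 \<le> 72 * (d * B\<^sup>2)" using dB(2) by (rule mult_left_mono) simp
  then have m72: "real m \<ge> 72" using m(1) by (simp only: mult_1_right)
  \<comment> \<open>With \<open>\<eta> = \<delta> / (d * L * w)\<close> the quadratic term of the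
    step size condition equals 1/2, and \<open>w \<ge> 4\<close> bounds the linear one by
    1/2.\<close>
  define w where "w = sqrt (2 * real m)"
  have w: "w > 0" "w * w = 2 * real m" using m72 by (simp_all add: w_def)
  have w4: "4 \<le> w"
    by (rule power2_le_imp_le) (use w m72 in \<open>simp_all add: power2_eq_square\<close>)
  \<comment> \<open>The 13 comes from \<open>2 * 73 \<le> 169\<close>.\<close>
  have w13: "w \<le> 13 * (s * B)"
  proof (rule power2_le_imp_le)
    have "w\<^sup>2 = 2 * real m" by (simp add: power2_eq_square w(2))
    also have "\<dots> \<le> 2 * (73 * (d * B\<^sup>2))" using m(2) by (rule mult_left_mono) simp
    also have "\<dots> \<le> 169 * (d * B\<^sup>2)" using d by simp
    also have "\<dots> = (13 * (s * B))\<^sup>2" by (simp add: power_mult_distrib power2_eq_square[of s] s(2))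
    finally show "w\<^sup>2 \<le> (13 * (s * B))\<^sup>2" .
  qed (use s B in simp)
  define \<eta> where "\<eta> = \<delta> / (d * L * w)"
  have \<eta>: "\<eta> > 0" using \<delta> d L w by (simp add: \<eta>_def)
  have A\<eta>: "d * L / \<delta> * \<eta> = 1 / w" using \<delta> d L w by (simp add: \<eta>_def)
  have cond: "2 * (d * L / \<delta>) * \<eta> + real m * (d * L / \<delta> * \<eta>)\<^sup>2 \<le> 1"
  proof -
    have "real m * (d * L / \<delta> * \<eta>)\<^sup>2 = 1 / 2"
      unfolding A\<eta> power_divide power2_eq_square[of w] w(2) using m72 by simp
    moreover have "2 * (d * L / \<delta>) * \<eta> = 2 * (1 / w)" by (simp only: mult.assoc[of 2] A\<eta>)
    moreover have "1 / w \<le> 1 / 4" using w4 by (intro divide_left_mono) auto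
    ultimately show ?thesis by linarith
  qed
  define \<sigma> where "\<sigma> = 6 * s * L"
  have \<sigma>: "\<sigma> > 0" "\<sigma> * \<sigma> = 36 * d * L\<^sup>2"
    using s L by (simp_all add: \<sigma>_def power2_eq_square flip: s(2))
  \<comment> \<open>A substitute radius that keeps the step size positive when \<open>R = 0\<close>.
    It adds at most \<open>\<kappa> * \<sigma> / t \<le> \<delta> * L\<close> to the gap, no more
    than one smoothing bias.\<close>
  define \<kappa> where "\<kappa> = \<delta> * L / \<sigma>"
  have \<kappa>: "\<kappa> > 0" "\<kappa> * \<sigma> = \<delta> * L" using \<delta> L \<sigma> by (simp_all add: \<kappa>_def)
  \<comment> \<open>The minimiser of the subgradient bound with \<open>R + \<kappa>\<close> in place
    of \<open>R\<close>; both of its terms are then equal.\<close>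
  define \<eta>0 where "\<eta>0 = (R + \<kappa>) / (\<sigma> * t)"
  have \<eta>0: "\<eta>0 > 0" using R \<kappa> \<sigma> t by (simp add: \<eta>0_def add_nonneg_pos)
  \<comment> \<open>Three units of \<open>\<delta> * L\<close>: the bias of each phase and the
    contribution of \<open>\<kappa>\<close>.\<close>
  define W where "W = R * \<sigma> / t + 3 * (\<delta> * L)"
  have W0: "W > 0" using R \<sigma> t \<delta> L by (simp add: W_def add_nonneg_pos)
  have gap: "(R\<^sup>2 / (2 * \<eta>0) / real T0 + (18 * d * L\<^sup>2 * \<eta>0 + \<delta> * L)) + \<delta> * L \<le> W"
  proof -
    have T1: "1 \<le> t" using T0(1) by (simp add: t_def)
    have "R\<^sup>2 / (2 * \<eta>0) / real T0 \<le> (R + \<kappa>)\<^sup>2 / (2 * \<eta>0) / real T0"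
      using R \<kappa> \<eta>0 by (intro divide_right_mono power_mono) auto
    also have "\<dots> = (R + \<kappa>) * \<sigma> / (2 * t)"
    proof -
      have "q\<^sup>2 / (2 * (q / (\<sigma> * t))) / (t * t) = q * \<sigma> / (2 * t)" if "q > 0" for q
        using that \<sigma>(1) t(1) by (simp add: power2_eq_square field_simps)
      from this[of "R + \<kappa>"] show ?thesis unfolding \<eta>0_def t(2)[symmetric] using R \<kappa>(1) by simp
    qed
    finally have 1: "R\<^sup>2 / (2 * \<eta>0) / real T0 \<le> (R + \<kappa>) * \<sigma> / (2 * t)" .
    have "18 * d * L\<^sup>2 * \<eta>0 = \<sigma> * \<sigma> / 2 * \<eta>0" unfolding \<sigma>(2) by simp
    also have "\<dots> = (R + \<kappa>) * \<sigma> / (2 * t)" using \<sigma>(1) by (simp add: \<eta>0_def)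
    finally have 2: "18 * d * L\<^sup>2 * \<eta>0 = (R + \<kappa>) * \<sigma> / (2 * t)" .
    have "(R + \<kappa>) * \<sigma> / (2 * t) + (R + \<kappa>) * \<sigma> / (2 * t) = R * \<sigma> / t + \<kappa> * \<sigma> / t"
      by (simp add: distrib_right add_divide_distrib)
    moreover have "\<kappa> * \<sigma> / t \<le> \<delta> * L"
      unfolding \<kappa>(2) using divide_left_mono[OF T1, of "\<delta> * L"] \<delta> L t(1) by simp
    ultimately show ?thesis using 1 unfolding 2 W_def by linarith
  qed
  \<comment> \<open>The number of steps after which the gap \<open>W\<close> contributes half of
    \<open>\<epsilon>\<^sup>2\<close>. Rounding it up to whole blocks costs at most
    \<open>2 * m\<close> steps.\<close>
  define Q where "Q = 4 * W / (\<eta> * \<epsilon>\<^sup>2)"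
  have Q0: "Q > 0" using W0 \<eta> \<epsilon> by (simp add: Q_def)
  define k where "k = nat \<lceil>Q / real m\<rceil> + 1"
  have k: "k \<ge> 1" "Q \<le> real (m * k)" "real (m * k) \<le> Q + 2 * real m"
  proof -
    have Qm: "0 \<le> Q / real m" using Q0 by simp
    show "k \<ge> 1" by (simp add: k_def)
    have "Q / real m \<le> real k" "real k \<le> Q / real m + 2"
      using nat_ceiling_bounds[OF Qm] by (simp_all add: k_def)
    then have "real m * (Q / real m) \<le> real m * real k" "real m * real k \<le> real m * (Q / real m + 2)"
      by (simp_all only: mult_left_mono of_nat_0_le_iff)
    moreover have "real m * (Q / real m) = Q" using m72 by simp
    ultimately show "Q \<le> real (m * k)" "real (m * k) \<le> Q + 2 * real m"
      unfolding distrib_left of_nat_mult by linarith+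
  qed
  have mk0: "real (m * k) > 0" using Q0 k(2) by linarith
  have acc: "2 / \<eta> / real (m * k) * ((R\<^sup>2 / (2 * \<eta>0) / real T0 + (18 * d * L\<^sup>2 * \<eta>0 + \<delta> * L)) + \<delta> * L)
      + 36 * d * L\<^sup>2 / real m \<le> \<epsilon>\<^sup>2"
  proof -
    have "2 / \<eta> / real (m * k) * ((R\<^sup>2 / (2 * \<eta>0) / real T0 + (18 * d * L\<^sup>2 * \<eta>0 + \<delta> * L)) + \<delta> * L)
        \<le> 2 / \<eta> / real (m * k) * W" using \<eta> mk0 by (intro mult_left_mono gap) auto
    also have "\<dots> \<le> \<epsilon>\<^sup>2 / 2"
    proof -
      have "4 * W \<le> real (m * k) * (\<eta> * \<epsilon>\<^sup>2)"
        using k(2) \<eta> \<epsilon> unfolding Q_def by (simp only: pos_divide_le_eq[OF mult_pos_pos] zero_less_power)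
      then have "2 * W / (\<eta> * real (m * k)) \<le> \<epsilon>\<^sup>2 / 2"
        using \<eta> mk0 by (simp add: pos_divide_le_eq del: of_nat_mult) (simp add: mult_ac del: of_nat_mult)
      then show ?thesis by simp
    qed
    finally have 1: "2 / \<eta> / real (m * k) * ((R\<^sup>2 / (2 * \<eta>0) / real T0 + (18 * d * L\<^sup>2 * \<eta>0 + \<delta> * L)) + \<delta> * L) \<le> \<epsilon>\<^sup>2 / 2" .
    have "72 * (d * B\<^sup>2) * \<epsilon>\<^sup>2 \<le> real m * \<epsilon>\<^sup>2" using m(1) by (intro mult_right_mono) auto
    moreover have "B\<^sup>2 * \<epsilon>\<^sup>2 = L\<^sup>2" using \<epsilon> by (simp add: B_def power_divide)
    ultimately have "72 * (d * L\<^sup>2) \<le> real m * \<epsilon>\<^sup>2" by (simp add: mult.assoc)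
    then have "36 * d * L\<^sup>2 / real m \<le> \<epsilon>\<^sup>2 / 2" using m72 by (simp add: pos_divide_le_eq mult_ac)
    with 1 show ?thesis by linarith
  qed
  have QXY: "Q \<le> 312 * X + 156 * Y"
  proof -
    have "Q = 4 * W * (d * L / (\<delta> * \<epsilon>\<^sup>2)) * w" using \<delta> d L w by (simp add: Q_def \<eta>_def)
    also have "\<dots> \<le> 4 * W * (d * L / (\<delta> * \<epsilon>\<^sup>2)) * (13 * (s * B))"
      using W0 d L \<delta> w13 by (intro mult_left_mono) auto
    also have "\<dots> = 52 * (R * \<sigma> / t) * (d * L / (\<delta> * \<epsilon>\<^sup>2)) * (s * B) + 156 * (\<delta> * L) * (d * L / (\<delta> * \<epsilon>\<^sup>2)) * (s * B)"
      by (simp add: W_def algebra_simps)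
    also have "156 * (\<delta> * L) * (d * L / (\<delta> * \<epsilon>\<^sup>2)) * (s * B) = 156 * Y"
      using \<delta> \<epsilon> by (simp add: Y B_def power2_eq_square power3_eq_cube)
    also have "52 * (R * \<sigma> / t) * (d * L / (\<delta> * \<epsilon>\<^sup>2)) * (s * B) = 312 * (Z / t)"
    proof -
      have "52 * (R * \<sigma> / t) * (d * L / (\<delta> * \<epsilon>\<^sup>2)) * (s * B) = 312 * (R * ((s * s) * d) * L ^ 3 / (\<delta> * \<epsilon> ^ 3) / t)"
        using \<epsilon> by (simp add: \<sigma>_def B_def power2_eq_square power3_eq_cube mult_ac)
      then show ?thesis by (simp add: Z_def s(2) power2_eq_square)
    qed
    also have "312 * (Z / t) \<le> 312 * X" using Zt t(1) by (simp add: pos_divide_le_eq)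
    finally show ?thesis by simp
  qed
  have "2 * real T0 + 6 * real (m * k) \<le> 2 * (X + 2) + 6 * (Q + 2 * (73 * (d * B\<^sup>2)))"
    by (intro add_mono mult_left_mono T0(3) order_trans[OF k(3)] add_left_mono m(2)) auto
  also have "\<dots> \<le> 10 ^ 6 * (Y + X)" using QXY dB X0 by simp
  finally have calls: "2 * real T0 + 6 * real (m * k) \<le> 10 ^ 6 * (Y + X)" .
  have "m \<ge> 1" using m72 by simp
  then show thesis
    using that[OF \<eta>0 \<eta> T0(1) _ k(1) cond acc] calls unfolding X_def Y_def by blast
qed

section \<open>The two-phase algorithm\<close>

text \<open>The integral inequality for \<open>distr\<close> bounds the total mass by 1 for every
  map \<open>h\<close>, so the laws of both phases are subprobabilities.\<close>

lemma distr_in_subprob_algebra: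
  assumes "prob_space M"
  shows "distr M (borel :: 'b::topological_space measure) h \<in> space (subprob_algebra borel)"
proof -
  interpret M: prob_space M by fact
  have "(\<integral>\<^sup>+x. 1 \<partial>distr M (borel :: 'b measure) h) \<le> (\<integral>\<^sup>+x. 1 \<partial>M)"
    by (rule nn_integral_distr_le) auto
  then have "emeasure (distr M borel h) (space (distr M (borel :: 'b measure) h)) \<le> 1"
    by (simp add: M.emeasure_space_1)
  then have "subprob_space (distr M (borel :: 'b measure) h)" by (intro subprob_spaceI) auto
  then show ?thesis by (simp add: space_subprob_algebra)
qed

lemma subprob_nn_integral_le_const:
  assumes "M \<in> space (subprob_algebra N)" and "\<And>x. g x \<le> c"
  shows "(\<integral>\<^sup>+x. g x \<partial>M) \<le> c"
proof -
  interpret M: subprob_space M using assms(1) by (simp add: space_subprob_algebra)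
  have "(\<integral>\<^sup>+x. g x \<partial>M) \<le> (\<integral>\<^sup>+x. c \<partial>M)" by (intro nn_integral_mono assms(2))
  also have "\<dots> \<le> c * 1" unfolding nn_integral_const by (intro mult_left_mono M.emeasure_space_le_1) simp
  finally show ?thesis by simp
qed

context stochastic_objective
begin

lemma gfm_in_subprob: "gfm \<Xi> F \<rho> \<eta> T x0 \<in> space (subprob_algebra borel)"
  unfolding gfm_def
  by (intro distr_in_subprob_algebra prob_space_pair prob_space_PiM prob_space_samples measure_pmf.prob_space_axioms)

lemma gfm_plus_in_subprob: "gfm_plus \<Xi> F \<rho> \<eta> T m b b' x1 \<in> space (subprob_algebra borel)"
  unfolding gfm_plus_def
  by (intro distr_in_subprob_algebra prob_space_pair prob_space_PiM prob_space_samples measure_pmf.prob_space_axioms)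

lemma space_gfm: "space (gfm \<Xi> F \<rho> \<eta> T x0) = UNIV"
  by (simp add: gfm_def)

lemma ws_nn_integral_le:
  assumes "g \<in> borel_measurable borel"
  shows "(\<integral>\<^sup>+x. g x \<partial>ws_gfm_plus \<Xi> F \<rho>0 \<eta>0 T0 \<rho> \<eta> T m b b' x0)
    \<le> (\<integral>\<^sup>+x1. \<integral>\<^sup>+x. g x \<partial>gfm_plus \<Xi> F \<rho> \<eta> T m b b' x1 \<partial>gfm \<Xi> F \<rho>0 \<eta>0 T0 x0)"
  unfolding ws_gfm_plus_def
  by (rule nn_integral_bind_le[OF _ gfm_plus_in_subprob assms]) (simp add: space_gfm)

lemma sets_ws: "sets (ws_gfm_plus \<Xi> F \<rho>0 \<eta>0 T0 \<rho> \<eta> T m b b' x0) = sets borel"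
  unfolding ws_gfm_plus_def
  by (rule sets_bind_subprob[OF _ gfm_plus_in_subprob]) (simp add: space_gfm)

text \<open>A finite nonnegative integral of a measurable function supplies the integrability that
  stationarity in expectation demands.\<close>

lemma goldstein_stationaryI:
  assumes \<delta>: "\<delta> > 0" and \<epsilon>: "\<epsilon> \<ge> 0" and sets: "sets M = sets borel"
    and le: "(\<integral>\<^sup>+x. ennreal (infdist 0 (goldstein_subdiff f \<delta> x)) \<partial>M) \<le> ennreal \<epsilon>"
  shows "goldstein_stationary_in_expectation f \<delta> \<epsilon> M"
proof -
  let ?\<Psi> = "\<lambda>x. infdist 0 (goldstein_subdiff f \<delta> x)"
  have meas: "?\<Psi> \<in> borel_measurable M"
    unfolding measurable_cong_sets[OF sets refl] by (rule borel_measurable_infdist_goldstein[OF \<delta>])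
  have int: "integrable M ?\<Psi>"
    by (rule integrableI_nonneg[OF meas]) (use le_less_trans[OF le] in \<open>simp_all add: infdist_nonneg\<close>)
  have "ennreal (\<integral>x. ?\<Psi> x \<partial>M) \<le> ennreal \<epsilon>"
    using le nn_integral_eq_integral[OF int] by (simp add: infdist_nonneg)
  then have "(\<integral>x. ?\<Psi> x \<partial>M) \<le> \<epsilon>" using \<epsilon> by (simp add: ennreal_le_iff)
  with int show ?thesis unfolding goldstein_stationary_in_expectation_def by blast
qed

lemma psi_measurable:
  "\<delta> > 0 \<Longrightarrow> (\<lambda>x. ennreal (infdist 0 (goldstein_subdiff f \<delta> x))) \<in> borel_measurable borel"
  by (rule measurable_compose[OF borel_measurable_infdist_goldstein measurable_ennreal])

lemma ws_stationary_large:
  assumes \<delta>: "\<delta> > 0" and "L \<le> \<epsilon>"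
  shows "goldstein_stationary_in_expectation f \<delta> \<epsilon> (ws_gfm_plus \<Xi> F \<rho>0 \<eta>0 T0 \<rho> \<eta> T m b b' x0)"
proof (rule goldstein_stationaryI[OF \<delta> _ sets_ws])
  have "ennreal (infdist 0 (goldstein_subdiff f \<delta> x)) \<le> ennreal \<epsilon>" for x
    using infdist_goldstein_le_L[OF \<delta>, of x] assms(2) by (intro ennreal_leI) linarith
  then show "(\<integral>\<^sup>+x. ennreal (infdist 0 (goldstein_subdiff f \<delta> x)) \<partial>ws_gfm_plus \<Xi> F \<rho>0 \<eta>0 T0 \<rho> \<eta> T m b b' x0) \<le> ennreal \<epsilon>"
    by (intro order_trans[OF ws_nn_integral_le[OF psi_measurable[OF \<delta>]]]
        subprob_nn_integral_le_const[OF gfm_in_subprob] subprob_nn_integral_le_const[OF gfm_plus_in_subprob])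
qed (use L_pos assms(2) in simp)

text \<open>The second phase bounds the mean squared gradient affinely in the gap of its starting
  point, so the expected gap of the first phase can be inserted. Averaging the AM-GM bound then
  gives at most \<open>\<epsilon> / 2 + \<epsilon>\<^sup>2 / (2 * \<epsilon>)\<close>.\<close>

lemma ws_stationary:
  assumes \<rho>0: "\<rho>0 > 0" and \<eta>0: "\<eta>0 > 0" and \<delta>: "\<delta> > 0" and \<eta>: "\<eta> > 0" and \<epsilon>: "\<epsilon> > 0"
    and T0: "T0 \<ge> 1" and m: "m \<ge> 1" and k: "k \<ge> 1" and b: "b \<ge> 1" and b': "b' \<ge> 1"
    and cond: "2 * (real DIM('a) * L / \<delta>) * \<eta> + real m * (real DIM('a) * L / \<delta> * \<eta>)\<^sup>2 / real b \<le> 1"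
    and xs: "\<And>y. f xs \<le> f y"
    and acc: "2 / \<eta> / real (m * k) * (((norm (x0 - xs))\<^sup>2 / (2 * \<eta>0) / real T0 + (18 * real DIM('a) * L\<^sup>2 * \<eta>0 + \<rho>0 * L)) + \<delta> * L)
      + 36 * real DIM('a) * L\<^sup>2 / real b' \<le> \<epsilon>\<^sup>2"
  shows "goldstein_stationary_in_expectation f \<delta> \<epsilon> (ws_gfm_plus \<Xi> F \<rho>0 \<eta>0 T0 \<delta> \<eta> (m * k) m b b' x0)"
proof (rule goldstein_stationaryI[OF \<delta> _ sets_ws])
  let ?M1 = "gfm \<Xi> F \<rho>0 \<eta>0 T0 x0" and ?M2 = "gfm_plus \<Xi> F \<delta> \<eta> (m * k) m b b'"
  define c1 c2 where "c1 = 2 / \<eta> / real (m * k)" and "c2 = c1 * (\<delta> * L) + 36 * real DIM('a) * L\<^sup>2 / real b'"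
  define \<Delta> where "\<Delta> = (norm (x0 - xs))\<^sup>2 / (2 * \<eta>0) / real T0 + (18 * real DIM('a) * L\<^sup>2 * \<eta>0 + \<rho>0 * L)"
  have c: "c1 \<ge> 0" "c2 \<ge> 0" using \<eta> \<delta> L_pos by (simp_all add: c1_def c2_def)
  have \<Delta>: "\<Delta> \<ge> 0" using \<eta>0 \<rho>0 L_pos by (simp add: \<Delta>_def)
  have gap0: "f x - f xs \<ge> 0" for x using xs[of x] by simp
  have G2_m: "(\<lambda>x. ennreal ((norm (smoothing_grad \<delta> x))\<^sup>2)) \<in> borel_measurable borel"
    by (intro measurable_compose[OF _ measurable_ennreal] borel_measurable_power measurable_compose[OF _ borel_measurable_norm]
        smoothing_grad_measurable \<delta>)
  have gap_m: "(\<lambda>x. ennreal (f x - f xs)) \<in> borel_measurable borel"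
    by (intro measurable_compose[OF _ measurable_ennreal] borel_measurable_diff borel_measurable_const borel_measurable)
  have inner: "(\<integral>\<^sup>+x. ennreal (infdist 0 (goldstein_subdiff f \<delta> x)) \<partial>?M2 x1)
      \<le> ennreal (\<epsilon> / 2) + ennreal (1 / (2 * \<epsilon>)) * (ennreal c1 * ennreal (f x1 - f xs) + ennreal c2)" for x1
  proof -
    have sets2: "sets (?M2 x1) = sets borel" by (simp add: gfm_plus_def)
    \<comment> \<open>AM-GM replaces the norm by its square.\<close>
    have pt: "ennreal (infdist 0 (goldstein_subdiff f \<delta> x))
        \<le> ennreal (\<epsilon> / 2) + ennreal (1 / (2 * \<epsilon>)) * ennreal ((norm (smoothing_grad \<delta> x))\<^sup>2)" for x
    proof -
      let ?n = "norm (smoothing_grad \<delta> x)"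
      have "0 \<le> (?n - \<epsilon>)\<^sup>2 / (2 * \<epsilon>)" using \<epsilon> by simp
      also have "(?n - \<epsilon>)\<^sup>2 / (2 * \<epsilon>) = \<epsilon> / 2 + 1 / (2 * \<epsilon>) * ?n\<^sup>2 - ?n"
        using \<epsilon> by (simp add: power2_eq_square field_simps)
      finally have "infdist 0 (goldstein_subdiff f \<delta> x) \<le> \<epsilon> / 2 + 1 / (2 * \<epsilon>) * ?n\<^sup>2"
        using infdist_goldstein_le[OF \<delta>, of x] by linarith
      then have "ennreal (infdist 0 (goldstein_subdiff f \<delta> x)) \<le> ennreal (\<epsilon> / 2 + 1 / (2 * \<epsilon>) * ?n\<^sup>2)"
        by (rule ennreal_leI)
      also have "\<dots> = ennreal (\<epsilon> / 2) + ennreal (1 / (2 * \<epsilon>) * ?n\<^sup>2)"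
        using \<epsilon> by (intro ennreal_plus) auto
      also have "ennreal (1 / (2 * \<epsilon>) * ?n\<^sup>2) = ennreal (1 / (2 * \<epsilon>)) * ennreal (?n\<^sup>2)"
        using \<epsilon> by (intro ennreal_mult) auto
      finally show ?thesis .
    qed
    have G2_m': "(\<lambda>x. ennreal ((norm (smoothing_grad \<delta> x))\<^sup>2)) \<in> borel_measurable (?M2 x1)"
      unfolding measurable_cong_sets[OF sets2 refl] by (rule G2_m)
    have "(\<integral>\<^sup>+x. ennreal (infdist 0 (goldstein_subdiff f \<delta> x)) \<partial>?M2 x1)
        \<le> (\<integral>\<^sup>+x. ennreal (\<epsilon> / 2) + ennreal (1 / (2 * \<epsilon>)) * ennreal ((norm (smoothing_grad \<delta> x))\<^sup>2) \<partial>?M2 x1)"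
      by (intro nn_integral_mono pt)
    also have "\<dots> = (\<integral>\<^sup>+x. ennreal (\<epsilon> / 2) \<partial>?M2 x1)
        + (\<integral>\<^sup>+x. ennreal (1 / (2 * \<epsilon>)) * ennreal ((norm (smoothing_grad \<delta> x))\<^sup>2) \<partial>?M2 x1)"
      by (intro nn_integral_add borel_measurable_const borel_measurable_times_ennreal G2_m')
    also have "(\<integral>\<^sup>+x. ennreal (1 / (2 * \<epsilon>)) * ennreal ((norm (smoothing_grad \<delta> x))\<^sup>2) \<partial>?M2 x1)
        = ennreal (1 / (2 * \<epsilon>)) * (\<integral>\<^sup>+x. ennreal ((norm (smoothing_grad \<delta> x))\<^sup>2) \<partial>?M2 x1)"
      by (rule nn_integral_cmult[OF G2_m'])
    finally have 1: "(\<integral>\<^sup>+x. ennreal (infdist 0 (goldstein_subdiff f \<delta> x)) \<partial>?M2 x1)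
        \<le> (\<integral>\<^sup>+x. ennreal (\<epsilon> / 2) \<partial>?M2 x1)
          + ennreal (1 / (2 * \<epsilon>)) * (\<integral>\<^sup>+x. ennreal ((norm (smoothing_grad \<delta> x))\<^sup>2) \<partial>?M2 x1)" .
    have 2: "(\<integral>\<^sup>+x. ennreal (\<epsilon> / 2) \<partial>?M2 x1) \<le> ennreal (\<epsilon> / 2)"
      by (rule subprob_nn_integral_le_const[OF gfm_plus_in_subprob]) simp
    have "2 / \<eta> * (f x1 + \<delta> * L - f xs) / real (m * k) + 36 * real DIM('a) * L\<^sup>2 / real b' = c1 * (f x1 - f xs) + c2"
    proof -
      have "2 / \<eta> * (f x1 + \<delta> * L - f xs) / real (m * k) = c1 * ((f x1 - f xs) + \<delta> * L)"
        unfolding c1_def times_divide_eq_left by (simp only: diff_add_eq)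
      then show ?thesis unfolding c2_def by (simp only: distrib_left add.assoc)
    qed
    then have 3: "(\<integral>\<^sup>+x. ennreal ((norm (smoothing_grad \<delta> x))\<^sup>2) \<partial>?M2 x1) \<le> ennreal (c1 * (f x1 - f xs) + c2)"
      using gfm_plus_gradient[OF \<delta> \<eta> m b b' k cond xs, of x1] by (simp only:)
    have 4: "ennreal (c1 * (f x1 - f xs) + c2) = ennreal c1 * ennreal (f x1 - f xs) + ennreal c2"
      using ennreal_plus[OF mult_nonneg_nonneg[OF c(1) gap0] c(2)] ennreal_mult[OF c(1) gap0] by (simp only:)
    show ?thesis
      by (rule order_trans[OF 1]) (intro add_mono 2 mult_left_mono 3[unfolded 4]; simp)
  qed
  have sets1: "sets ?M1 = sets borel" by (simp add: gfm_def)
  have gap_m': "(\<lambda>x. ennreal (f x - f xs)) \<in> borel_measurable ?M1"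
    unfolding measurable_cong_sets[OF sets1 refl] by (rule gap_m)
  let ?e = "ennreal (1 / (2 * \<epsilon>))"
  have "(\<integral>\<^sup>+x. ennreal (infdist 0 (goldstein_subdiff f \<delta> x)) \<partial>ws_gfm_plus \<Xi> F \<rho>0 \<eta>0 T0 \<delta> \<eta> (m * k) m b b' x0)
      \<le> (\<integral>\<^sup>+x1. ennreal (\<epsilon> / 2) + ?e * (ennreal c1 * ennreal (f x1 - f xs) + ennreal c2) \<partial>?M1)"
    by (rule order_trans[OF ws_nn_integral_le[OF psi_measurable[OF \<delta>]]]) (intro nn_integral_mono inner)
  also have "\<dots> = (\<integral>\<^sup>+x1. (ennreal (\<epsilon> / 2) + ?e * ennreal c2) + (?e * ennreal c1) * ennreal (f x1 - f xs) \<partial>?M1)"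
    by (intro nn_integral_cong) (simp add: distrib_left ac_simps)
  also have "\<dots> = (\<integral>\<^sup>+x1. ennreal (\<epsilon> / 2) + ?e * ennreal c2 \<partial>?M1) + (?e * ennreal c1) * (\<integral>\<^sup>+x1. ennreal (f x1 - f xs) \<partial>?M1)"
    by (subst nn_integral_add[OF borel_measurable_const borel_measurable_times_ennreal[OF borel_measurable_const gap_m']])
      (simp only: nn_integral_cmult[OF gap_m'])
  also have "\<dots> \<le> (ennreal (\<epsilon> / 2) + ?e * ennreal c2) + (?e * ennreal c1) * ennreal \<Delta>"
  proof (intro add_mono mult_left_mono)
    show "(\<integral>\<^sup>+x1. ennreal (\<epsilon> / 2) + ?e * ennreal c2 \<partial>?M1) \<le> ennreal (\<epsilon> / 2) + ?e * ennreal c2"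
      by (rule subprob_nn_integral_le_const[OF gfm_in_subprob]) simp
    show "(\<integral>\<^sup>+x1. ennreal (f x1 - f xs) \<partial>?M1) \<le> ennreal \<Delta>"
      unfolding \<Delta>_def by (rule gfm_gap[OF \<rho>0 \<eta>0 T0 xs])
  qed simp
  also have "\<dots> = ennreal (\<epsilon> / 2 + 1 / (2 * \<epsilon>) * (c1 * \<Delta> + c2))"
  proof -
    have e: "0 \<le> 1 / (2 * \<epsilon>)" "0 \<le> \<epsilon> / 2" using \<epsilon> by auto
    have "ennreal (\<epsilon> / 2) + ?e * ennreal c2 + ?e * ennreal c1 * ennreal \<Delta>
        = ennreal (\<epsilon> / 2) + ennreal (1 / (2 * \<epsilon>) * c2) + ennreal (1 / (2 * \<epsilon>) * c1 * \<Delta>)"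
      by (simp only: ennreal_mult[OF e(1) c(2)] ennreal_mult[OF e(1) c(1)] ennreal_mult[OF mult_nonneg_nonneg[OF e(1) c(1)] \<Delta>])
    also have "\<dots> = ennreal (\<epsilon> / 2 + 1 / (2 * \<epsilon>) * c2 + 1 / (2 * \<epsilon>) * c1 * \<Delta>)"
      using e c \<Delta> by (simp only: ennreal_plus mult_nonneg_nonneg add_nonneg_nonneg)
    also have "\<epsilon> / 2 + 1 / (2 * \<epsilon>) * c2 + 1 / (2 * \<epsilon>) * c1 * \<Delta> = \<epsilon> / 2 + 1 / (2 * \<epsilon>) * (c1 * \<Delta> + c2)"
      by (simp add: distrib_left)
    finally show ?thesis .
  qed
  also have "\<dots> \<le> ennreal \<epsilon>"
  proof (rule ennreal_leI)
    have "c1 * \<Delta> + c2 \<le> \<epsilon>\<^sup>2"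
      using acc unfolding c2_def c1_def[symmetric] \<Delta>_def[symmetric] by (simp only: distrib_left add.assoc)
    then have "1 / (2 * \<epsilon>) * (c1 * \<Delta> + c2) \<le> 1 / (2 * \<epsilon>) * \<epsilon>\<^sup>2" using \<epsilon> by (intro mult_left_mono) auto
    also have "\<dots> = \<epsilon> / 2" using \<epsilon> by (simp add: power2_eq_square)
    finally show "\<epsilon> / 2 + 1 / (2 * \<epsilon>) * (c1 * \<Delta> + c2) \<le> \<epsilon>" by linarith
  qed
  finally show "(\<integral>\<^sup>+x. ennreal (infdist 0 (goldstein_subdiff f \<delta> x)) \<partial>ws_gfm_plus \<Xi> F \<rho>0 \<eta>0 T0 \<delta> \<eta> (m * k) m b b' x0) \<le> ennreal \<epsilon>" .
qed (use \<epsilon> in simp)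

text \<open>Continuity makes the set of minimisers closed, so \<open>gfm_gap\<close> can be applied
  to a nearest minimiser.\<close>

lemma argmin_attains_infdist:
  assumes "argmin_set f \<noteq> {}"
  obtains xs where "\<And>y. f xs \<le> f y" "norm (x0 - xs) = infdist x0 (argmin_set f)"
proof -
  have "argmin_set f = (\<Inter>y. {x. f x \<le> f y})" by (auto simp: argmin_set_def)
  moreover have "closed {x. f x \<le> f y}" for y
    using continuous[of UNIV] by (intro closed_Collect_le continuous_on_const)
  ultimately have "closed (argmin_set f)" by auto
  then obtain xs where "xs \<in> argmin_set f" "infdist x0 (argmin_set f) = dist x0 xs"
    using infdist_attains_inf[OF _ assms] by blast
  then show thesis using that[of xs] by (auto simp: argmin_set_def dist_norm)
qed

end

text \<open>The parameters are quantified before the law, the components and the starting point, so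
  they depend only on the dimension, \<open>L\<close>, \<open>R\<close>, \<open>\<delta>\<close> and
  \<open>\<epsilon>\<close>. The restriction \<open>\<epsilon> \<le> L\<close> on the cost bound is
  the small-accuracy regime of the asymptotic notation.\<close>

theorem theorem3:
  fixes L R \<delta> \<epsilon> :: real
  assumes "L > 0" and "R \<ge> 0" and "\<delta> > 0" and "\<epsilon> > 0"
  shows "\<exists>\<rho>0 \<eta>0 \<rho> \<eta> :: real. \<exists>T0 T m b b' :: nat.
    \<rho>0 > 0 \<and> \<eta>0 > 0 \<and> \<rho> > 0 \<and> \<eta> > 0 \<and> T0 \<ge> 1 \<and> T \<ge> 1 \<and> m \<ge> 1 \<and> b \<ge> 1 \<and> b' \<ge> 1 \<and>
    (\<epsilon> \<le> L \<longrightarrow>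
      real (ws_gfm_plus_calls T0 T m b b') \<le>
        complexity_const *
          (real CARD('n::finite) powr (3/2) * L ^ 3 / \<epsilon> ^ 3 +
           real CARD('n) powr (4/3) * L\<^sup>2 * R powr (2/3) / (\<delta> powr (2/3) * \<epsilon>\<^sup>2))) \<and>
    (\<forall>(\<Xi> :: 'x measure) (F :: real ^ 'n \<Rightarrow> 'x \<Rightarrow> real) (Lc :: 'x \<Rightarrow> real) (x0 :: real ^ 'n).
      mean_square_lipschitz \<Xi> F Lc L \<longrightarrow>
      convex_on UNIV (expected_objective \<Xi> F) \<longrightarrow>
      argmin_set (expected_objective \<Xi> F) \<noteq> {} \<longrightarrow>
      infdist x0 (argmin_set (expected_objective \<Xi> F)) = R \<longrightarrow>
      goldstein_stationary_in_expectation (expected_objective \<Xi> F) \<delta> \<epsilon>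
        (ws_gfm_plus \<Xi> F \<rho>0 \<eta>0 T0 \<rho> \<eta> T m b b' x0))"
proof (cases "L \<le> \<epsilon>")
  \<comment> \<open>Every output is stationary, so one iteration per phase with unit parameters will
    do. The cost bound is at stake only for \<open>\<epsilon> = L\<close>, where its first term is
    at least 1 and only 4 calls are made.\<close>
  case True
  let ?d = "real CARD('n)"
  have calls: "real (ws_gfm_plus_calls 1 1 1 1 1) \<le> complexity_const *
      (?d powr (3/2) * L ^ 3 / \<epsilon> ^ 3 + ?d powr (4/3) * L\<^sup>2 * R powr (2/3) / (\<delta> powr (2/3) * \<epsilon>\<^sup>2))"
    if "\<epsilon> \<le> L"
  proof -
    have "\<epsilon> = L" using True that by simp
    have d1: "1 \<le> ?d" by (simp add: Suc_leI)
    have "1 \<le> ?d powr (3/2)" using d1 by (simp add: ge_one_powr_ge_zero)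
    also have "\<dots> = ?d powr (3/2) * L ^ 3 / \<epsilon> ^ 3" using \<open>\<epsilon> = L\<close> \<open>L > 0\<close> by simp
    also have "\<dots> \<le> ?d powr (3/2) * L ^ 3 / \<epsilon> ^ 3 + ?d powr (4/3) * L\<^sup>2 * R powr (2/3) / (\<delta> powr (2/3) * \<epsilon>\<^sup>2)"
      by simp
    finally show ?thesis
      by (simp add: ws_gfm_plus_calls_def gfm_calls_def gfm_plus_calls_def complexity_const_def)
  qed
  have stat: "goldstein_stationary_in_expectation (expected_objective \<Xi> F) \<delta> \<epsilon> (ws_gfm_plus \<Xi> F 1 1 1 1 1 1 1 1 1 x0)"
    if "mean_square_lipschitz \<Xi> F Lc L" "convex_on UNIV (expected_objective \<Xi> F)"
    for \<Xi> :: "'x measure" and F :: "real ^ 'n \<Rightarrow> 'x \<Rightarrow> real" and Lc x0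
  proof -
    interpret stochastic_objective \<Xi> F Lc L by (unfold_locales) (use that assms in auto)
    show ?thesis by (rule ws_stationary_large[OF \<open>\<delta> > 0\<close> True])
  qed
  show ?thesis
    by (intro exI[where x=1] conjI impI allI) (rule zero_less_one order_refl calls stat | assumption)+
next
  case False
  then have "\<epsilon> < L" by simp
  have d1: "1 \<le> real CARD('n)" by (simp add: Suc_leI)
  obtain \<eta>0 \<eta> :: real and T0 m k :: nat where p: "\<eta>0 > 0" "\<eta> > 0" "T0 \<ge> 1" "m \<ge> 1" "k \<ge> 1"
    and cond: "2 * (real CARD('n) * L / \<delta>) * \<eta> + real m * (real CARD('n) * L / \<delta> * \<eta>)\<^sup>2 \<le> 1"
    and acc: "2 / \<eta> / real (m * k) * ((R\<^sup>2 / (2 * \<eta>0) / real T0 + (18 * real CARD('n) * L\<^sup>2 * \<eta>0 + \<delta> * L)) + \<delta> * L)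
      + 36 * real CARD('n) * L\<^sup>2 / real m \<le> \<epsilon>\<^sup>2"
    and calls: "2 * real T0 + 6 * real (m * k) \<le> 10 ^ 6 * (real CARD('n) powr (3/2) * L ^ 3 / \<epsilon> ^ 3 +
      real CARD('n) powr (4/3) * L\<^sup>2 * R powr (2/3) / (\<delta> powr (2/3) * \<epsilon>\<^sup>2))"
    by (rule parameter_choice[OF assms \<open>\<epsilon> < L\<close> d1])
  have stat: "goldstein_stationary_in_expectation (expected_objective \<Xi> F) \<delta> \<epsilon>
      (ws_gfm_plus \<Xi> F \<delta> \<eta>0 T0 \<delta> \<eta> (m * k) m 1 m x0)"
    if A: "mean_square_lipschitz \<Xi> F Lc L" "convex_on UNIV (expected_objective \<Xi> F)"
      "argmin_set (expected_objective \<Xi> F) \<noteq> {}" "infdist x0 (argmin_set (expected_objective \<Xi> F)) = R"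
    for \<Xi> :: "'x measure" and F :: "real ^ 'n \<Rightarrow> 'x \<Rightarrow> real" and Lc x0
  proof -
    interpret stochastic_objective \<Xi> F Lc L by (unfold_locales) (use A assms in auto)
    obtain xs where xs: "\<And>y. f xs \<le> f y" "norm (x0 - xs) = R"
      using argmin_attains_infdist[OF A(3), of x0] A(4) by metis
    have dim: "DIM(real ^ 'n) = CARD('n)" by simp
    show ?thesis
      by (rule ws_stationary[OF \<open>\<delta> > 0\<close> p(1) \<open>\<delta> > 0\<close> p(2) \<open>\<epsilon> > 0\<close> p(3,4,5) _ p(4) _ xs(1)])
        (use cond acc in \<open>simp_all only: dim xs(2) of_nat_1 div_by_1 order_refl\<close>)
  qed
  have T: "m * k \<ge> 1" using p by simp
  have "real (ws_gfm_plus_calls T0 (m * k) m 1 m) \<le> complexity_const *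
      (real CARD('n) powr (3/2) * L ^ 3 / \<epsilon> ^ 3 +
       real CARD('n) powr (4/3) * L\<^sup>2 * R powr (2/3) / (\<delta> powr (2/3) * \<epsilon>\<^sup>2))"
    unfolding complexity_const_def by (rule order_trans[OF ws_gfm_plus_calls_le[OF p(4)] calls])
  note facts = this T p assms stat order_refl
  \<comment> \<open>Both phases smooth at radius \<open>\<delta>\<close>. Single samples between the
    restarts suffice, with restart batches as large as the period \<open>m\<close>.\<close>
  show ?thesis
    by (rule exI[of _ \<delta>], rule exI[of _ \<eta>0], rule exI[of _ \<delta>], rule exI[of _ \<eta>],
        rule exI[of _ T0], rule exI[of _ "m * k"], rule exI[of _ m], rule exI[of _ 1], rule exI[of _ m],
        intro conjI impI allI) (rule facts | assumption)+
qed

end
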